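(* Let $\widetilde{\mathcal F}$, $\widetilde\Delta$, $I_\varepsilon$, $\mathcal F=\widetilde{\mathcal F}/I_\varepsilon$ and the power series $A$ be as defined in the context (so $\mathcal F$ is the algebra of functions on the Poisson-Lie group $SL(2,\mathbb R)^*$ generated by $x_1,x_2,x_3,e^{\pm x_1}$, quantized by the gauge-transformed Kontsevich product). Then $\widetilde\Delta$ is coassociative and descends to a well-defined coproduct $\Delta$ on $\mathcal F$, and the resulting bialgebra $\mathcal F$ is isomorphic to the quantum universal enveloping algebra $U_h(sl(2,\mathbb R))$. Explicitly: put $h=2\varepsilon$ and write $\mathcal F$ in the new coordinates $z_1,z_2,z_3$ given by $$x_1=\varepsilon z_1,\qquad x_2=\sqrt{2\varepsilon A(\varepsilon^2)\sinh(h)}\;z_2,\qquad x_3=\sqrt{2\varepsilon A(\varepsilon^2)\sinh(h)}\;z_3 ,$$ so that $e^{\pm x_1}=e^{\pm hz_1/2}$. Then the commutation relations become $$[z_1,z_2]=2z_2,\qquad[z_1,z_3]=-2z_3,\qquad[z_2,z_3]=\frac{\sinh(hz_1)}{\sinh(h)},$$ $$e^{\pm hz_1/2}*z_2=e^{\pm h}z_2*e^{\pm hz_1/2},\qquad e^{\pm hz_1/2}*z_3=e^{\mp h}z_3*e^{\pm hz_1/2},\qquad[z_1,e^{\pm hz_1/2}]=0,$$ and the coproduct becomes $$\Delta z_1=1\otimes z_1+z_1\otimes1,\qquad \Delta z_j=z_j\otimes e^{-hz_1/2}+e^{hz_1/2}\otimes z_j\ (j=2,3),\qquad \Delta e^{\pm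 hz_1/2}=e^{\pm hz_1/2}\otimes e^{\pm hz_1/2};$$ that is, $z_1,z_2,z_3$ are the generators of $U_h(sl(2,\mathbb R))$.
   Context: Poisson-Lie group. $SL(2,\mathbb R)^*=\left\{\left[\begin{pmatrix}a^{-1}&0\\ b&a\end{pmatrix},\begin{pmatrix}a&c\\0&a^{-1}\end{pmatrix}\right]: a\in\mathbb R_{>0},\ b,c\in\mathbb R\right\}\subset SL(2,\mathbb R)\times SL(2,\mathbb R)$, with global coordinates $x_1=\ln a$, $x_2=-b$, $x_3=c$ and (up to normalization by a constant factor) Poisson bivector field $$\alpha=x_2\,\partial_1\wedge\partial_2-x_3\,\partial_1\wedge\partial_3+4\sinh(2x_1)\,\partial_2\wedge\partial_3,\qquad u\wedge v=u\otimes v-v\otimes u .$$ Kontsevich product. Write $\alpha=\sum_{i,j}\alpha^{ij}\partial_i\otimes\partial_j$. For $n\ge 0$, $G_n$ is the set of labelled directed graphs with vertices $1,\dots,n,L,R$ such that exactly two ordered edges $e_k^1,e_k^2$ start at each vertex $k\in\{1,\dots,n\}$, ending at two distinct vertices different from $k$, and no edges start at $L,R$. For $\Gamma\in G_n$, $$B_{\Gamma,\alpha}(f,g)=\sum_{I:E_\Gamma\to\{1,2,3\}}\Big[\prod_{k=1}^n\Big(\prod_{e\to k}\partial_{I(e)}\Big)\alpha^{I(e_k^1)I(e_k^2)}\Big]\Big(\prod_{e\to L}\partial_{I(e)}\Big)f\,\Big(\prod_{e\to R}\partial_{I(e)}\Big)g,$$ $$\omega_\Gamma=\frac1{n!(2\pi)^{2n}}\int\bigwedge_{k=1}^n\big(d\phi_{e_k^1}\wedge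 d\phi_{e_k^2}\big),$$ where $E_\Gamma$ is the set of edges of $\Gamma$, the integral being over configurations of $n$ distinct points of the upper half plane placed at the vertices $1,\dots,n$, with $L=0$, $R=1$, and $\phi_{(p,q)}=\arg\frac{q-p}{q-\bar p}$. Kontsevich's product is $f*_{old}g=\sum_{n\ge0}\varepsilon^n\sum_{\Gamma\in G_n}\omega_\Gamma B_{\Gamma,\alpha}(f,g)$. The gauge-transformed product is $f*g=D^{-1}(Df*_{old}Dg)$, where $D=\sum_{m\ge 0\text{ even}}a_m\varepsilon^m\partial_1^m$ ($a_m\in\mathbb R$, $a_0=1$) is chosen such that the $n$-fold product $x_1*\cdots*x_1$ equals $x_1^n$ for all $n$. For this product there is a formal power series $A(\varepsilon^2)\in\mathbb R[[\varepsilon^2]]$ (with $A(0)=4$) determined by $x_2*x_3-x_3*x_2=2\varepsilon A(\varepsilon^2)\sinh(2x_1)$. Algebra. $\widetilde{\mathcal F}=\mathbb R\{x_1,x_2,x_3,e^{\pm x_1}\}[[\varepsilon]]$ is the algebra of non-commutative words in the generators $x_1,x_2,x_3,e^{x_1},e^{-x_1}$, with formal parameter $\varepsilon$, where $e^{x_1}*e^{-x_1}=e^{-x_1}*e^{x_1}=1$; its product is written $*$. Put $\sinh(2x_1)=\frac12\big(e^{x_1}*e^{x_1}-e^{-x_1}*e^{-x_1}\big)$ and $[a,b]=a*b-b*a$. $I_\varepsilon$ is the two-sided ideal generated by $$[x_1,x_2]-2\varepsilon x_2,\quad [x_1,x_3]+2\varepsilon x_3,\quad [x_2,x_3]-2\varepsilon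 A(\varepsilon^2)\sinh(2x_1),$$ $$e^{\pm x_1}*x_2-e^{\pm2\varepsilon}x_2*e^{\pm x_1},\quad e^{\pm x_1}*x_3-e^{\mp2\varepsilon}x_3*e^{\pm x_1},\quad [x_1,e^{\pm x_1}].$$ These are the relations satisfied by the corresponding functions under the gauge-transformed product. Coproduct. $\widetilde\Delta:\widetilde{\mathcal F}\to\widetilde{\mathcal F}\otimes\widetilde{\mathcal F}$ is the algebra homomorphism (with respect to $*$) with $$\widetilde\Delta x_1=1\otimes x_1+x_1\otimes1,\quad \widetilde\Delta x_j=x_j\otimes e^{-x_1}+e^{x_1}\otimes x_j\ (j=2,3),\quad \widetilde\Delta e^{\pm x_1}=e^{\pm x_1}\otimes e^{\pm x_1}.$$ On the generators this is the coproduct coming from the group multiplication of $SL(2,\mathbb R)^*$. Quantum universal enveloping algebra. $U_h(sl(2,\mathbb R))$ is the quantum universal enveloping algebra of $sl(2,\mathbb R)$ with deformation parameter $h$: it is the bialgebra generated by $z_1,z_2,z_3$ with relations $[z_1,z_2]=2z_2$, $[z_1,z_3]=-2z_3$, $[z_2,z_3]=\sinh(hz_1)/\sinh(h)$ and coproduct $\Delta z_1=1\otimes z_1+z_1\otimes1$, $\Delta z_j=z_j\otimes e^{-hz_1/2}+e^{hz_1/2}\otimes z_j$ ($j=2,3$).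
   Formalization: F is not literally isomorphic to U_h (F/ε is commutative, U_h/h is not): proved instead are the relations with ε inverted and an injective bialgebra map F→U_h, z_i↦z_i, with h-adically dense image after inverting ε and matching relation ideals; ideals and tensor products are ε-adically completed. *)

theory Defs
  imports
    "HOL-Analysis.Analysis"
    "HOL-Combinatorics.Permutations"
    "HOL-Computational_Algebra.Formal_Laurent_Series"
    "HOL-Library.Poly_Mapping"
    "HOL-Algebra.QuotRing"
    "HOL-Algebra.Algebraic_Closure_Type"
begin

section \<open>Kontsevich's star product and the power series A\<close>

type_synonym point = "real ^ 3"

definition pderiv_dir :: "3 \<Rightarrow> (point \<Rightarrow> real) \<Rightarrow> point \<Rightarrow> real" where
  "pderiv_dir i f p = deriv (\<lambda>t. f (p + t *\<^sub>R axis i 1)) 0"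

definition alpha :: "3 \<Rightarrow> 3 \<Rightarrow> point \<Rightarrow> real" where
  "alpha i j p =
    (if (i, j) = (1, 2) then p $ 2 else if (i, j) = (2, 1) then - (p $ 2)
     else if (i, j) = (1, 3) then - (p $ 3) else if (i, j) = (3, 1) then p $ 3
     else if (i, j) = (2, 3) then 4 * sinh (2 * p $ 1)
     else if (i, j) = (3, 2) then - (4 * sinh (2 * p $ 1)) else 0)"

datatype vertex = Inner nat | VL | VR

text \<open>The edge \<open>e\<^sub>k\<^sup>s\<close> is the pair \<open>(k, s)\<close>, and a graph is the map sending each edge to its end point.\<close>

definition edges :: "nat \<Rightarrow> (nat \<times> nat) set" where
  "edges n = {1..n} \<times> {1, 2}"

definition kgraphs :: "nat \<Rightarrow> (nat \<times> nat \<Rightarrow> vertex) set" where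
  "kgraphs n = {\<Gamma> \<in> edges n \<rightarrow>\<^sub>E (Inner ` {1..n} \<union> {VL, VR}).
     \<forall>k\<in>{1..n}. \<Gamma> (k, 1) \<noteq> \<Gamma> (k, 2) \<and> \<Gamma> (k, 1) \<noteq> Inner k \<and> \<Gamma> (k, 2) \<noteq> Inner k}"

definition edges_into :: "nat \<Rightarrow> (nat \<times> nat \<Rightarrow> vertex) \<Rightarrow> vertex \<Rightarrow> (nat \<times> nat) list" where
  "edges_into n \<Gamma> v = filter (\<lambda>e. \<Gamma> e = v) (List.product [1..<n + 1] [1, 2])"

definition pderivs :: "(nat \<times> nat \<Rightarrow> 3) \<Rightarrow> (nat \<times> nat) list \<Rightarrow> (point \<Rightarrow> real) \<Rightarrow> point \<Rightarrow> real" where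
  "pderivs I es f = foldr (\<lambda>e. pderiv_dir (I e)) es f"

definition B_op :: "nat \<Rightarrow> (nat \<times> nat \<Rightarrow> vertex) \<Rightarrow> (point \<Rightarrow> real) \<Rightarrow> (point \<Rightarrow> real) \<Rightarrow> point \<Rightarrow> real" where
  "B_op n \<Gamma> f g p = (\<Sum>I \<in> edges n \<rightarrow>\<^sub>E (UNIV :: 3 set).
     (\<Prod>k\<in>{1..n}. pderivs I (edges_into n \<Gamma> (Inner k)) (alpha (I (k, 1)) (I (k, 2))) p)
     * pderivs I (edges_into n \<Gamma> VL) f p * pderivs I (edges_into n \<Gamma> VR) g p)"

definition position :: "(nat \<Rightarrow> complex) \<Rightarrow> vertex \<Rightarrow> complex" where
  "position P v = (case v of Inner j \<Rightarrow> P j | VL \<Rightarrow> 0 | VR \<Rightarrow> 1)"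

text \<open>The value of the one-form \<open>d\<phi>\<^sub>e\<close> at the configuration \<open>P\<close>, where \<open>e\<close> goes from \<open>k\<close> to \<open>v\<close>,
  on the tangent vector that moves only the point \<open>P j\<close>, with velocity \<open>u\<close>. The formula is
  \<open>d arg w = Im (dw / w)\<close> for \<open>w = (q - p) / (q - cnj p)\<close>; it avoids the branch cut of the argument.\<close>

definition dphi :: "(nat \<Rightarrow> complex) \<Rightarrow> nat \<Rightarrow> vertex \<Rightarrow> nat \<Rightarrow> complex \<Rightarrow> real" where
  "dphi P k v j u =
    (let p = P k; q = position P v; dp = (if j = k then u else 0); dq = (if v = Inner j then u else 0)
     in Im ((dq - dp) / (q - p) - (dq - cnj dp) / (q - cnj p)))"

text \<open>The \<open>2n\<close>-form is evaluated on the standard oriented frame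
  \<open>\<partial>/\<partial>Re p\<^sub>1, \<partial>/\<partial>Im p\<^sub>1, \<partial>/\<partial>Re p\<^sub>2, \<dots>\<close> and integrated against Lebesgue measure.\<close>

definition weight :: "nat \<Rightarrow> (nat \<times> nat \<Rightarrow> vertex) \<Rightarrow> real" where
  "weight n \<Gamma> =
    (LINT P : {P \<in> space (PiM {1..n} (\<lambda>_. lborel :: complex measure)).
                 (\<forall>k\<in>{1..n}. 0 < Im (P k)) \<and> inj_on P {1..n}} | PiM {1..n} (\<lambda>_. lborel).
       \<Sum>\<sigma> | \<sigma> permutes {..<2 * n}. of_int (sign \<sigma>) *
         (\<Prod>i<2 * n. dphi P (i div 2 + 1) (\<Gamma> (i div 2 + 1, i mod 2 + 1))
                       (\<sigma> i div 2 + 1) (if even (\<sigma> i) then 1 else \<i>)))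
    / (fact n * (2 * pi) ^ (2 * n))"

text \<open>A formal power series in \<open>\<epsilon>\<close> whose coefficients are functions is the sequence of its coefficients.\<close>

type_synonym fseries = "nat \<Rightarrow> point \<Rightarrow> real"

definition fconst :: "(point \<Rightarrow> real) \<Rightarrow> fseries" where
  "fconst f = (\<lambda>N p. if N = 0 then f p else 0)"

definition star_old :: "fseries \<Rightarrow> fseries \<Rightarrow> fseries" where
  "star_old f g N p =
    (\<Sum>i\<le>N. \<Sum>j\<le>N - i. \<Sum>\<Gamma>\<in>kgraphs (N - i - j).
       weight (N - i - j) \<Gamma> * B_op (N - i - j) \<Gamma> (f i) (g j) p)"

text \<open>The operator \<open>D = \<Sum> a\<^sub>m \<epsilon>\<^sup>m \<partial>\<^sub>1\<^sup>m\<close>; its inverse is the operator of the inverse series of \<open>a\<close>.\<close>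

definition gauge_op :: "real fps \<Rightarrow> fseries \<Rightarrow> fseries" where
  "gauge_op a f N p = (\<Sum>m\<le>N. fps_nth a m * (pderiv_dir 1 ^^ m) (f (N - m)) p)"

definition star :: "real fps \<Rightarrow> fseries \<Rightarrow> fseries \<Rightarrow> fseries" where
  "star a f g = gauge_op (inverse a) (star_old (gauge_op a f) (gauge_op a g))"

text \<open>\<open>star_power a f n\<close> is the star product of \<open>n + 1\<close> factors \<open>f\<close>.\<close>

primrec star_power :: "real fps \<Rightarrow> fseries \<Rightarrow> nat \<Rightarrow> fseries" where
  "star_power a f 0 = f"
| "star_power a f (Suc n) = star a f (star_power a f n)"

definition coord :: "3 \<Rightarrow> fseries" where
  "coord i = fconst (\<lambda>p. p $ i)"

definition is_gauge :: "real fps \<Rightarrow> bool" where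
  "is_gauge a \<longleftrightarrow> fps_nth a 0 = 1 \<and> (\<forall>m. odd m \<longrightarrow> fps_nth a m = 0) \<and>
     (\<forall>n. star_power a (coord 1) n = fconst (\<lambda>p. (p $ 1) ^ (n + 1)))"

text \<open>The argument \<open>A\<close> is the series \<open>A(t)\<close>; it enters with \<open>t = \<epsilon>\<^sup>2\<close>.\<close>

definition is_commutator_series :: "real fps \<Rightarrow> real fps \<Rightarrow> bool" where
  "is_commutator_series a A \<longleftrightarrow> fps_nth A 0 = 4 \<and>
     (\<forall>N p. star a (coord 2) (coord 3) N p - star a (coord 3) (coord 2) N p =
            fps_nth (2 * fps_X * (A oo fps_X\<^sup>2)) N * sinh (2 * p $ 1))"


section \<open>Formal series over monoid algebras\<close>

text \<open>\<open>'m alg\<close> is \<open>\<real>[M][[\<epsilon>]]\<close> for the (not necessarily commutative) monoid \<open>M\<close> of the type \<open>'m\<close>,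
  written additively as \<^typ>\<open>'a \<Rightarrow>\<^sub>0 'b\<close> requires. The completed tensor product of \<open>'m alg\<close> and
  \<open>'k alg\<close> over \<open>\<real>[[\<epsilon>]]\<close> is \<open>('m \<times> 'k) alg\<close>.\<close>

type_synonym 'm alg = "('m \<Rightarrow>\<^sub>0 real) fps"

definition mon :: "'m \<Rightarrow> 'm alg" where
  "mon m = fps_const (Poly_Mapping.single m 1)"

definition scal :: "real fps \<Rightarrow> ('m::zero) alg" where
  "scal r = Abs_fps (\<lambda>n. Poly_Mapping.single 0 (fps_nth r n))"

text \<open>\<open>lin \<phi>\<close> is the \<open>\<real>[[\<epsilon>]]\<close>-linear (hence \<open>\<epsilon>\<close>-adically continuous) extension of \<open>\<phi>\<close>.\<close>

definition lin :: "('m \<Rightarrow> ('k::monoid_add) alg) \<Rightarrow> 'm alg \<Rightarrow> 'k alg" where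
  "lin \<phi> f = Abs_fps (\<lambda>N. \<Sum>n\<le>N. \<Sum>m\<in>Poly_Mapping.keys (fps_nth f n).
     Poly_Mapping.single 0 (Poly_Mapping.lookup (fps_nth f n) m) * fps_nth (\<phi> m) (N - n))"

definition ptens :: "('m \<Rightarrow>\<^sub>0 real) \<Rightarrow> ('k \<Rightarrow>\<^sub>0 real) \<Rightarrow> ('m \<times> 'k \<Rightarrow>\<^sub>0 real)" where
  "ptens p q = (\<Sum>a\<in>Poly_Mapping.keys p. \<Sum>b\<in>Poly_Mapping.keys q.
     Poly_Mapping.single (a, b) (Poly_Mapping.lookup p a * Poly_Mapping.lookup q b))"

definition tens :: "'m alg \<Rightarrow> 'k alg \<Rightarrow> ('m \<times> 'k) alg"  (infixr "\<boxtimes>" 72) where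
  "f \<boxtimes> g = Abs_fps (\<lambda>N. \<Sum>n\<le>N. ptens (fps_nth f n) (fps_nth g (N - n)))"

definition commutator :: "'a::ring \<Rightarrow> 'a \<Rightarrow> 'a" where
  "commutator a b = a * b - b * a"


section \<open>Quotients, bialgebras, and inverting the formal parameter\<close>

definition closed_ideal :: "'a::{ring_1, topological_space} set \<Rightarrow> 'a set" where
  "closed_ideal S = closure (genideal ring_of_type_algebra S)"

definition qring :: "'a::ring_1 set \<Rightarrow> 'a set ring" where
  "qring I = ring_of_type_algebra Quot I"

definition cls :: "'a::ring_1 set \<Rightarrow> 'a \<Rightarrow> 'a set" where
  "cls I f = I +>\<^bsub>ring_of_type_algebra\<^esub> f"

text \<open>The map that \<open>T\<close> induces from a quotient to the quotient by \<open>K\<close>; \<open>descends\<close> says that it is well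
  defined on the quotient by \<open>I\<close>, and a unital ring homomorphism.\<close>

definition induced :: "'b::ring_1 set \<Rightarrow> ('a \<Rightarrow> 'b) \<Rightarrow> 'a set \<Rightarrow> 'b set" where
  "induced K T C = (\<Union>f\<in>C. cls K (T f))"

definition descends :: "'a::ring_1 set \<Rightarrow> 'b::ring_1 set \<Rightarrow> ('a \<Rightarrow> 'b) \<Rightarrow> bool" where
  "descends I K T \<longleftrightarrow> induced K T \<in> ring_hom (qring I) (qring K) \<and>
     (\<forall>f. induced K T (cls I f) = cls K (T f))"

text \<open>The kernel of the projection from the completed tensor product of \<open>'m alg\<close> and \<open>'k alg\<close> to that of
  their quotients by \<open>I\<close> and \<open>K\<close>.\<close>

definition tker :: "('m::monoid_add) alg set \<Rightarrow> ('k::monoid_add) alg set \<Rightarrow> ('m \<times> 'k) alg set" where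
  "tker I K = closed_ideal ({f \<boxtimes> 1 |f. f \<in> I} \<union> {1 \<boxtimes> g |g. g \<in> K})"

definition tens_id :: "('m::monoid_add \<Rightarrow> ('m \<times> 'm) alg) \<Rightarrow> ('m \<times> 'm) alg \<Rightarrow> ('m \<times> 'm \<times> 'm) alg" where
  "tens_id \<delta> = lin (\<lambda>(a, b). lin (\<lambda>((p, q), r). mon (p, q, r)) (\<delta> a \<boxtimes> mon b))"

definition id_tens :: "('m::monoid_add \<Rightarrow> ('m \<times> 'm) alg) \<Rightarrow> ('m \<times> 'm) alg \<Rightarrow> ('m \<times> 'm \<times> 'm) alg" where
  "id_tens \<delta> = lin (\<lambda>(a, b). mon a \<boxtimes> \<delta> b)"

text \<open>The quotient of \<open>'m alg\<close> by \<open>I\<close> is a (topological) bialgebra over \<open>\<real>[[\<epsilon>]]\<close> with the coproduct and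
  counit induced by the values \<open>\<delta>\<close> and \<open>\<kappa>\<close> on the monoid.\<close>

definition counit :: "('m \<Rightarrow> real) \<Rightarrow> 'm alg \<Rightarrow> real fps" where
  "counit \<kappa> f = Abs_fps (\<lambda>n. \<Sum>m\<in>Poly_Mapping.keys (fps_nth f n).
     Poly_Mapping.lookup (fps_nth f n) m * \<kappa> m)"

definition bialgebra ::
  "('m::monoid_add) alg set \<Rightarrow> ('m \<Rightarrow> ('m \<times> 'm) alg) \<Rightarrow> ('m \<Rightarrow> real) \<Rightarrow> bool" where
  "bialgebra I \<delta> \<kappa> \<longleftrightarrow>
    (let I2 = tker I I; I3 = tker I I2; \<Delta> = induced I2 (lin \<delta>);
         l = lin (\<lambda>(a, b). scal (fps_const (\<kappa> a)) * mon b);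
         r = lin (\<lambda>(a, b). scal (fps_const (\<kappa> b)) * mon a)
     in ideal I ring_of_type_algebra \<and> descends I I2 (lin \<delta>) \<and>
        descends I2 I3 (tens_id \<delta>) \<and> descends I2 I3 (id_tens \<delta>) \<and>
        (\<forall>C\<in>carrier (qring I). induced I3 (tens_id \<delta>) (\<Delta> C) = induced I3 (id_tens \<delta>) (\<Delta> C)) \<and>
        descends I {0} (counit \<kappa>) \<and> descends I2 I l \<and> descends I2 I r \<and>
        (\<forall>C\<in>carrier (qring I). induced I l (\<Delta> C) = C \<and> induced I r (\<Delta> C) = C))"

definition bialgebra_hom ::
  "('m::monoid_add) alg set \<Rightarrow> ('m \<Rightarrow> ('m \<times> 'm) alg) \<Rightarrow> ('m \<Rightarrow> real) \<Rightarrow>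
   ('k::monoid_add) alg set \<Rightarrow> ('k \<Rightarrow> ('k \<times> 'k) alg) \<Rightarrow> ('k \<Rightarrow> real) \<Rightarrow> ('m \<Rightarrow> 'k alg) \<Rightarrow> bool" where
  "bialgebra_hom I \<delta> \<kappa> J \<delta>' \<kappa>' \<phi> \<longleftrightarrow>
    (let I2 = tker I I; J2 = tker J J; \<phi>2 = lin (\<lambda>(a, b). \<phi> a \<boxtimes> \<phi> b)
     in descends I J (lin \<phi>) \<and> (\<forall>r. lin \<phi> (scal r) = scal r) \<and> descends I2 J2 \<phi>2 \<and>
        (\<forall>C\<in>carrier (qring I).
           induced J2 \<phi>2 (induced I2 (lin \<delta>) C) = induced J2 (lin \<delta>') (induced J (lin \<phi>) C)) \<and>
        (\<forall>f. counit \<kappa>' (lin \<phi> f) = counit \<kappa> f))"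

text \<open>Inverting \<open>\<epsilon>\<close>: \<open>\<real>[M][[\<epsilon>]]\<close> becomes \<open>\<real>[M]((\<epsilon>))\<close>, the ideal \<open>I\<close> becomes \<open>loc I\<close>, and an
  \<open>\<real>[[\<epsilon>]]\<close>-linear map \<open>T\<close> becomes \<open>loc_map T\<close>, a series being written as \<open>\<epsilon>\<^sup>d g\<close> with \<open>d\<close> its
  subdegree.\<close>

definition loc :: "'a::zero fps set \<Rightarrow> 'a fls set" where
  "loc I = {fls_shift k (fps_to_fls g) |k g. g \<in> I}"

definition loc_map :: "('a::zero fps \<Rightarrow> 'b::zero fps) \<Rightarrow> 'a fls \<Rightarrow> 'b fls" where
  "loc_map T f = fls_shift (- fls_subdegree f) (fps_to_fls (T (fls_base_factor_to_fps f)))"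

definition lscal :: "real fls \<Rightarrow> ('m::zero \<Rightarrow>\<^sub>0 real) fls" where
  "lscal = loc_map scal"

definition ltens :: "('m \<Rightarrow>\<^sub>0 real) fls \<Rightarrow> ('k \<Rightarrow>\<^sub>0 real) fls \<Rightarrow> ('m \<times> 'k \<Rightarrow>\<^sub>0 real) fls"  (infixr "\<boxtimes>\<^sub>l" 72) where
  "f \<boxtimes>\<^sub>l g = fls_shift (- fls_subdegree f - fls_subdegree g)
     (fps_to_fls (fls_base_factor_to_fps f \<boxtimes> fls_base_factor_to_fps g))"


section \<open>The quantized function algebra\<close>

text \<open>The monoid of words in \<open>x\<^sub>1, x\<^sub>2, x\<^sub>3, e\<^sup>x\<^sup>1, e\<^sup>-\<^sup>x\<^sup>1\<close> modulo \<open>e\<^sup>x\<^sup>1 e\<^sup>-\<^sup>x\<^sup>1 = e\<^sup>-\<^sup>x\<^sup>1 e\<^sup>x\<^sup>1 = 1\<close>, in normal form: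
  \<open>XE k\<close> is the \<open>k\<close>-th power of \<open>e\<^sup>x\<^sup>1\<close> and \<open>XC k i w\<close> is that power followed by \<open>x\<^sub>i\<close> and the word \<open>w\<close>.\<close>

datatype xword = XE int | XC int 3 xword

instantiation xword :: monoid_add
begin

definition zero_xword :: xword where "zero_xword = XE 0"

fun shift_xword :: "int \<Rightarrow> xword \<Rightarrow> xword" where
  "shift_xword k (XE l) = XE (k + l)"
| "shift_xword k (XC l i w) = XC (k + l) i w"

primrec plus_xword :: "xword \<Rightarrow> xword \<Rightarrow> xword" where
  "plus_xword (XE k) v = shift_xword k v"
| "plus_xword (XC k i w) v = XC k i (plus_xword w v)"

instance
proof
  have shift: "shift_xword k (b + c) = shift_xword k b + c" for k and b c :: xword
  proof (cases b)
    case (XE l)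
    then show ?thesis by (cases c) (simp_all add: add.assoc)
  qed simp
  fix a b c :: xword
  show "a + b + c = a + (b + c)"
    by (induction a) (simp_all add: shift)
  show "0 + a = a"
    by (cases a) (simp_all add: zero_xword_def)
  show "a + 0 = a"
    by (induction a) (simp_all add: zero_xword_def)
qed

end

definition genx :: "3 \<Rightarrow> xword alg" where
  "genx i = mon (XC 0 i (XE 0))"

definition expx :: "int \<Rightarrow> xword alg" where
  "expx k = mon (XE k)"

text \<open>The multiplicative map on words with \<open>x\<^sub>i \<mapsto> g i\<close>, \<open>e\<^sup>x\<^sup>1 \<mapsto> p\<close> and \<open>e\<^sup>-\<^sup>x\<^sup>1 \<mapsto> q\<close>.\<close>

primrec xlift :: "'r::monoid_mult \<Rightarrow> 'r \<Rightarrow> (3 \<Rightarrow> 'r) \<Rightarrow> xword \<Rightarrow> 'r" where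
  "xlift p q g (XE k) = (if k \<ge> 0 then p ^ nat k else q ^ nat (- k))"
| "xlift p q g (XC k i w) = (if k \<ge> 0 then p ^ nat k else q ^ nat (- k)) * g i * xlift p q g w"

definition fexp :: "real fps \<Rightarrow> real fps" where
  "fexp c = fps_exp 1 oo c"

definition fsinh :: "real fps \<Rightarrow> real fps" where
  "fsinh c = fps_const (1 / 2) * (fexp c - fexp (- c))"

definition sinh2X :: "xword alg" where
  "sinh2X = scal (fps_const (1 / 2)) * (expx 1 * expx 1 - expx (- 1) * expx (- 1))"

definition F_relations :: "real fps \<Rightarrow> xword alg set" where
  "F_relations A =
    {commutator (genx 1) (genx 2) - scal (2 * fps_X) * genx 2,
     commutator (genx 1) (genx 3) + scal (2 * fps_X) * genx 3,
     commutator (genx 2) (genx 3) - scal (2 * fps_X * (A oo fps_X\<^sup>2)) * sinh2X,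
     expx 1 * genx 2 - scal (fexp (2 * fps_X)) * genx 2 * expx 1,
     expx (- 1) * genx 2 - scal (fexp (- (2 * fps_X))) * genx 2 * expx (- 1),
     expx 1 * genx 3 - scal (fexp (- (2 * fps_X))) * genx 3 * expx 1,
     expx (- 1) * genx 3 - scal (fexp (2 * fps_X)) * genx 3 * expx (- 1),
     commutator (genx 1) (expx 1), commutator (genx 1) (expx (- 1))}"

text \<open>As usual for algebras over \<open>\<real>[[\<epsilon>]]\<close>, the ideal is taken closed in the \<open>\<epsilon>\<close>-adic topology.\<close>

definition F_ideal :: "real fps \<Rightarrow> xword alg set" where
  "F_ideal A = closed_ideal (F_relations A)"

definition F_cop :: "xword \<Rightarrow> (xword \<times> xword) alg" where
  "F_cop = xlift (expx 1 \<boxtimes> expx 1) (expx (- 1) \<boxtimes> expx (- 1))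
     (\<lambda>i. if i = 1 then 1 \<boxtimes> genx 1 + genx 1 \<boxtimes> 1 else genx i \<boxtimes> expx (- 1) + expx 1 \<boxtimes> genx i)"

definition F_counit :: "xword \<Rightarrow> real" where
  "F_counit = xlift 1 1 (\<lambda>_. 0)"


section \<open>The quantum universal enveloping algebra\<close>

text \<open>The free monoid on \<open>z\<^sub>1, z\<^sub>2, z\<^sub>3\<close>.\<close>

datatype zword = ZW "3 list"

instantiation zword :: monoid_add
begin

definition zero_zword :: zword where "zero_zword = ZW []"

fun plus_zword :: "zword \<Rightarrow> zword \<Rightarrow> zword" where
  "plus_zword (ZW v) (ZW w) = ZW (v @ w)"

instance
proof
  fix a b c :: zword
  show "a + b + c = a + (b + c)"
    by (cases a; cases b; cases c) simp
  show "0 + a = a" "a + 0 = a"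
    by (cases a; simp add: zero_zword_def)+
qed

end

definition genz :: "3 \<Rightarrow> zword alg" where
  "genz i = mon (ZW [i])"

primrec zlift :: "(3 \<Rightarrow> 'r::monoid_mult) \<Rightarrow> zword \<Rightarrow> 'r" where
  "zlift g (ZW w) = prod_list (map g w)"

text \<open>The series \<open>\<Sum>\<^sub>k b\<^sub>k z\<^sub>1\<^sup>k\<close>, for coefficients \<open>b\<^sub>k \<in> \<real>[[\<epsilon>]]\<close> tending to \<open>0\<close>.\<close>

definition z_series :: "(nat \<Rightarrow> real fps) \<Rightarrow> zword alg" where
  "z_series b = Abs_fps (\<lambda>n. \<Sum>k | fps_nth (b k) n \<noteq> 0.
     Poly_Mapping.single (ZW (replicate k 1)) (fps_nth (b k) n))"

definition expz :: "real fps \<Rightarrow> zword alg" where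
  "expz c = z_series (\<lambda>k. fps_const (1 / fact k) * c ^ k)"

text \<open>\<open>sinh(h z\<^sub>1) / sinh(h)\<close>: the division of \<open>h\<^sup>k\<close> by \<open>sinh(h)\<close> is exact for \<open>k \<ge> 1\<close>.\<close>

definition sinh_ratio :: "real fps \<Rightarrow> zword alg" where
  "sinh_ratio h = z_series (\<lambda>k. if odd k then fps_const (1 / fact k) * h ^ k / fsinh h else 0)"

text \<open>\<open>U\<^sub>h\<close> is the \<open>\<epsilon>\<close>-adically complete algebra with generators \<open>z\<^sub>1, z\<^sub>2, z\<^sub>3\<close>; its deformation parameter is
  a series \<open>h \<in> \<epsilon>\<real>[[\<epsilon>]]\<close>, and \<open>expz (h / 2)\<close> is the exponential series of \<open>h z\<^sub>1 / 2\<close>.\<close>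

definition U_ideal :: "real fps \<Rightarrow> zword alg set" where
  "U_ideal h = closed_ideal
    {commutator (genz 1) (genz 2) - 2 * genz 2, commutator (genz 1) (genz 3) + 2 * genz 3,
     commutator (genz 2) (genz 3) - sinh_ratio h}"

definition U_cop :: "real fps \<Rightarrow> zword \<Rightarrow> (zword \<times> zword) alg" where
  "U_cop h = zlift (\<lambda>i. if i = 1 then 1 \<boxtimes> genz 1 + genz 1 \<boxtimes> 1
     else genz i \<boxtimes> expz (- (fps_const (1 / 2) * h)) + expz (fps_const (1 / 2) * h) \<boxtimes> genz i)"

definition U_counit :: "zword \<Rightarrow> real" where
  "U_counit = zlift (\<lambda>_. 0)"


section \<open>The change of coordinates\<close>

definition h_par :: "real fps" where
  "h_par = 2 * fps_X"

definition fps_sqrt :: "real fps \<Rightarrow> real fps" where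
  "fps_sqrt f = (THE g. g\<^sup>2 = f \<and> 0 < fps_nth g (subdegree g))"

definition rescaling :: "real fps \<Rightarrow> real fps" where
  "rescaling A = fps_sqrt (2 * fps_X * (A oo fps_X\<^sup>2) * fsinh h_par)"

text \<open>The substitution \<open>x\<^sub>1 = \<epsilon> z\<^sub>1\<close>, \<open>x\<^sub>j = c z\<^sub>j\<close>, \<open>e\<^sup>\<plusminus>\<^sup>x\<^sup>1 = exp(\<plusminus>h z\<^sub>1 / 2)\<close>, with \<open>c = rescaling A\<close>.\<close>

definition coord_change :: "real fps \<Rightarrow> xword \<Rightarrow> zword alg" where
  "coord_change A = xlift (expz (fps_const (1 / 2) * h_par)) (expz (- (fps_const (1 / 2) * h_par)))
     (\<lambda>i. if i = 1 then scal fps_X * genz 1 else scal (rescaling A) * genz i)"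

text \<open>The new coordinates as elements of the word algebra with \<open>\<epsilon>\<close> inverted.\<close>

definition new_coord :: "real fps \<Rightarrow> 3 \<Rightarrow> (xword \<Rightarrow>\<^sub>0 real) fls" where
  "new_coord A i =
    lscal (inverse (fps_to_fls (if i = 1 then fps_X else rescaling A))) * fps_to_fls (genx i)"

end

theory Submission
  imports Defs
begin

text \<open>The coproducts are checked on the defining relations; there the point is that the two group-like
  elements \<open>q\<close>-commute with \<open>x\<^sub>2\<close> and \<open>x\<^sub>3\<close>, so that the cross terms cancel. Everything else rests on ordered
  monomials. Modulo the closed ideals, the words reduce to series in \<open>x\<^sub>2\<^sup>a x\<^sub>3\<^sup>b x\<^sub>1\<^sup>c e\<^sup>k\<^sup>x\<^sup>1\<close> and in
  \<open>z\<^sub>2\<^sup>a z\<^sub>3\<^sup>b z\<^sub>1\<^sup>c\<close>, respectively. The latter are linearly independent because the formulas for left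
  multiplication on them define a representation of \<open>U\<^sub>h\<close>, whatever the series \<open>[z\<^sub>2, z\<^sub>3]\<close> in \<open>z\<^sub>1\<close> is; hence \<open>U\<^sub>h\<close>
  has no torsion. No such representation is needed for the function algebra: the substitution turns
  \<open>x\<^sub>1\<^sup>c e\<^sup>k\<^sup>x\<^sup>1\<close> into \<open>(\<epsilon> t)\<^sup>c exp(k \<epsilon> t)\<close>, where \<open>t\<close> is the weight of \<open>z\<^sub>1\<close> on the vacuum vector, and the functions
  \<open>t\<^sup>c e\<^sup>k\<^sup>t\<close> are linearly independent. So the kernel of the substitution is exactly the ideal of relations,
  which gives injectivity and carries the absence of torsion over.\<close>

section \<open>Linear maps between algebras of formal series\<close>

text \<open>The coordinate change cannot be onto over the power series, since \<epsilon> and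
  \<open>rescaling A\<close> are not units; and even with \<epsilon> inverted, a series such as
  \<open>\<Sum> \<epsilon>^n z_2^(2n)\<close> would need unboundedly negative powers of \<epsilon>
  when written in x_2. Hence the isomorphism is expressed by injectivity, density of the image, and
  the fact that the transported relations generate the full closed ideal of U_h. Absence of torsion
  makes the passage to Laurent series faithful, and the closedness of the localized ideal rests on
  it as well. The substitution does not respect orders in \<epsilon> either:
  \<open>x_1^c e^(k x_1)\<close> contributes to infinitely many orders, so different orders on the
  function side are superposed in one order on the other side. They can be separated because every
  \<epsilon> produced by this part carries exactly one factor t: at total order
  \<open>n + d\<close>, order n of the function side is the coefficient of \<open>t^d\<close>. Only
  then does the independence of the functions \<open>t^c e^(k t)\<close> apply.\<close>

lemma poly_mapping_expand:
  "p = (\<Sum>m\<in>Poly_Mapping.keys p. Poly_Mapping.single m (Poly_Mapping.lookup p m))"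
  by (rule poly_mapping_eqI) (simp add: lookup_sum lookup_single when_def in_keys_iff)

lemma single_sum: "Poly_Mapping.single k (\<Sum>i\<in>S. f i) = (\<Sum>i\<in>S. Poly_Mapping.single k (f i))"
  by (induction S rule: infinite_finite_induct) (simp_all add: single_add)

lemma single_zero_commute:
  fixes p :: "'m::monoid_add \<Rightarrow>\<^sub>0 real"
  shows "Poly_Mapping.single 0 c * p = p * Poly_Mapping.single 0 c"
proof -
  have "Poly_Mapping.single 0 c * (\<Sum>m\<in>Poly_Mapping.keys p. Poly_Mapping.single m (Poly_Mapping.lookup p m))
      = (\<Sum>m\<in>Poly_Mapping.keys p. Poly_Mapping.single m (Poly_Mapping.lookup p m)) * Poly_Mapping.single 0 c"
    by (simp add: sum_distrib_left sum_distrib_right mult_single mult.commute)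
  then show ?thesis
    using poly_mapping_expand[of p] by simp
qed

lemma lookup_single_zero_mult:
  fixes p :: "'m::monoid_add \<Rightarrow>\<^sub>0 real"
  shows "Poly_Mapping.lookup (Poly_Mapping.single 0 c * p) k = c * Poly_Mapping.lookup p k"
proof -
  have "Poly_Mapping.single 0 c * p = Poly_Mapping.map ((*) c) p"
    by (simp add: mult_map_scale_conv_mult)
  then show ?thesis
    by (simp add: map.rep_eq when_def)
qed

section \<open>Scalars from \<open>\<real>[[\<epsilon>]]\<close> inside the algebras\<close>

lemma scal_nth [simp]: "fps_nth (scal r) n = Poly_Mapping.single 0 (fps_nth r n)"
  by (simp add: scal_def)

lemma scal_0 [simp]: "scal 0 = 0"
  by (rule fps_ext) simp

lemma scal_1 [simp]: "scal 1 = 1"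
  by (rule fps_ext) simp

lemma scal_add: "scal (r + s) = scal r + scal s"
  by (rule fps_ext) (simp add: single_add)

lemma scal_uminus: "scal (- r) = - scal r"
  by (rule fps_ext) (simp add: single_uminus)

lemma scal_diff: "scal (r - s) = scal r - scal s"
  by (rule fps_ext) (simp add: single_diff)

lemma scal_mult: "scal (r * s) = (scal r * scal s :: 'm::monoid_add alg)"
  by (rule fps_ext) (simp add: fps_mult_nth single_sum mult_single)

lemma scal_power: "scal (r ^ n) = (scal r ^ n :: 'm::monoid_add alg)"
  by (induction n) (simp_all add: scal_mult)

lemma scal_inj: "scal r = scal s \<longleftrightarrow> r = s"
  by (metis fps_ext lookup_single_eq scal_nth)

lemma scal_X [simp]: "scal fps_X = (fps_X :: 'm::monoid_add alg)"
  by (rule fps_ext) simp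

lemma scal_numeral [simp]: "scal (numeral n) = (numeral n :: 'm::monoid_add alg)"
  by (rule fps_ext) (auto simp: fps_numeral_nth)

lemma scal_commute: "scal r * f = f * (scal r :: 'm::monoid_add alg)"
proof (rule fps_ext)
  fix n
  have "(\<Sum>i=0..n. Poly_Mapping.single 0 (fps_nth r i) * fps_nth f (n - i)) =
      (\<Sum>i=0..n. Poly_Mapping.single 0 (fps_nth r (n - i)) * fps_nth f i)"
    by (rule sum.reindex_bij_witness[of _ "\<lambda>i. n - i" "\<lambda>i. n - i"]) auto
  then show "fps_nth (scal r * f) n = fps_nth (f * scal r) n"
    by (simp add: fps_mult_nth single_zero_commute)
qed

lemma scal_left_commute: "f * (scal r * g) = scal r * (f * (g :: 'm::monoid_add alg))"
  by (metis mult.assoc scal_commute)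

text \<open>A nonzero scalar is a unit times a power of \<epsilon>, and a power of \<epsilon> merely
  shifts coefficients. Cancellation is limited to scalars because the monoid algebra itself may have
  zero divisors.\<close>

lemma scal_cancel:
  fixes f g :: "'m::monoid_add alg"
  assumes "r \<noteq> 0" and eq: "scal r * f = scal r * g"
  shows "f = g"
proof -
  define k where "k = subdegree r"
  define u where "u = fps_shift k r"
  have "r = u * fps_X ^ k" and u: "fps_nth u 0 \<noteq> 0"
    using assms(1) by (simp_all add: k_def u_def subdegree_decompose)
  then have "inverse u * r = fps_X ^ k"
    by (simp add: inverse_mult_eq_1 flip: mult.assoc)
  then have "scal (fps_X ^ k) * f = scal (fps_X ^ k) * g"
    using eq by (metis mult.assoc scal_mult)
  then have "fps_X ^ k * f = fps_X ^ k * g"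
    by (simp add: scal_power)
  then have "fps_shift k (fps_X ^ k * f) = fps_shift k (fps_X ^ k * g)"
    by simp
  then show ?thesis
    by (simp add: fps_eq_iff fps_X_power_mult_nth)
qed

lemma mon_0 [simp]: "mon 0 = 1"
  by (simp add: mon_def)

lemma mon_mult: "mon a * mon b = mon (a + b)"
  by (simp add: mon_def mult_single)

text \<open>Linearity over \<open>\<real>[[\<epsilon>]]\<close>. Continuity needs no extra clause:
  the rule for scalars includes \<open>T (\<epsilon>^N f) = \<epsilon>^N T f\<close>.\<close>

definition slinear :: "('m::monoid_add alg \<Rightarrow> 'k::monoid_add alg) \<Rightarrow> bool" where
  "slinear T \<longleftrightarrow> (\<forall>f g. T (f + g) = T f + T g) \<and> (\<forall>r f. T (scal r * f) = scal r * T f)"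

lemma fps_conv_const_shift:
  fixes f :: "'a::ring_1 fps"
  shows "f = fps_const (fps_nth f 0) + fps_X * fps_shift 1 f"
  by (rule fps_ext) simp

lemma const_expand:
  "fps_const p = (\<Sum>m\<in>Poly_Mapping.keys p.
     scal (fps_const (Poly_Mapping.lookup p m)) * (mon m :: 'm::monoid_add alg))"
proof -
  have "scal (fps_const c) * mon m = fps_const (Poly_Mapping.single m c)" for c and m :: 'm
    by (rule fps_ext) (simp add: mon_def mult_single)
  moreover have "fps_const (sum g S) = (\<Sum>m\<in>S. fps_const (g m))" for g :: "'m \<Rightarrow> 'm \<Rightarrow>\<^sub>0 real" and S
    by (induction S rule: infinite_finite_induct) (simp_all flip: fps_const_add)
  moreover have "fps_const p = fps_const
      (\<Sum>m\<in>Poly_Mapping.keys p. Poly_Mapping.single m (Poly_Mapping.lookup p m))"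
    by (simp flip: poly_mapping_expand)
  ultimately show ?thesis
    by simp
qed

lemma slinear_0:
  assumes "slinear T"
  shows "T 0 = 0"
proof -
  have "T (scal 0 * 0) = scal 0 * T 0"
    using assms by (simp only: slinear_def)
  then show ?thesis by simp
qed

lemma slinear_sum: "slinear T \<Longrightarrow> T (sum f S) = (\<Sum>i\<in>S. T (f i))"
  by (induction S rule: infinite_finite_induct) (simp_all add: slinear_0 slinear_def)

lemma slinear_uminus:
  assumes "slinear T"
  shows "T (- f) = - T f"
proof -
  have "T (f + - f) = T f + T (- f)"
    using assms by (simp only: slinear_def)
  then show ?thesis
    using slinear_0[OF assms] by (simp add: eq_neg_iff_add_eq_0 add.commute)
qed

lemma slinear_diff:
  assumes "slinear T"
  shows "T (f - g) = T f - T g"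
proof -
  have "T (f + - g) = T f + T (- g)"
    using assms by (simp only: slinear_def)
  then show ?thesis
    by (simp add: slinear_uminus[OF assms])
qed

lemma slinear_const_shift:
  assumes "slinear T"
  shows "T f = T (fps_const (fps_nth f 0)) + fps_X * T (fps_shift 1 f)"
proof -
  have "T (fps_const (fps_nth f 0) + scal fps_X * fps_shift 1 f) =
      T (fps_const (fps_nth f 0)) + scal fps_X * T (fps_shift 1 f)"
    using assms by (simp only: slinear_def)
  then show ?thesis
    unfolding scal_X fps_conv_const_shift[of f, symmetric] .
qed

text \<open>The constant coefficient of f is a finite combination of monomials, so
  \<open>T f\<close> equals \<epsilon> times T of the shifted series; iterating this kills every
  coefficient of \<open>T f\<close>.\<close>

lemma slinear_zero_on_monI:
  assumes T: "slinear T" and mon: "\<And>m. T (mon m) = 0"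
  shows "T f = 0"
proof (rule fps_ext)
  have const: "T (fps_const p) = 0" for p
    unfolding const_expand[of p] using T mon by (simp add: slinear_sum) (simp add: slinear_def)
  have step: "T f = fps_X * T (fps_shift 1 f)" for f
    using slinear_const_shift[OF T, of f] const by simp
  fix n
  show "fps_nth (T f) n = fps_nth 0 n"
  proof (induction n arbitrary: f)
    case 0
    show ?case by (subst step) simp
  next
    case (Suc n)
    show ?case by (subst step) (simp add: Suc)
  qed
qed

lemma slinear_eqI:
  assumes "slinear T" "slinear U" and "\<And>m. T (mon m) = U (mon m)"
  shows "T f = U f"
proof -
  have "slinear (\<lambda>f. T f - U f)"
    using assms(1,2) by (simp add: slinear_def algebra_simps)
  from slinear_zero_on_monI[OF this, of f] show ?thesis
    by (simp add: assms(3))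
qed

lemma keys_sum_superset:
  fixes g :: "'m \<Rightarrow> 'k::monoid_add \<Rightarrow>\<^sub>0 real"
  assumes "finite K" "Poly_Mapping.keys p \<subseteq> K"
  shows "(\<Sum>m\<in>Poly_Mapping.keys p. Poly_Mapping.single 0 (Poly_Mapping.lookup p m) * g m) =
    (\<Sum>m\<in>K. Poly_Mapping.single 0 (Poly_Mapping.lookup p m) * g m)"
  using assms by (intro sum.mono_neutral_left) (auto simp: in_keys_iff)

lemma slinear_lin:
  fixes \<phi> :: "'m::monoid_add \<Rightarrow> 'k::monoid_add alg"
  shows "slinear (lin \<phi>)"
proof -
  \<comment> \<open>\<open>P\<close> extends a function on monomials linearly to one coefficient of
    the series; \<open>lin\<close> is then a Cauchy product of such sums.\<close>
  define P where "P g p = (\<Sum>m\<in>Poly_Mapping.keys p. Poly_Mapping.single 0 (Poly_Mapping.lookup p m) * g m)"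
    for g :: "'m \<Rightarrow> 'k \<Rightarrow>\<^sub>0 real" and p
  have P_add: "P g (p + q) = P g p + P g q" for g p q
  proof -
    let ?K = "Poly_Mapping.keys p \<union> Poly_Mapping.keys q"
    have "P g p = (\<Sum>m\<in>?K. Poly_Mapping.single 0 (Poly_Mapping.lookup p m) * g m)"
      "P g q = (\<Sum>m\<in>?K. Poly_Mapping.single 0 (Poly_Mapping.lookup q m) * g m)"
      "P g (p + q) = (\<Sum>m\<in>?K. Poly_Mapping.single 0 (Poly_Mapping.lookup (p + q) m) * g m)"
      unfolding P_def by (rule keys_sum_superset; auto dest: subsetD[OF keys_add])+
    then show ?thesis
      by (simp add: lookup_add single_add distrib_right sum.distrib)
  qed
  have P_scale: "P g (Poly_Mapping.single 0 c * p) = Poly_Mapping.single 0 c * P g p" for g c p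
  proof -
    have "P g (Poly_Mapping.single 0 c * p) = (\<Sum>m\<in>Poly_Mapping.keys p.
        Poly_Mapping.single 0 (Poly_Mapping.lookup (Poly_Mapping.single 0 c * p) m) * g m)"
      unfolding P_def by (rule keys_sum_superset) (auto simp: in_keys_iff lookup_single_zero_mult)
    then show ?thesis
      by (simp add: P_def lookup_single_zero_mult sum_distrib_left flip: mult.assoc)
        (simp add: mult_single)
  qed
  have P_sum: "P g (sum p S) = (\<Sum>i\<in>S. P g (p i))" for g and p :: "nat \<Rightarrow> _" and S
    by (induction S rule: infinite_finite_induct) (simp_all add: P_add, simp_all add: P_def)
  have lin: "fps_nth (lin \<phi> f) N = (\<Sum>n=0..N. P (\<lambda>m. fps_nth (\<phi> m) (N - n)) (fps_nth f n))" for f N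
    by (simp add: lin_def P_def atMost_atLeast0)
  have "lin \<phi> (scal r * f) = scal r * lin \<phi> f" for r f
  proof (rule fps_ext)
    fix N
    \<comment> \<open>Both sides are sums over \<open>i + j + l = N\<close>, bracketed in the two
      possible ways.\<close>
    show "fps_nth (lin \<phi> (scal r * f)) N = fps_nth (scal r * lin \<phi> f) N"
      using fps_mult_assoc_lemma[where k = N and n = N and f =
          "\<lambda>i j l. Poly_Mapping.single 0 (fps_nth r i) * P (\<lambda>m. fps_nth (\<phi> m) l) (fps_nth f j)"]
      by (simp add: lin fps_mult_nth P_sum P_scale sum_distrib_left)
  qed
  moreover have "lin \<phi> (f + g) = lin \<phi> f + lin \<phi> g" for f g
    by (rule fps_ext) (simp add: lin P_add sum.distrib)
  ultimately show ?thesis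
    by (simp add: slinear_def)
qed

lemma lin_mon [simp]: "lin \<phi> (mon m) = \<phi> m"
proof (rule fps_ext)
  fix N
  have "fps_nth (lin \<phi> (mon m)) N = (\<Sum>n\<le>N. if n = 0 then fps_nth (\<phi> m) N else 0)"
    unfolding lin_def mon_def fps_nth_Abs_fps by (rule sum.cong) simp_all
  then show "fps_nth (lin \<phi> (mon m)) N = fps_nth (\<phi> m) N"
    by simp
qed

lemma lin_add: "lin \<phi> (f + g) = lin \<phi> f + lin \<phi> g"
  for \<phi> :: "'m::monoid_add \<Rightarrow> 'k::monoid_add alg"
  using slinear_lin[of \<phi>] by (simp add: slinear_def)

lemma lin_scal_mult: "lin \<phi> (scal r * f) = scal r * lin \<phi> f"
  for \<phi> :: "'m::monoid_add \<Rightarrow> 'k::monoid_add alg"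
  using slinear_lin[of \<phi>] by (simp add: slinear_def)

definition ahom :: "('m::monoid_add alg \<Rightarrow> 'k::monoid_add alg) \<Rightarrow> bool" where
  "ahom T \<longleftrightarrow> (\<forall>f g. T (f + g) = T f + T g) \<and> (\<forall>f g. T (f * g) = T f * T g) \<and> (\<forall>r. T (scal r) = scal r)"

lemma ahom_slinear: "ahom T \<Longrightarrow> slinear T"
  by (simp add: ahom_def slinear_def)

lemma ahom_simps:
  assumes "ahom T"
  shows "T (f + g) = T f + T g" "T (f * g) = T f * T g" "T (scal r) = scal r" "T 1 = 1" "T 0 = 0"
    "T (- f) = - T f" "T (f - g) = T f - T g" "T (f ^ n) = T f ^ n"
proof -
  show *: "T (f + g) = T f + T g" "T (f * g) = T f * T g" "T (scal r) = scal r" for f g r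
    using assms by (auto simp: ahom_def)
  show 1: "T 1 = 1" "T 0 = 0"
    using *(3)[of 1] *(3)[of 0] by simp_all
  show "T (- f) = - T f" "T (f - g) = T f - T g"
    using ahom_slinear[OF assms] by (simp_all add: slinear_uminus slinear_diff)
  show "T (f ^ n) = T f ^ n"
    by (induction n) (simp_all add: 1 *)
qed

lemma ahom_comp: "ahom T \<Longrightarrow> ahom U \<Longrightarrow> ahom (\<lambda>f. T (U f))"
  by (simp add: ahom_def)

definition mhom :: "('m::monoid_add \<Rightarrow> 'r::monoid_mult) \<Rightarrow> bool" where
  "mhom \<phi> \<longleftrightarrow> \<phi> 0 = 1 \<and> (\<forall>a b. \<phi> (a + b) = \<phi> a * \<phi> b)"

text \<open>Multiplicativity spreads from monomials one factor at a time: first to a monomial times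
  an arbitrary series, then to two arbitrary series.\<close>

lemma ahom_lin:
  fixes \<phi> :: "'m::monoid_add \<Rightarrow> 'k::monoid_add alg"
  assumes \<phi>: "mhom \<phi>"
  shows "ahom (lin \<phi>)"
proof -
  have 1: "lin \<phi> (mon a * g) = \<phi> a * lin \<phi> g" for a g
    by (rule slinear_eqI)
      (use \<phi> in \<open>auto simp: slinear_def lin_add lin_scal_mult distrib_left scal_left_commute mon_mult mhom_def\<close>)
  have "lin \<phi> (f * g) = lin \<phi> f * lin \<phi> g" for f g
    by (rule slinear_eqI[where T = "\<lambda>f. lin \<phi> (f * g)"])
      (auto simp: slinear_def lin_add lin_scal_mult distrib_right mult.assoc 1)
  moreover have "lin \<phi> (scal r) = scal r" for r
    using lin_scal_mult[of \<phi> r 1] lin_mon[of \<phi> 0] \<phi> by (simp add: mhom_def)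
  ultimately show ?thesis
    by (simp add: ahom_def lin_add)
qed

lemma mhom_ahom_mon: "ahom T \<Longrightarrow> mhom (\<lambda>m. T (mon m))"
  by (simp add: mhom_def ahom_simps flip: mon_mult)

section \<open>Tensor products\<close>

definition inl :: "'m::monoid_add alg \<Rightarrow> ('m \<times> 'k::monoid_add) alg" where
  "inl = lin (\<lambda>a. mon (a, 0))"

definition inr :: "'k::monoid_add alg \<Rightarrow> ('m::monoid_add \<times> 'k) alg" where
  "inr = lin (\<lambda>b. mon (0, b))"

lemma ahom_inl: "ahom inl"
  unfolding inl_def by (rule ahom_lin) (simp add: mhom_def mon_mult flip: zero_prod_def)

lemma ahom_inr: "ahom inr"
  unfolding inr_def by (rule ahom_lin) (simp add: mhom_def mon_mult flip: zero_prod_def)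

lemma inl_inr_commute: "inr g * inl f = inl f * inr g"
proof -
  have 1: "inr g * mon (a, 0) = mon (a, 0) * inr g" for a :: 'a and g :: "'b alg"
    by (rule slinear_eqI[where T = "\<lambda>g. inr g * mon (a, 0)"])
      (auto simp: slinear_def ahom_simps[OF ahom_inr] distrib_left distrib_right mult.assoc
        scal_left_commute, simp add: inr_def mon_mult)
  show ?thesis
    by (rule slinear_eqI[where T = "\<lambda>f. inr g * inl f"])
      (auto simp: slinear_def ahom_simps[OF ahom_inl] distrib_left distrib_right mult.assoc
        scal_left_commute, simp add: inl_def 1)
qed

lemma lin_mon_nth:
  "fps_nth (lin (\<lambda>a. mon (h a)) f) n =
    (\<Sum>a\<in>Poly_Mapping.keys (fps_nth f n). Poly_Mapping.single (h a) (Poly_Mapping.lookup (fps_nth f n) a))"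
  for h :: "'m \<Rightarrow> 'k::monoid_add"
proof -
  have "fps_nth (lin (\<lambda>a. mon (h a)) f) n = (\<Sum>j\<le>n. if j = n then
    (\<Sum>a\<in>Poly_Mapping.keys (fps_nth f n). Poly_Mapping.single (h a) (Poly_Mapping.lookup (fps_nth f n) a)) else 0)"
    unfolding lin_def mon_def fps_nth_Abs_fps by (rule sum.cong) (auto simp: mult_single)
  then show ?thesis by simp
qed

text \<open>Replaces the coefficientwise tensor product by a product of two commuting embeddings, so
  that tensor identities become computations in a single ring.\<close>

lemma tens_conv_mult: "f \<boxtimes> g = inl f * inr g"
  for f :: "'m::monoid_add alg" and g :: "'k::monoid_add alg"
  by (rule fps_ext)
    (simp add: tens_def fps_mult_nth inl_def inr_def lin_mon_nth ptens_def sum_product mult_single atMost_atLeast0)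

lemma tens_mult: "(f \<boxtimes> g) * (f' \<boxtimes> g') = (f * f') \<boxtimes> (g * g')"
  for f f' :: "'m::monoid_add alg" and g g' :: "'k::monoid_add alg"
proof -
  have "inr g * (inl f' * inr g') = inl f' * (inr g * inr g')"
    by (simp add: inl_inr_commute flip: mult.assoc)
  then show ?thesis
    by (simp add: tens_conv_mult ahom_simps[OF ahom_inl] ahom_simps[OF ahom_inr] mult.assoc)
qed

lemma tens_add_left: "(f + f') \<boxtimes> g = f \<boxtimes> g + f' \<boxtimes> g"
  and tens_add_right: "f \<boxtimes> (g + g') = f \<boxtimes> g + f \<boxtimes> g'"
  and tens_diff_left: "(f - f') \<boxtimes> g = f \<boxtimes> g - f' \<boxtimes> g"
  and tens_diff_right: "f \<boxtimes> (g - g') = f \<boxtimes> g - f \<boxtimes> g'"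
  and tens_scal_left: "(scal r * f) \<boxtimes> g = scal r * (f \<boxtimes> g)"
  and tens_scal_right: "f \<boxtimes> (scal r * g) = scal r * (f \<boxtimes> g)"
  and tens_0_left [simp]: "(0 :: 'm alg) \<boxtimes> g = 0"
  and tens_0_right [simp]: "f \<boxtimes> (0 :: 'k alg) = 0"
  and tens_1_1 [simp]: "(1 :: 'm alg) \<boxtimes> (1 :: 'k alg) = 1"
  for f f' :: "'m::monoid_add alg" and g g' :: "'k::monoid_add alg"
  unfolding tens_conv_mult ahom_simps[OF ahom_inl] ahom_simps[OF ahom_inr]
  by (simp_all add: distrib_left distrib_right left_diff_distrib right_diff_distrib mult.assoc
      scal_left_commute[of "inl f"])

section \<open>Closed ideals and quotients\<close>

lemma ring_of_type_algebra_simps [simp]: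
  "carrier ring_of_type_algebra = UNIV"
  "x \<otimes>\<^bsub>ring_of_type_algebra\<^esub> y = x * y" "x \<oplus>\<^bsub>ring_of_type_algebra\<^esub> y = x + y"
  "\<one>\<^bsub>ring_of_type_algebra\<^esub> = 1" "\<zero>\<^bsub>ring_of_type_algebra\<^esub> = 0"
  by (simp_all add: ring_of_type_algebra_def)

lemma ring_ring_of_type_algebra: "ring (ring_of_type_algebra :: 'a::ring_1 ring)"
proof -
  have "\<exists>y. x + y = 0" for x :: 'a
    using add.right_inverse by blast
  then show ?thesis
    unfolding ring_of_type_algebra_def using add.right_inverse
    by unfold_locales (auto simp: algebra_simps Units_def)
qed

lemma ideal_iff:
  "ideal K (ring_of_type_algebra :: 'a::ring_1 ring) \<longleftrightarrow>
     0 \<in> K \<and> (\<forall>a\<in>K. \<forall>b\<in>K. a + b \<in> K) \<and> (\<forall>r. \<forall>a\<in>K. r * a \<in> K \<and> a * r \<in> K)"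
proof
  assume "ideal K (ring_of_type_algebra :: 'a ring)"
  then interpret ideal K "ring_of_type_algebra :: 'a ring" .
  show "0 \<in> K \<and> (\<forall>a\<in>K. \<forall>b\<in>K. a + b \<in> K) \<and> (\<forall>r. \<forall>a\<in>K. r * a \<in> K \<and> a * r \<in> K)"
    using additive_subgroup.zero_closed[OF is_additive_subgroup]
      additive_subgroup.a_closed[OF is_additive_subgroup] I_l_closed I_r_closed by simp
next
  assume K: "0 \<in> K \<and> (\<forall>a\<in>K. \<forall>b\<in>K. a + b \<in> K) \<and> (\<forall>r. \<forall>a\<in>K. r * a \<in> K \<and> a * r \<in> K)"
  have "group (add_monoid (ring_of_type_algebra :: 'a ring))"
    using ring_ring_of_type_algebra
    by (meson abelian_group.a_group ring.is_abelian_group)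
  moreover have "inv\<^bsub>add_monoid ring_of_type_algebra\<^esub> a \<in> K" if "a \<in> K" for a
  proof -
    have "inv\<^bsub>add_monoid ring_of_type_algebra\<^esub> a = - a"
      by (rule group.inv_equality[OF \<open>group _\<close>]) simp_all
    moreover have "-1 * a \<in> K"
      using K that by blast
    ultimately show ?thesis
      by simp
  qed
  ultimately have "subgroup K (add_monoid (ring_of_type_algebra :: 'a ring))"
    using K by (intro group.subgroupI) auto
  then show "ideal K (ring_of_type_algebra :: 'a ring)"
    using K by (intro idealI ring_ring_of_type_algebra) auto
qed

lemma
  assumes "ideal K (ring_of_type_algebra :: 'a::ring_1 ring)"
  shows ideal_0: "0 \<in> K" and ideal_add: "a \<in> K \<Longrightarrow> b \<in> K \<Longrightarrow> a + b \<in> K"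
    and ideal_lmult: "a \<in> K \<Longrightarrow> r * a \<in> K" and ideal_rmult: "a \<in> K \<Longrightarrow> a * r \<in> K"
    and ideal_uminus: "a \<in> K \<Longrightarrow> - a \<in> K" and ideal_diff: "a \<in> K \<Longrightarrow> b \<in> K \<Longrightarrow> a - b \<in> K"
proof -
  note K = assms[unfolded ideal_iff]
  show "0 \<in> K" "a \<in> K \<Longrightarrow> b \<in> K \<Longrightarrow> a + b \<in> K" "a \<in> K \<Longrightarrow> r * a \<in> K" "a \<in> K \<Longrightarrow> a * r \<in> K"
    using K by blast+
  show *: "- a \<in> K" if "a \<in> K" for a
    using K that by (metis mult_minus1)
  show "a \<in> K \<Longrightarrow> b \<in> K \<Longrightarrow> a - b \<in> K"
    using K * by (metis add_uminus_conv_diff)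
qed

lemma ideal_genideal: "ideal (genideal ring_of_type_algebra S) (ring_of_type_algebra :: 'a::ring_1 ring)"
  by (rule ring.genideal_ideal[OF ring_ring_of_type_algebra]) simp

text \<open>The distance of two different series is 2 to the power minus the order of their
  difference, so being close means agreeing in all low degrees.\<close>

lemma closure_fps_iff:
  "f \<in> closure S \<longleftrightarrow> (\<forall>N. \<exists>g\<in>S. \<forall>n<N. fps_nth f n = fps_nth (g :: 'a::ab_group_add fps) n)"
proof safe
  fix N
  assume "f \<in> closure S"
  then obtain g where g: "g \<in> S" "dist g f < inverse (2 ^ N)"
    unfolding closure_approachable by (meson inverse_positive_iff_positive zero_less_numeral zero_less_power)
  have "fps_nth f n = fps_nth g n" if "n < N" for n
  proof (cases "g = f")
    case False
    then have "N < subdegree (g - f)"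
      using g(2) by (simp add: dist_fps_def)
    then have "fps_nth (g - f) n = 0"
      using that by (intro nth_less_subdegree_zero) simp
    then show ?thesis by simp
  qed simp
  then show "\<exists>g\<in>S. \<forall>n<N. fps_nth f n = fps_nth g n"
    using g(1) by blast
next
  assume *: "\<forall>N. \<exists>g\<in>S. \<forall>n<N. fps_nth f n = fps_nth g n"
  show "f \<in> closure S"
    unfolding closure_approachable
  proof safe
    fix e :: real
    assume "e > 0"
    then obtain N where "(1 / 2) ^ N < e"
      using real_arch_pow_inv[of e "1 / 2"] by force
    then have N: "inverse (2 ^ N) < e"
      by (simp add: power_one_over inverse_eq_divide)
    obtain g where g: "g \<in> S" "\<forall>n<N. fps_nth f n = fps_nth g n"
      using * by blast
    have "dist g f \<le> inverse (2 ^ N)"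
    proof (cases "g = f")
      case False
      then have "N \<le> subdegree (g - f)"
        using g(2) by (intro subdegree_geI) auto
      then show ?thesis
        by (simp add: dist_fps_def)
    qed simp
    with N g(1) show "\<exists>y\<in>S. dist y f < e"
      by force
  qed
qed

text \<open>Closedness is phrased through coefficients, the form in which linear maps interact with
  it via \<open>slinear_agree\<close>.\<close>

definition cideal :: "'m::monoid_add alg set \<Rightarrow> bool" where
  "cideal K \<longleftrightarrow> ideal K ring_of_type_algebra \<and>
     (\<forall>f. (\<forall>N. \<exists>g\<in>K. \<forall>n<N. fps_nth f n = fps_nth g n) \<longrightarrow> f \<in> K)"

lemma cideal_ideal: "cideal K \<Longrightarrow> ideal K ring_of_type_algebra"
  by (simp add: cideal_def)

lemmas cideal_0 = ideal_0[OF cideal_ideal]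
lemmas cideal_add = ideal_add[OF cideal_ideal]
lemmas cideal_diff = ideal_diff[OF cideal_ideal]
lemmas cideal_uminus = ideal_uminus[OF cideal_ideal]
lemmas cideal_lmult = ideal_lmult[OF cideal_ideal]
lemmas cideal_rmult = ideal_rmult[OF cideal_ideal]

lemma cideal_sum: "cideal K \<Longrightarrow> (\<And>i. i \<in> S \<Longrightarrow> f i \<in> K) \<Longrightarrow> sum f S \<in> K"
  by (induction S rule: infinite_finite_induct) (auto simp: cideal_0 cideal_add)

lemma cideal_lim: "cideal K \<Longrightarrow> (\<And>N. \<exists>g\<in>K. \<forall>n<N. fps_nth f n = fps_nth g n) \<Longrightarrow> f \<in> K"
  unfolding cideal_def by blast

lemma cideal_singleton_0: "cideal {0 :: 'm::monoid_add alg}"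
proof -
  have "f = 0" if *: "\<forall>N. \<exists>g\<in>{0}. \<forall>n<N. fps_nth f n = fps_nth g n" for f :: "'m alg"
    by (rule fps_ext) (use * in auto)
  then show ?thesis
    by (auto simp: cideal_def ideal_iff)
qed

lemma cideal_closed_ideal: "cideal (closed_ideal S)"
proof -
  let ?G = "genideal ring_of_type_algebra S :: 'a alg set"
  note G = ideal_genideal[of S]
  have mult: "\<forall>n<N. fps_nth (r * a) n = fps_nth (r * b) n" "\<forall>n<N. fps_nth (a * r) n = fps_nth (b * r) n"
    if "\<forall>n<N. fps_nth a n = fps_nth b n" for a b r :: "'a alg" and N
    using that by (auto simp: fps_mult_nth intro!: sum.cong)
  have "0 \<in> closed_ideal S"
    unfolding closed_ideal_def closure_fps_iff using ideal_0[OF G] by blast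
  moreover have "a + b \<in> closed_ideal S" if "a \<in> closed_ideal S" "b \<in> closed_ideal S" for a b
    using that unfolding closed_ideal_def closure_fps_iff
    by (metis fps_add_nth ideal_add[OF G])
  moreover have "r * a \<in> closed_ideal S \<and> a * r \<in> closed_ideal S" if "a \<in> closed_ideal S" for r a
    using that mult ideal_lmult[OF G] ideal_rmult[OF G] unfolding closed_ideal_def closure_fps_iff by meson
  ultimately have "ideal (closed_ideal S) ring_of_type_algebra"
    by (simp add: ideal_iff)
  moreover have "f \<in> closed_ideal S" if "\<forall>N. \<exists>g\<in>closed_ideal S. \<forall>n<N. fps_nth f n = fps_nth g n" for f
    using that closure_fps_iff[of f "closure ?G"] by (simp add: closed_ideal_def)
  ultimately show ?thesis
    by (simp add: cideal_def)
qed

lemma closed_ideal_superset: "S \<subseteq> closed_ideal S"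
  unfolding closed_ideal_def
  using closure_subset ring.genideal_self[OF ring_ring_of_type_algebra] by (metis subset_trans
      ring_of_type_algebra_simps(1) subset_UNIV)

lemma closed_ideal_least:
  assumes "cideal K" "S \<subseteq> K"
  shows "closed_ideal S \<subseteq> K"
proof
  fix f
  assume "f \<in> closed_ideal S"
  moreover have "genideal ring_of_type_algebra S \<subseteq> K"
    using ring.genideal_minimal[OF ring_ring_of_type_algebra] assms cideal_ideal by blast
  ultimately show "f \<in> K"
    unfolding closed_ideal_def closure_fps_iff by (intro cideal_lim[OF assms(1)]) blast
qed

lemma slinear_agree:
  assumes T: "slinear T" and "\<forall>n<N. fps_nth f n = fps_nth g n" and "n < N"
  shows "fps_nth (T f) n = fps_nth (T g) n"
proof -
  have "f - g = scal (fps_X ^ N) * fps_shift N (f - g)"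
    by (rule fps_ext) (use assms(2) in \<open>auto simp: scal_power fps_X_power_mult_nth\<close>)
  then have "T (f - g) = scal (fps_X ^ N) * T (fps_shift N (f - g))"
    using T by (metis slinear_def)
  then have "fps_nth (T (f - g)) n = 0"
    using assms(3) by (simp add: scal_power fps_X_power_mult_nth)
  then show ?thesis
    by (simp add: slinear_diff[OF T])
qed

text \<open>Modulo \<open>\<epsilon>^N\<close> only finitely many monomials of f matter, and K is
  closed. Restricting the hypothesis to monomials that occur in f lets a series in z_1 be handled
  through the powers of z_1 alone.\<close>

lemma slinear_in_cideal:
  assumes T: "slinear T" and K: "cideal K"
    and supp: "\<And>n m. m \<in> Poly_Mapping.keys (fps_nth f n) \<Longrightarrow> T (mon m) \<in> K"
  shows "T f \<in> K"
proof (rule cideal_lim[OF K])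
  fix N
  show "\<exists>g\<in>K. \<forall>n<N. fps_nth (T f) n = fps_nth g n"
    using supp
  proof (induction N arbitrary: f)
    case 0
    then show ?case using cideal_0[OF K] by auto
  next
    case (Suc N)
    have "\<exists>g\<in>K. \<forall>n<N. fps_nth (T (fps_shift 1 f)) n = fps_nth g n"
      by (rule Suc.IH) (use Suc.prems in auto)
    then obtain g where g: "g \<in> K" "\<forall>n<N. fps_nth (T (fps_shift 1 f)) n = fps_nth g n"
      by blast
    have "T (fps_const (fps_nth f 0)) \<in> K"
      unfolding const_expand[of "fps_nth f 0"] slinear_sum[OF T]
      using T Suc.prems by (intro cideal_sum[OF K]) (auto simp: slinear_def intro: cideal_lmult[OF K])
    then have "T (fps_const (fps_nth f 0)) + fps_X * g \<in> K"
      using g(1) by (intro cideal_add[OF K] cideal_lmult[OF K])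
    moreover have "T f = T (fps_const (fps_nth f 0)) + fps_X * T (fps_shift 1 f)"
      by (rule slinear_const_shift[OF T])
    ultimately show ?case
      using g(2) by (intro bexI[of _ "T (fps_const (fps_nth f 0)) + fps_X * g"]) auto
  qed
qed

lemma cideal_vimage:
  assumes T: "ahom T" and K: "cideal K"
  shows "cideal {f. T f \<in> K}"
proof -
  have "f \<in> {f. T f \<in> K}" if lim: "\<forall>N. \<exists>g\<in>{f. T f \<in> K}. \<forall>n<N. fps_nth f n = fps_nth g n" for f
  proof -
    have "\<exists>g\<in>K. \<forall>n<N. fps_nth (T f) n = fps_nth g n" for N
    proof -
      obtain g where g: "T g \<in> K" "\<forall>n<N. fps_nth f n = fps_nth g n"
        using lim by blast
      show ?thesis
        using slinear_agree[OF ahom_slinear[OF T] g(2)] g(1) by blast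
    qed
    then show ?thesis
      using cideal_lim[OF K] by blast
  qed
  moreover have "ideal {f. T f \<in> K} ring_of_type_algebra"
    by (simp add: ideal_iff ahom_simps[OF T] cideal_0[OF K] cideal_add[OF K] cideal_lmult[OF K] cideal_rmult[OF K])
  ultimately show ?thesis
    unfolding cideal_def by blast
qed

text \<open>A homomorphism preserves agreement up to order N, so the preimage of a closed ideal is
  again a closed ideal; hence checking generators is enough.\<close>

lemma closed_ideal_image:
  assumes "ahom T" "cideal K" "\<And>f. f \<in> S \<Longrightarrow> T f \<in> K" "f \<in> closed_ideal S"
  shows "T f \<in> K"
  using closed_ideal_least[OF cideal_vimage[OF assms(1,2)], of S] assms(3,4) by blast

lemma in_closed_ideal: "f \<in> S \<Longrightarrow> f \<in> closed_ideal S"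
  for S :: "'m::monoid_add alg set"
  using closed_ideal_superset by blast

section \<open>Residue classes and induced maps\<close>

lemma cls_conv: "cls I f = (\<lambda>i. i + f) ` I"
  by (auto simp: cls_def a_r_coset_def')

lemma cls_eq_iff:
  assumes "ideal I ring_of_type_algebra"
  shows "cls I f = cls I g \<longleftrightarrow> f - g \<in> I"
proof
  assume "cls I f = cls I g"
  moreover have "f \<in> cls I f"
    using ideal_0[OF assms] unfolding cls_conv by force
  ultimately show "f - g \<in> I"
    unfolding cls_conv by auto
next
  assume "f - g \<in> I"
  moreover have "cls I f \<subseteq> cls I g" if "f - g \<in> I" for f g
  proof
    fix x
    assume "x \<in> cls I f"
    then obtain i where "i \<in> I" "x = i + f"
      by (auto simp: cls_conv)
    then have "x = (i + (f - g)) + g" "i + (f - g) \<in> I"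
      using ideal_add[OF assms _ that] by simp_all
    then show "x \<in> cls I g"
      unfolding cls_conv by blast
  qed
  moreover have "g - f \<in> I"
    using ideal_uminus[OF assms \<open>f - g \<in> I\<close>] by simp
  ultimately show "cls I f = cls I g"
    by blast
qed

lemma carrier_qring: "carrier (qring I) = range (cls I)"
  unfolding qring_def FactRing_def A_RCOSETS_def' by (auto simp: cls_def)

lemma cls_hom:
  assumes "ideal I (ring_of_type_algebra :: 'a::ring_1 ring)"
  shows "cls I \<in> ring_hom ring_of_type_algebra (qring I)"
  using ideal.rcos_ring_hom[OF assms] by (simp add: cls_def[abs_def] qring_def)

lemma descendsI:
  fixes T :: "'a::ring_1 \<Rightarrow> 'b::ring_1"
  assumes I: "ideal I ring_of_type_algebra" and K: "ideal K ring_of_type_algebra"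
    and T: "\<And>f g. T (f + g) = T f + T g" "\<And>f g. T (f * g) = T f * T g" "T 1 = 1"
    and into: "\<And>f. f \<in> I \<Longrightarrow> T f \<in> K"
  shows "descends I K T"
proof -
  have T_cls: "cls K (T g) = cls K (T f)" if "g \<in> cls I f" for f g
    using that into by (auto simp: cls_conv[of I] T(1) cls_eq_iff[OF K])
  have ind: "induced K T (cls I f) = cls K (T f)" for f
  proof -
    have "f \<in> cls I f"
      using ideal_0[OF I] unfolding cls_conv by force
    then show ?thesis
      unfolding induced_def using T_cls by blast
  qed
  note hI = cls_hom[OF I] and hK = cls_hom[OF K]
  have "induced K T \<in> ring_hom (qring I) (qring K)"
  proof (rule ring_hom_memI)
    show "induced K T x \<in> carrier (qring K)" if "x \<in> carrier (qring I)" for x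
      using that ind by (auto simp: carrier_qring)
    fix x y
    assume "x \<in> carrier (qring I)" "y \<in> carrier (qring I)"
    then obtain f g where [simp]: "x = cls I f" "y = cls I g"
      by (auto simp: carrier_qring)
    show "induced K T (x \<otimes>\<^bsub>qring I\<^esub> y) = induced K T x \<otimes>\<^bsub>qring K\<^esub> induced K T y"
      using ring_hom_mult[OF hI, of f g] ring_hom_mult[OF hK, of "T f" "T g"] ind[of "f * g"] T(2)
      by (simp add: ind)
    show "induced K T (x \<oplus>\<^bsub>qring I\<^esub> y) = induced K T x \<oplus>\<^bsub>qring K\<^esub> induced K T y"
      using ring_hom_add[OF hI, of f g] ring_hom_add[OF hK, of "T f" "T g"] ind[of "f + g"] T(1)
      by (simp add: ind)
  next
    show "induced K T \<one>\<^bsub>qring I\<^esub> = \<one>\<^bsub>qring K\<^esub>"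
      using ring_hom_one[OF hI] ring_hom_one[OF hK] ind[of 1] T(3) by simp
  qed
  then show ?thesis
    using ind by (simp add: descends_def)
qed

lemma descends_ahomI:
  assumes "ahom T" "cideal I" "cideal K" "\<And>f. f \<in> I \<Longrightarrow> T f \<in> K"
  shows "descends I K T"
  using assms by (intro descendsI) (auto simp: ahom_simps cideal_ideal)

lemma descends_cls: "descends I K T \<Longrightarrow> induced K T (cls I f) = cls K (T f)"
  by (simp add: descends_def)

section \<open>Bialgebra criteria\<close>

lemma inl_conv: "inl f = f \<boxtimes> 1" and inr_conv: "inr f = 1 \<boxtimes> f"
  using ahom_simps(4)[OF ahom_inl] ahom_simps(4)[OF ahom_inr] by (metis mult_1 mult.right_neutral tens_conv_mult)+

lemma inl_mon: "inl (mon a) = mon (a, 0)" and inr_mon: "inr (mon b) = mon (0, b)"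
  by (simp_all add: inl_def inr_def)

lemma tker_conv: "tker I K = closed_ideal (inl ` I \<union> inr ` K)"
proof -
  have "inl ` I \<union> inr ` K = {f \<boxtimes> 1 |f. f \<in> I} \<union> {1 \<boxtimes> g |g. g \<in> K}"
    by (auto simp: inl_conv inr_conv)
  then show ?thesis
    by (simp add: tker_def)
qed

lemma cideal_tker: "cideal (tker I K)"
  by (simp add: tker_def cideal_closed_ideal)

lemma inl_tker: "f \<in> I \<Longrightarrow> inl f \<in> tker I K" and inr_tker: "g \<in> K \<Longrightarrow> inr g \<in> tker I K"
  by (auto simp: tker_conv intro: in_closed_ideal)

lemma tens_tker_left: "f \<in> I \<Longrightarrow> f \<boxtimes> g \<in> tker I K" and tens_tker_right: "g \<in> K \<Longrightarrow> f \<boxtimes> g \<in> tker I K"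
  by (simp_all add: tens_conv_mult inl_tker inr_tker cideal_lmult[OF cideal_tker] cideal_rmult[OF cideal_tker])

lemma tker_image:
  assumes "ahom T" "cideal L" "\<And>f. f \<in> I \<Longrightarrow> T (inl f) \<in> L" "\<And>g. g \<in> K \<Longrightarrow> T (inr g) \<in> L" "f \<in> tker I K"
  shows "T f \<in> L"
  by (rule closed_ideal_image[of T L _ f, OF assms(1,2)]) (use assms(3-) in \<open>auto simp: tker_conv\<close>)

lemma lin_inl:
  assumes "\<And>a. \<phi> (a, 0) = \<psi> a"
  shows "lin \<phi> (inl f) = lin \<psi> f"
  by (rule slinear_eqI[where T = "\<lambda>f. lin \<phi> (inl f)"])
    (auto simp: slinear_def ahom_simps[OF ahom_inl] lin_add lin_scal_mult inl_mon assms)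

lemma lin_inr:
  assumes "\<And>b. \<phi> (0, b) = \<psi> b"
  shows "lin \<phi> (inr f) = lin \<psi> f"
  by (rule slinear_eqI[where T = "\<lambda>f. lin \<phi> (inr f)"])
    (auto simp: slinear_def ahom_simps[OF ahom_inr] lin_add lin_scal_mult inr_mon assms)

lemma lin_mon_id: "lin mon f = f"
  by (rule slinear_eqI[OF slinear_lin]) (simp_all add: slinear_def)

text \<open>The counit takes values in \<open>real fps\<close>, which is not of the form
  \<open>'k alg\<close>; composed with the injective \<open>scal\<close> it becomes an instance of
  \<open>lin\<close>, and the general results on homomorphisms apply to it.\<close>

lemma scal_counit: "scal (counit \<kappa> f) = (lin (\<lambda>m. scal (fps_const (\<kappa> m))) f :: 'k::monoid_add alg)"
proof (rule fps_ext)
  fix n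
  have "fps_nth (lin (\<lambda>m. scal (fps_const (\<kappa> m))) f :: 'k alg) n = (\<Sum>j\<le>n. if j = n then
    (\<Sum>m\<in>Poly_Mapping.keys (fps_nth f n). Poly_Mapping.single 0 (Poly_Mapping.lookup (fps_nth f n) m * \<kappa> m)) else 0)"
    unfolding lin_def fps_nth_Abs_fps by (rule sum.cong) (auto simp: mult_single)
  then show "fps_nth (scal (counit \<kappa> f)) n = fps_nth (lin (\<lambda>m. scal (fps_const (\<kappa> m))) f :: 'k alg) n"
    by (simp add: counit_def single_sum)
qed

lemma mhom_scal_const: "mhom \<kappa> \<Longrightarrow> mhom (\<lambda>m. scal (fps_const (\<kappa> m)) :: 'k::monoid_add alg)"
  by (simp add: mhom_def flip: scal_mult)

lemma ahom_scal_counit: "mhom \<kappa> \<Longrightarrow> ahom (\<lambda>f. scal (counit \<kappa> f) :: 'k::monoid_add alg)"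
  unfolding scal_counit by (rule ahom_lin[OF mhom_scal_const])

lemma counit_simps:
  fixes \<kappa> :: "'m::monoid_add \<Rightarrow> real"
  assumes "mhom \<kappa>"
  shows "counit \<kappa> (f + g) = counit \<kappa> f + counit \<kappa> g" "counit \<kappa> (f * g) = counit \<kappa> f * counit \<kappa> g"
    "counit \<kappa> (f - g) = counit \<kappa> f - counit \<kappa> g"
    "counit \<kappa> 1 = 1" "counit \<kappa> (scal r) = r" "counit \<kappa> (mon m) = fps_const (\<kappa> m)"
proof -
  note * = ahom_simps[OF ahom_scal_counit[OF assms, where 'k = 'm]]
  show "counit \<kappa> (f + g) = counit \<kappa> f + counit \<kappa> g" "counit \<kappa> (f * g) = counit \<kappa> f * counit \<kappa> g"
    "counit \<kappa> (f - g) = counit \<kappa> f - counit \<kappa> g" "counit \<kappa> (scal r) = r"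
    using *(1)[of f g] *(2)[of f g] *(7)[of f g] *(3)[of r]
    by (simp_all add: scal_inj flip: scal_add scal_mult scal_diff)
  show "counit \<kappa> 1 = 1"
    using *(4) by (metis scal_1 scal_inj)
  have "scal (counit \<kappa> (mon m)) = (scal (fps_const (\<kappa> m)) :: 'm alg)"
    by (simp add: scal_counit)
  then show "counit \<kappa> (mon m) = fps_const (\<kappa> m)"
    by (simp only: scal_inj)
qed

section \<open>Rebracketing and the two iterated coproducts\<close>

definition assoc3 :: "(('m \<times> 'm) \<times> 'm) alg \<Rightarrow> ('m::monoid_add \<times> 'm \<times> 'm) alg" where
  "assoc3 = lin (\<lambda>((p, q), r). mon (p, q, r))"

lemma ahom_assoc3: "ahom assoc3"
  unfolding assoc3_def by (rule ahom_lin) (auto simp: mhom_def mon_mult zero_prod_def split_beta simp flip: mon_0)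

lemma assoc3_inl_inl: "assoc3 (inl (inl f)) = inl f"
  and assoc3_inl_inr: "assoc3 (inl (inr f)) = inr (inl f)"
  and assoc3_inr: "assoc3 (inr f) = inr (inr f)"
proof -
  note hom = ahom_slinear[OF ahom_comp[OF ahom_assoc3 ahom_comp[OF ahom_inl ahom_inl]]]
    ahom_slinear[OF ahom_inl] ahom_slinear[OF ahom_comp[OF ahom_assoc3 ahom_comp[OF ahom_inl ahom_inr]]]
    ahom_slinear[OF ahom_comp[OF ahom_inr ahom_inl]] ahom_slinear[OF ahom_comp[OF ahom_assoc3 ahom_inr]]
    ahom_slinear[OF ahom_comp[OF ahom_inr ahom_inr]]
  show "assoc3 (inl (inl f)) = inl f"
    by (rule slinear_eqI[OF hom(1,2)]) (simp add: inl_mon assoc3_def zero_prod_def)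
  show "assoc3 (inl (inr f)) = inr (inl f)"
    by (rule slinear_eqI[OF hom(3,4)]) (simp add: inl_mon inr_mon assoc3_def)
  show "assoc3 (inr f) = inr (inr f)"
    by (rule slinear_eqI[OF hom(5,6)]) (simp add: inr_mon assoc3_def zero_prod_def)
qed

lemma tens_id_conv: "tens_id \<delta> = lin (\<lambda>(a, b). assoc3 (\<delta> a \<boxtimes> mon b))"
  by (simp add: tens_id_def assoc3_def)

lemma ahom_tens_id: "mhom \<delta> \<Longrightarrow> ahom (tens_id \<delta>)"
  unfolding tens_id_conv
  by (rule ahom_lin)
    (auto simp: mhom_def zero_prod_def ahom_simps[OF ahom_assoc3] simp flip: tens_mult mon_mult)

lemma ahom_id_tens: "mhom \<delta> \<Longrightarrow> ahom (id_tens \<delta>)"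
  unfolding id_tens_def
  by (rule ahom_lin) (auto simp: mhom_def zero_prod_def tens_mult mon_mult)

lemma tens_id_inl: "tens_id \<delta> (inl f) = assoc3 (inl (lin \<delta> f))"
  for \<delta> :: "'m::monoid_add \<Rightarrow> ('m \<times> 'm) alg"
  by (rule slinear_eqI[where T = "\<lambda>f. tens_id \<delta> (inl f)"])
    (auto simp: tens_id_conv slinear_def ahom_simps[OF ahom_inl] ahom_simps[OF ahom_assoc3]
      lin_add lin_scal_mult inl_mon inl_conv[symmetric])

lemma tens_id_inr: "mhom \<delta> \<Longrightarrow> tens_id \<delta> (inr f) = assoc3 (inr f)"
  by (rule slinear_eqI[where T = "\<lambda>f. tens_id \<delta> (inr f)"])
    (auto simp: tens_id_conv slinear_def ahom_simps[OF ahom_inr] ahom_simps[OF ahom_assoc3]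
      lin_add lin_scal_mult inr_mon inr_conv[symmetric] mhom_def)

lemma id_tens_inl: "mhom \<delta> \<Longrightarrow> id_tens \<delta> (inl f) = inl f"
  by (rule slinear_eqI[where T = "\<lambda>f. id_tens \<delta> (inl f)"])
    (auto simp: id_tens_def slinear_def ahom_simps[OF ahom_inl]
      lin_add lin_scal_mult inl_mon inl_conv[symmetric] mhom_def)

lemma id_tens_inr: "id_tens \<delta> (inr f) = inr (lin \<delta> f)"
  for \<delta> :: "'m::monoid_add \<Rightarrow> ('m \<times> 'm) alg"
  by (rule slinear_eqI[where T = "\<lambda>f. id_tens \<delta> (inr f)"])
    (auto simp: id_tens_def slinear_def ahom_simps[OF ahom_inr]
      lin_add lin_scal_mult inr_mon inr_conv[symmetric])

definition counit_left :: "('m \<Rightarrow> real) \<Rightarrow> ('m \<times> 'm::monoid_add) alg \<Rightarrow> 'm alg" where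
  "counit_left \<kappa> = lin (\<lambda>(a, b). scal (fps_const (\<kappa> a)) * mon b)"

definition counit_right :: "('m \<Rightarrow> real) \<Rightarrow> ('m \<times> 'm::monoid_add) alg \<Rightarrow> 'm alg" where
  "counit_right \<kappa> = lin (\<lambda>(a, b). scal (fps_const (\<kappa> b)) * mon a)"

lemma ahom_counit_left: "mhom \<kappa> \<Longrightarrow> ahom (counit_left \<kappa>)"
  unfolding counit_left_def
  by (rule ahom_lin) (auto simp: mhom_def zero_prod_def scal_left_commute[of "mon _"] mult.assoc
      scal_mult simp flip: mon_mult fps_const_mult)

lemma ahom_counit_right: "mhom \<kappa> \<Longrightarrow> ahom (counit_right \<kappa>)"
  unfolding counit_right_def
  by (rule ahom_lin) (auto simp: mhom_def zero_prod_def scal_left_commute[of "mon _"] mult.assoc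
      scal_mult simp flip: mon_mult fps_const_mult)

lemma counit_left_inl: "counit_left \<kappa> (inl f) = scal (counit \<kappa> f)"
  and counit_right_inr: "counit_right \<kappa> (inr f) = scal (counit \<kappa> f)"
  unfolding counit_left_def counit_right_def scal_counit by (auto intro: lin_inl lin_inr)

lemma counit_left_inr: "mhom \<kappa> \<Longrightarrow> counit_left \<kappa> (inr f) = f"
  and counit_right_inl: "mhom \<kappa> \<Longrightarrow> counit_right \<kappa> (inl f) = f"
  unfolding counit_left_def counit_right_def
  by (subst lin_inl[where \<psi> = mon] lin_inr[where \<psi> = mon]; simp add: mhom_def lin_mon_id)+

text \<open>Coassociativity and the counit laws are identities on the word algebra already; the
  relations enter only in showing that the maps descend.\<close>

lemma bialgebraI:
  fixes \<delta> :: "'m::monoid_add \<Rightarrow> ('m \<times> 'm) alg"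
  assumes \<delta>: "mhom \<delta>" and \<kappa>: "mhom \<kappa>"
    and rel: "\<And>s. s \<in> S \<Longrightarrow> lin \<delta> s \<in> tker I I" "\<And>s. s \<in> S \<Longrightarrow> counit \<kappa> s = 0"
    and I: "I = closed_ideal S"
    and coassoc: "\<And>f. tens_id \<delta> (lin \<delta> f) = id_tens \<delta> (lin \<delta> f)"
    and counit: "\<And>f. counit_left \<kappa> (lin \<delta> f) = f" "\<And>f. counit_right \<kappa> (lin \<delta> f) = f"
  shows "bialgebra I \<delta> \<kappa>" "descends I (tker I I) (lin \<delta>)"
proof -
  have cI: "cideal I"
    by (simp add: I cideal_closed_ideal)
  let ?I2 = "tker I I" and ?I3 = "tker I (tker I I)"
  note hom = ahom_lin[OF \<delta>] ahom_tens_id[OF \<delta>] ahom_id_tens[OF \<delta>] ahom_counit_left[OF \<kappa>] ahom_counit_right[OF \<kappa>]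
  have \<delta>I: "lin \<delta> f \<in> ?I2" if "f \<in> I" for f
    using closed_ideal_image[OF hom(1) cideal_tker rel(1)] that I by blast
  have \<kappa>I: "counit \<kappa> f = 0" if "f \<in> I" for f
    using closed_ideal_image[OF ahom_scal_counit[OF \<kappa>, where 'k = 'm] cideal_singleton_0, of S f] rel(2) that I
    by (metis scal_0 scal_inj singletonD singletonI)
  show D: "descends I ?I2 (lin \<delta>)"
    using hom(1) cI cideal_tker \<delta>I by (rule descends_ahomI)
  have D1: "descends ?I2 ?I3 (tens_id \<delta>)"
  proof (rule descends_ahomI[OF hom(2) cideal_tker cideal_tker], rule tker_image[OF hom(2) cideal_tker])
    fix f
    assume "f \<in> I"
    \<comment> \<open>The kernel on the first two legs is generated by I in either leg. Rebracketing
      moves the first leg to \<open>inl\<close> and the second to \<open>inr\<close> of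
      \<open>inl\<close>, both inside the kernel on three legs.\<close>
    have "assoc3 (inl y) \<in> ?I3" if "y \<in> ?I2" for y
      by (rule tker_image[OF ahom_comp[OF ahom_assoc3 ahom_inl] cideal_tker _ _ that])
        (simp_all add: assoc3_inl_inl assoc3_inl_inr inl_tker inr_tker)
    then show "tens_id \<delta> (inl f) \<in> ?I3"
      by (simp add: tens_id_inl \<delta>I \<open>f \<in> I\<close>)
    show "tens_id \<delta> (inr f) \<in> ?I3"
      by (simp add: tens_id_inr[OF \<delta>] assoc3_inr inr_tker \<open>f \<in> I\<close>)
  qed
  have D2: "descends ?I2 ?I3 (id_tens \<delta>)"
    by (rule descends_ahomI[OF hom(3) cideal_tker cideal_tker], rule tker_image[OF hom(3) cideal_tker])
      (simp_all add: id_tens_inl[OF \<delta>] id_tens_inr inl_tker inr_tker \<delta>I)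
  have D3: "descends I {0} (counit \<kappa>)"
    using \<kappa>I by (intro descendsI cideal_ideal[OF cI]) (auto simp: counit_simps[OF \<kappa>] ideal_iff)
  have D4: "descends ?I2 I (counit_left \<kappa>)"
    by (rule descends_ahomI[OF hom(4) cideal_tker cI], rule tker_image[OF hom(4) cI])
      (simp_all add: counit_left_inl counit_left_inr[OF \<kappa>] \<kappa>I cideal_0[OF cI])
  have D5: "descends ?I2 I (counit_right \<kappa>)"
    by (rule descends_ahomI[OF hom(5) cideal_tker cI], rule tker_image[OF hom(5) cI])
      (simp_all add: counit_right_inr counit_right_inl[OF \<kappa>] \<kappa>I cideal_0[OF cI])
  show "bialgebra I \<delta> \<kappa>"
    unfolding bialgebra_def Let_def counit_left_def[symmetric] counit_right_def[symmetric]
    using D D1 D2 D3 D4 D5 cideal_ideal[OF cI]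
    by (auto simp: carrier_qring descends_cls coassoc counit)
qed

lemma ahom_tens_map:
  fixes \<phi> :: "'m::monoid_add \<Rightarrow> 'k::monoid_add alg"
  assumes "mhom \<phi>"
  shows "ahom (lin (\<lambda>(a, b). \<phi> a \<boxtimes> \<phi> b))"
  by (rule ahom_lin) (use assms in \<open>auto simp: mhom_def zero_prod_def tens_mult\<close>)

lemma
  fixes \<phi> :: "'m::monoid_add \<Rightarrow> 'k::monoid_add alg"
  assumes \<phi>: "mhom \<phi>"
  shows tens_map_inl: "lin (\<lambda>(a, b). \<phi> a \<boxtimes> \<phi> b) (inl f) = inl (lin \<phi> f)"
    and tens_map_inr: "lin (\<lambda>(a, b). \<phi> a \<boxtimes> \<phi> b) (inr f) = inr (lin \<phi> f)"
proof -
  note hom = ahom_lin[OF \<phi>] and hom2 = ahom_tens_map[OF \<phi>]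
  have \<phi>0: "\<phi> 0 = 1"
    using \<phi> by (simp add: mhom_def)
  show "lin (\<lambda>(a, b). \<phi> a \<boxtimes> \<phi> b) (inl f) = inl (lin \<phi> f)"
    by (rule slinear_eqI[OF ahom_slinear[OF ahom_comp[OF hom2 ahom_inl]]
          ahom_slinear[OF ahom_comp[OF ahom_inl hom]]]) (simp add: inl_mon \<phi>0 flip: inl_conv)
  show "lin (\<lambda>(a, b). \<phi> a \<boxtimes> \<phi> b) (inr f) = inr (lin \<phi> f)"
    by (rule slinear_eqI[OF ahom_slinear[OF ahom_comp[OF hom2 ahom_inr]]
          ahom_slinear[OF ahom_comp[OF ahom_inr hom]]]) (simp add: inr_mon \<phi>0 flip: inr_conv)
qed

lemma bialgebra_homI:
  fixes \<delta> :: "'m::monoid_add \<Rightarrow> ('m \<times> 'm) alg" and \<delta>' :: "'k::monoid_add \<Rightarrow> ('k \<times> 'k) alg"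
  assumes D: "descends I (tker I I) (lin \<delta>)" "descends J (tker J J) (lin \<delta>')"
    and I: "cideal I" and J: "cideal J" and \<phi>: "mhom \<phi>"
    and rel: "\<And>f. f \<in> I \<Longrightarrow> lin \<phi> f \<in> J"
    and cop: "\<And>f. lin (\<lambda>(a, b). \<phi> a \<boxtimes> \<phi> b) (lin \<delta> f) = lin \<delta>' (lin \<phi> f)"
    and counit: "\<And>f. counit \<kappa>' (lin \<phi> f) = counit \<kappa> f"
  shows "bialgebra_hom I \<delta> \<kappa> J \<delta>' \<kappa>' \<phi>"
proof -
  let ?\<phi>2 = "lin (\<lambda>(a, b). \<phi> a \<boxtimes> \<phi> b)"
  note hom = ahom_lin[OF \<phi>]
  note T2 = tens_map_inl[OF \<phi>] tens_map_inr[OF \<phi>] and hom2 = ahom_tens_map[OF \<phi>]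
  have "descends (tker I I) (tker J J) ?\<phi>2"
    by (intro descends_ahomI[OF hom2 cideal_tker cideal_tker], elim tker_image[OF hom2 cideal_tker, rotated 2])
      (simp_all add: T2 rel inl_tker inr_tker)
  moreover have "descends I J (lin \<phi>)"
    using hom I J rel by (rule descends_ahomI)
  ultimately show ?thesis
    unfolding bialgebra_hom_def Let_def
    using D by (auto simp: carrier_qring descends_cls cop counit ahom_simps(3)[OF hom])
qed

section \<open>Exponentials of topologically nilpotent elements\<close>

definition dpow :: "'m::monoid_add alg \<Rightarrow> nat \<Rightarrow> 'm alg" where
  "dpow a k = scal (fps_const (1 / fact k)) * a ^ k"

text \<open>If a has constant term zero, \<open>a^k\<close> starts in degree k or later, so the
  cut-off at \<open>k \<le> n\<close> loses nothing in degree n.\<close>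

definition nexp :: "'m::monoid_add alg \<Rightarrow> 'm alg" where
  "nexp a = Abs_fps (\<lambda>n. fps_nth (\<Sum>k\<le>n. dpow a k) n)"

lemma nilpotent_mult_nth:
  fixes a c :: "'a::ring_1 fps"
  assumes "fps_nth a 0 = 0" "\<And>m. m < k \<Longrightarrow> fps_nth c m = 0" "n < Suc k"
  shows "fps_nth (a * c) n = 0"
proof -
  have "fps_nth a i * fps_nth c (n - i) = 0" if "i \<in> {0..n}" for i
    using that assms by (cases i) auto
  then show ?thesis
    by (simp add: fps_mult_nth)
qed

lemma nilpotent_power_nth:
  fixes a :: "'a::ring_1 fps"
  assumes "fps_nth a 0 = 0" "n < k"
  shows "fps_nth (a ^ k) n = 0"
  using assms(2)
proof (induction k arbitrary: n)
  case (Suc k)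
  then show ?case
    using nilpotent_mult_nth[OF assms(1), of k "a ^ k" n] by simp
qed simp

lemma scal_mult_power: "(scal c * a) ^ k = scal (c ^ k) * (a :: 'm::monoid_add alg) ^ k"
proof (induction k)
  case (Suc k)
  have "(scal c * a) ^ Suc k = scal c * (a * (scal (c ^ k) * a ^ k))"
    by (simp add: Suc mult.assoc)
  also have "\<dots> = scal (c ^ Suc k) * a ^ Suc k"
    by (simp only: scal_left_commute[of a] scal_mult mult.assoc power_Suc)
  finally show ?case .
qed simp

lemma scal_const_mult_nth:
  "fps_nth (scal (fps_const c) * a) n = Poly_Mapping.single 0 c * fps_nth a n"
  for a :: "'m::monoid_add alg"
proof -
  have "scal (fps_const c) = (fps_const (Poly_Mapping.single 0 c) :: 'm alg)"
    by (rule fps_ext) simp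
  then show ?thesis by simp
qed

lemma dpow_nth:
  assumes "fps_nth a 0 = 0" "n < k"
  shows "fps_nth (dpow a k) n = 0"
  using nilpotent_power_nth[OF assms] by (simp add: dpow_def scal_const_mult_nth)

lemma nexp_nth:
  assumes "fps_nth a 0 = 0" "n < M"
  shows "fps_nth (nexp a) n = fps_nth (\<Sum>k<M. dpow a k) n"
  unfolding nexp_def fps_nth_Abs_fps fps_sum_nth
  using assms dpow_nth[OF assms(1)] by (intro sum.mono_neutral_left) auto

lemma dpow_Suc: "a * dpow a n = scal (of_nat (Suc n)) * dpow a (Suc n)"
proof -
  have "of_nat (Suc n) * fps_const (1 / fact (Suc n)) = (fps_const (1 / fact n) :: real fps)"
    by (simp add: fps_eq_iff fps_of_nat[symmetric] del: of_nat_Suc)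
  then have "scal (of_nat (Suc n)) * dpow a (Suc n) = scal (fps_const (1 / fact n)) * (a * a ^ n)"
    by (simp only: dpow_def flip: mult.assoc scal_mult power_Suc)
  then show ?thesis
    by (simp only: dpow_def[of a n] scal_left_commute[of a])
qed

text \<open>The binomial theorem for commuting elements of a noncommutative ring. The induction step
  is carried out after multiplication by \<open>n + 1\<close>, because multiplying by a and by b
  produces the weights i and \<open>n + 1 - i\<close>, which add up to \<open>n + 1\<close>.\<close>

lemma dpow_add:
  assumes comm: "a * b = b * a"
  shows "dpow (a + b) n = (\<Sum>i\<le>n. dpow a i * dpow b (n - i))"
proof (induction n)
  case 0
  show ?case by (simp add: dpow_def)
next
  case (Suc n)
  let ?s = "\<lambda>k. scal (of_nat k) :: 'a alg"
  have comm': "b * dpow a i = dpow a i * b" for i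
    by (simp add: dpow_def scal_left_commute power_commuting_commutes comm mult.assoc)
  have "?s (Suc n) * dpow (a + b) (Suc n) = (a + b) * (\<Sum>i\<le>n. dpow a i * dpow b (n - i))"
    by (simp only: Suc[symmetric] dpow_Suc)
  also have "\<dots> = (\<Sum>i\<le>n. (a * dpow a i) * dpow b (n - i)) + (\<Sum>i\<le>n. dpow a i * (b * dpow b (n - i)))"
    by (simp only: distrib_right sum_distrib_left comm' mult.assoc[symmetric] sum.distrib)
  also have "(\<Sum>i\<le>n. (a * dpow a i) * dpow b (n - i)) =
      (\<Sum>i\<le>n. ?s (Suc i) * (dpow a (Suc i) * dpow b (Suc n - Suc i)))"
    by (simp add: dpow_Suc mult.assoc)
  also have "\<dots> = (\<Sum>i\<le>Suc n. ?s i * (dpow a i * dpow b (Suc n - i)))"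
    by (subst sum.atMost_Suc_shift[where n = n]) simp
  also have "(\<Sum>i\<le>n. dpow a i * (b * dpow b (n - i))) =
      (\<Sum>i\<le>n. ?s (Suc n - i) * (dpow a i * dpow b (Suc n - i)))"
    by (rule sum.cong) (simp_all add: dpow_Suc Suc_diff_le scal_left_commute)
  also have "\<dots> = (\<Sum>i\<le>Suc n. ?s (Suc n - i) * (dpow a i * dpow b (Suc n - i)))"
    by simp
  also have "(\<Sum>i\<le>Suc n. ?s i * (dpow a i * dpow b (Suc n - i))) +
      (\<Sum>i\<le>Suc n. ?s (Suc n - i) * (dpow a i * dpow b (Suc n - i))) =
      (\<Sum>i\<le>Suc n. ?s (Suc n) * (dpow a i * dpow b (Suc n - i)))"
    unfolding sum.distrib[symmetric]
    by (rule sum.cong) (simp_all only: distrib_right[symmetric] scal_add[symmetric] of_nat_add[symmetric]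
        atMost_iff le_add_diff_inverse)
  also have "\<dots> = ?s (Suc n) * (\<Sum>i\<le>Suc n. dpow a i * dpow b (Suc n - i))"
    by (simp only: sum_distrib_left)
  finally show ?case
    by (rule scal_cancel[rotated]) (simp del: of_nat_Suc)
qed

lemma nexp_add:
  assumes comm: "a * b = b * a" and a0: "fps_nth a 0 = 0" and b0: "fps_nth b 0 = 0"
  shows "nexp (a + b) = nexp a * nexp b"
proof (rule fps_ext)
  fix n
  let ?M = "Suc n"
  \<comment> \<open>Such products have no terms in degree n. This allows the triangle
    \<open>i + j < n + 1\<close> to be enlarged to a square, over which the sum factors.\<close>
  have mult_0: "fps_nth (dpow a i * dpow b j) n = 0" if "i + j \<ge> ?M" for i j
  proof -
    have "fps_nth (dpow a i) l * fps_nth (dpow b j) (n - l) = 0" if "l \<in> {0..n}" for l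
      using that \<open>i + j \<ge> ?M\<close> dpow_nth[OF a0, of l i] dpow_nth[OF b0, of "n - l" j]
      by (cases "l < i") auto
    then show ?thesis
      by (simp add: fps_mult_nth)
  qed
  have "fps_nth (nexp (a + b)) n = (\<Sum>k<?M. \<Sum>i\<le>k. fps_nth (dpow a i * dpow b (k - i)) n)"
    using nexp_nth[of "a + b" n ?M] a0 b0 by (simp add: dpow_add[OF comm] fps_sum_nth)
  also have "\<dots> = (\<Sum>(i, j)\<in>{(i, j). i + j < ?M}. fps_nth (dpow a i * dpow b j) n)"
    by (rule sum.triangle_reindex[symmetric])
  also have "\<dots> = (\<Sum>(i, j)\<in>{..<?M} \<times> {..<?M}. fps_nth (dpow a i * dpow b j) n)"
    using mult_0 by (intro sum.mono_neutral_left) (auto simp: not_less[symmetric])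
  also have "\<dots> = fps_nth ((\<Sum>i<?M. dpow a i) * (\<Sum>j<?M. dpow b j)) n"
    by (simp add: sum_product fps_sum_nth sum.cartesian_product split_beta del: sum.lessThan_Suc)
  also have "\<dots> = fps_nth (nexp a * nexp b) n"
    unfolding fps_mult_nth
    by (rule sum.cong) (simp_all add: nexp_nth[OF a0, of _ ?M] nexp_nth[OF b0, of _ ?M] del: sum.lessThan_Suc)
  finally show "fps_nth (nexp (a + b)) n = fps_nth (nexp a * nexp b) n" .
qed

lemma ahom_nth_0:
  assumes "ahom T" "fps_nth a 0 = 0"
  shows "fps_nth (T a) 0 = 0"
  using slinear_agree[OF ahom_slinear[OF assms(1)], of 1 a 0 0] assms by (simp add: ahom_simps)

lemma ahom_nexp:
  assumes T: "ahom T" and a0: "fps_nth a 0 = 0"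
  shows "T (nexp a) = nexp (T a)"
proof (rule fps_ext)
  fix n
  have "fps_nth (T (nexp a)) n = fps_nth (T (\<Sum>k<Suc n. dpow a k)) n"
    by (rule slinear_agree[OF ahom_slinear[OF T], of "Suc n"]) (auto simp only: nexp_nth[OF a0])
  also have "T (\<Sum>k<Suc n. dpow a k) = (\<Sum>k<Suc n. dpow (T a) k)"
    by (simp only: slinear_sum[OF ahom_slinear[OF T]] dpow_def ahom_simps[OF T])
  also have "fps_nth \<dots> n = fps_nth (nexp (T a)) n"
    by (rule nexp_nth[symmetric]) (simp_all add: ahom_nth_0[OF T a0])
  finally show "fps_nth (T (nexp a)) n = fps_nth (nexp (T a)) n" .
qed

text \<open>\<open>a y = y b\<close> modulo K passes to all powers, hence to truncated exponentials,
  and to the exponentials themselves because K is closed.\<close>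

lemma nexp_intertwine:
  assumes K: "cideal K" and y: "a * y - y * b \<in> K" and a0: "fps_nth a 0 = 0" and b0: "fps_nth b 0 = 0"
  shows "nexp a * y - y * nexp b \<in> K"
proof (rule cideal_lim[OF K])
  fix N
  have pow: "a ^ k * y - y * b ^ k \<in> K" for k
  proof (induction k)
    case (Suc k)
    have "a ^ Suc k * y - y * b ^ Suc k = a * (a ^ k * y - y * b ^ k) + (a * y - y * b) * b ^ k"
      by (simp add: algebra_simps power_commutes)
    then show ?case
      using Suc y by (simp add: cideal_add[OF K] cideal_lmult[OF K] cideal_rmult[OF K])
  qed (simp add: cideal_0[OF K])
  have "dpow a k * y - y * dpow b k = scal (fps_const (1 / fact k)) * (a ^ k * y - y * b ^ k)" for k
    by (simp add: dpow_def right_diff_distrib mult.assoc scal_left_commute[of y])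
  then have "(\<Sum>k<N. dpow a k * y - y * dpow b k) \<in> K"
    using pow by (intro cideal_sum[OF K]) (simp add: cideal_lmult[OF K])
  then have "(\<Sum>k<N. dpow a k) * y - y * (\<Sum>k<N. dpow b k) \<in> K"
    by (simp add: sum_subtractf sum_distrib_left sum_distrib_right)
  moreover have "fps_nth (nexp a * y - y * nexp b) n =
      fps_nth ((\<Sum>k<N. dpow a k) * y - y * (\<Sum>k<N. dpow b k)) n" if "n < N" for n
  proof -
    have "fps_nth (nexp a * y) n = fps_nth ((\<Sum>k<N. dpow a k) * y) n"
      "fps_nth (y * nexp b) n = fps_nth (y * (\<Sum>k<N. dpow b k)) n"
      unfolding fps_mult_nth using that
      by (intro sum.cong; simp add: nexp_nth[OF a0, of _ N] nexp_nth[OF b0, of _ N])+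
    then show ?thesis by simp
  qed
  ultimately show "\<exists>g\<in>K. \<forall>n<N. fps_nth (nexp a * y - y * nexp b) n = fps_nth g n"
    by blast
qed

lemma fexp_nth: "fps_nth (fexp r) n = (\<Sum>k\<le>n. fps_nth (r ^ k) n / fact k)"
  by (simp add: fexp_def fps_compose_nth atMost_atLeast0)

lemma nexp_scal: "nexp (scal r) = scal (fexp r)"
  by (rule fps_ext)
    (simp add: nexp_def dpow_def fexp_nth fps_sum_nth single_sum flip: scal_power scal_mult)

lemma fexp_0 [simp]: "fexp 0 = 1"
  by (simp add: fexp_def)

lemma nexp_0 [simp]: "nexp 0 = 1"
  using nexp_scal[of 0] by simp

section \<open>Words\<close>

lemma mhom_zlift: "mhom (zlift g)"
proof -
  have "zlift g (v + w) = zlift g v * zlift g w" for v w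
    by (cases v; cases w) simp
  then show ?thesis
    by (simp add: mhom_def zero_zword_def)
qed

lemma mhom_zword_eqI:
  assumes "mhom \<phi>" "mhom \<psi>" "\<And>i. \<phi> (ZW [i]) = \<psi> (ZW [i])"
  shows "\<phi> w = \<psi> w"
proof -
  have "\<phi> (ZW v) = \<psi> (ZW v)" for v
  proof (induction v)
    case Nil
    show ?case
      using assms(1,2) by (simp add: mhom_def flip: zero_zword_def)
  next
    case (Cons i v)
    have "\<phi> (ZW [i] + ZW v) = \<psi> (ZW [i] + ZW v)"
      using assms Cons by (simp add: mhom_def del: plus_zword.simps)
    then show ?case by simp
  qed
  then show ?thesis
    by (cases w) simp
qed

lemma ahom_zword_eqI:
  assumes "ahom T" "ahom U" "\<And>i. T (genz i) = U (genz i)"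
  shows "T f = U f"
proof (rule slinear_eqI[OF assms(1,2)[THEN ahom_slinear]])
  show "T (mon m) = U (mon m)" for m
    by (rule mhom_zword_eqI[OF assms(1,2)[THEN mhom_ahom_mon]]) (rule assms(3)[unfolded genz_def])
qed

lemma lin_zlift_genz [simp]: "lin (zlift g) (genz i) = g i"
  by (simp add: genz_def)

definition zpow :: "'r::monoid_mult \<Rightarrow> 'r \<Rightarrow> int \<Rightarrow> 'r" where
  "zpow p q k = (if k \<ge> 0 then p ^ nat k else q ^ nat (- k))"

lemma zpow_add_1:
  assumes "p * q = 1" "q * p = 1"
  shows "zpow p q (k + 1) = p * zpow p q k" "zpow p q (k - 1) = q * zpow p q k"
proof -
  have 1: "p * (q * x) = x" "q * (p * x) = x" for x
    using assms by (simp_all flip: mult.assoc)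
  show "zpow p q (k + 1) = p * zpow p q k"
  proof (cases "k \<ge> 0")
    case False
    then have "nat (- k) = Suc (nat (- (k + 1)))" by simp
    with False show ?thesis
      by (auto simp: zpow_def 1)
  qed (simp add: zpow_def nat_add_distrib)
  show "zpow p q (k - 1) = q * zpow p q k"
  proof (cases "k > 0")
    case True
    then have "nat k = Suc (nat (k - 1))" by simp
    with True show ?thesis
      by (auto simp: zpow_def 1)
  next
    case False
    then have "nat (- (k - 1)) = Suc (nat (- k))" by simp
    with False show ?thesis
      by (auto simp: zpow_def)
  qed
qed

lemma zpow_add:
  assumes "p * q = 1" "q * p = 1"
  shows "zpow p q (k + l) = zpow p q k * zpow p q l"
proof (induction k rule: int_induct[where k = 0])
  case base
  show ?case by (simp add: zpow_def)
next
  case (step1 i)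
  have "zpow p q (i + 1 + l) = p * zpow p q (i + l)"
    using zpow_add_1(1)[OF assms, of "i + l"] by (simp add: algebra_simps)
  then show ?case
    by (simp add: step1 zpow_add_1(1)[OF assms] mult.assoc)
next
  case (step2 i)
  have "zpow p q (i - 1 + l) = q * zpow p q (i + l)"
    using zpow_add_1(2)[OF assms, of "i + l"] by (simp add: algebra_simps)
  then show ?case
    by (simp add: step2 zpow_add_1(2)[OF assms] mult.assoc)
qed

lemma xlift_zpow:
  "xlift p q g (XE k) = zpow p q k" "xlift p q g (XC k i w) = zpow p q k * g i * xlift p q g w"
  by (simp_all add: zpow_def)

lemma mhom_xlift:
  assumes "p * q = 1" "q * p = 1"
  shows "mhom (xlift p q g)"
proof -
  have shift: "xlift p q g (shift_xword k w) = zpow p q k * xlift p q g w" for k w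
    by (cases w) (simp_all add: xlift_zpow zpow_add[OF assms] mult.assoc del: xlift.simps)
  have "xlift p q g (v + w) = xlift p q g v * xlift p q g w" for v w
    by (induction v) (simp_all add: xlift_zpow shift mult.assoc del: xlift.simps)
  then show ?thesis
    by (simp add: mhom_def zero_xword_def)
qed

lemma mhom_xword_eqI:
  assumes hom: "mhom \<phi>" "mhom \<psi>" and eq: "\<phi> (XE 1) = \<psi> (XE 1)" "\<phi> (XE (- 1)) = \<psi> (XE (- 1))"
    "\<And>i. \<phi> (XC 0 i (XE 0)) = \<psi> (XC 0 i (XE 0))"
  shows "\<phi> w = \<psi> w"
proof -
  have add: "\<phi> (a + b) = \<phi> a * \<phi> b" "\<psi> (a + b) = \<psi> a * \<psi> b" for a b
    using hom by (simp_all add: mhom_def)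
  have eq_XE: "\<phi> (XE k) = \<psi> (XE k)" for k
  proof (induction k rule: int_induct[where k = 0])
    case base
    show ?case
      using hom by (simp add: mhom_def flip: zero_xword_def)
  next
    case (step1 i)
    then show ?case
      using add[of "XE 1" "XE i"] eq by (simp add: add.commute)
  next
    case (step2 i)
    have "XE (i - 1) = XE (- 1) + XE i"
      by simp
    then show ?case
      by (simp only: add eq step2)
  qed
  show ?thesis
  proof (induction w)
    case (XE k)
    show ?case by (rule eq_XE)
  next
    case (XC k i w)
    have "\<phi> (XE k + (XC 0 i (XE 0) + w)) = \<psi> (XE k + (XC 0 i (XE 0) + w))"
      unfolding add by (simp add: eq_XE XC eq)
    moreover have "XE 0 + w = w"
      using add_0_left[of w] by (simp only: zero_xword_def)
    ultimately show ?case by simp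
  qed
qed

lemma ahom_xword_eqI:
  assumes "ahom T" "ahom U" "T (expx 1) = U (expx 1)" "T (expx (- 1)) = U (expx (- 1))"
    "\<And>i. T (genx i) = U (genx i)"
  shows "T f = U f"
proof (rule slinear_eqI[OF assms(1,2)[THEN ahom_slinear]])
  show "T (mon m) = U (mon m)" for m
    by (rule mhom_xword_eqI[OF assms(1,2)[THEN mhom_ahom_mon]]) (rule assms(3-)[unfolded expx_def genx_def])+
qed

lemma lin_xlift_gen [simp]:
  "lin (xlift p q g) (expx 1) = p" "lin (xlift p q g) (expx (- 1)) = q" "lin (xlift p q g) (genx i) = g i"
  by (simp_all add: expx_def genx_def)

lemma expx_mult: "expx k * expx l = expx (k + l)"
  by (simp add: expx_def mon_mult)

lemma expx_0 [simp]: "expx 0 = 1"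
  by (simp add: expx_def flip: zero_xword_def)

section \<open>Series in one generator\<close>

lemma genz_power: "genz i ^ k = mon (ZW (replicate k i))"
  by (induction k) (simp_all add: genz_def mon_mult flip: zero_zword_def)

lemma z_series_nth:
  assumes "\<And>k. k \<ge> M \<Longrightarrow> fps_nth (b k) n = 0"
  shows "fps_nth (z_series b) n = (\<Sum>k<M. Poly_Mapping.single (ZW (replicate k 1)) (fps_nth (b k) n))"
proof -
  have "{k. fps_nth (b k) n \<noteq> 0} \<subseteq> {..<M}"
    using assms by (auto simp: not_le[symmetric])
  then show ?thesis
    unfolding z_series_def fps_nth_Abs_fps by (intro sum.mono_neutral_left) auto
qed

lemma keys_z_series:
  assumes "m \<in> Poly_Mapping.keys (fps_nth (z_series b) n)"
  shows "\<exists>k. m = ZW (replicate k 1)"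
proof (rule ccontr)
  assume *: "\<nexists>k. m = ZW (replicate k 1)"
  have "Poly_Mapping.lookup (fps_nth (z_series b) n) m = 0"
    unfolding z_series_def fps_nth_Abs_fps lookup_sum lookup_single
    by (rule sum.neutral) (use * in \<open>auto simp: when_def\<close>)
  with assms show False
    by (simp add: in_keys_iff)
qed

text \<open>The slack of one degree is what the division by \<open>sinh(h)\<close> in \<open>sinh_ratio\<close> costs.\<close>

definition zconv :: "(nat \<Rightarrow> real fps) \<Rightarrow> bool" where
  "zconv b \<longleftrightarrow> (\<forall>n k. n + 1 < k \<longrightarrow> fps_nth (b k) n = 0)"

lemma z_series_nth': "zconv b \<Longrightarrow>
  fps_nth (z_series b) n = (\<Sum>k<n + 2. Poly_Mapping.single (ZW (replicate k 1)) (fps_nth (b k) n))"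
  by (rule z_series_nth) (simp add: zconv_def)

lemma z_series_scal:
  assumes b: "zconv b"
  shows "scal r * z_series b = z_series (\<lambda>k. r * b k)"
proof (rule fps_ext)
  fix n
  have rb: "zconv (\<lambda>k. r * b k)"
    using b by (auto simp: zconv_def fps_mult_nth intro!: sum.neutral)
  have "fps_nth (scal r * z_series b) n = (\<Sum>i=0..n. \<Sum>k<n + 2.
      Poly_Mapping.single 0 (fps_nth r i) * Poly_Mapping.single (ZW (replicate k 1)) (fps_nth (b k) (n - i)))"
    unfolding fps_mult_nth scal_nth sum_distrib_left[symmetric]
    by (intro sum.cong refl arg_cong2[where f = "(*)"] z_series_nth) (use b in \<open>auto simp: zconv_def\<close>)
  also have "\<dots> = fps_nth (z_series (\<lambda>k. r * b k)) n"
    by (subst sum.swap) (simp add: z_series_nth'[OF rb] mult_single fps_mult_nth single_sum del: sum.lessThan_Suc)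
  finally show "fps_nth (scal r * z_series b) n = fps_nth (z_series (\<lambda>k. r * b k)) n" .
qed

lemma z_series_diff:
  assumes "zconv b" "zconv c"
  shows "z_series b - z_series c = z_series (\<lambda>k. b k - c k)"
proof (rule fps_ext)
  fix n
  have "zconv (\<lambda>k. b k - c k)"
    using assms by (simp add: zconv_def)
  then show "fps_nth (z_series b - z_series c) n = fps_nth (z_series (\<lambda>k. b k - c k)) n"
    by (simp add: z_series_nth'[OF assms(1)] z_series_nth'[OF assms(2)] z_series_nth' single_diff sum_subtractf
        del: sum.lessThan_Suc)
qed

lemma zconv_exp: "fps_nth c 0 = 0 \<Longrightarrow> zconv (\<lambda>k. fps_const (1 / fact k) * c ^ k)"
  by (auto simp: zconv_def nilpotent_power_nth)

text \<open>Makes the addition, homomorphism and intertwining rules of \<open>nexp\<close> available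
  for the exponential series in z_1.\<close>

lemma expz_conv_nexp:
  assumes c0: "fps_nth c 0 = 0"
  shows "expz c = nexp (scal c * genz 1)"
proof (rule fps_ext)
  fix n
  have "dpow (scal c * genz 1) k = scal (fps_const (1 / fact k) * c ^ k) * mon (ZW (replicate k 1))" for k
    by (simp only: dpow_def scal_mult_power scal_mult mult.assoc genz_power)
  moreover have "fps_nth (scal r * mon m) n = Poly_Mapping.single m (fps_nth r n)" for r and m :: zword
    by (simp add: mon_def mult_single)
  ultimately have "fps_nth (nexp (scal c * genz 1)) n =
      (\<Sum>k<n + 2. Poly_Mapping.single (ZW (replicate k 1)) (fps_nth (fps_const (1 / fact k) * c ^ k) n))"
    by (subst nexp_nth[where M = "n + 2"]) (simp_all add: c0 fps_sum_nth del: sum.lessThan_Suc)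
  then show "fps_nth (expz c) n = fps_nth (nexp (scal c * genz 1)) n"
    by (simp add: expz_def z_series_nth'[OF zconv_exp[OF c0]] del: sum.lessThan_Suc)
qed

lemma expz_add:
  assumes "fps_nth c 0 = 0" "fps_nth d 0 = 0"
  shows "expz (c + d) = expz c * expz d"
proof -
  have "(scal c * genz 1) * (scal d * genz 1) = (scal d * genz 1) * (scal c * genz 1)"
    by (simp only: mult.assoc scal_left_commute[of "genz 1"])
      (simp only: mult.assoc[symmetric] scal_mult[symmetric] mult.commute)
  then show ?thesis
    using assms by (simp add: expz_conv_nexp scal_add distrib_right nexp_add)
qed

lemma fsinh_nonzero:
  assumes "fps_nth h 0 = 0" "fps_nth h 1 \<noteq> 0"
  shows "fps_nth (fsinh h) 0 = 0" "fps_nth (fsinh h) 1 \<noteq> 0" "fsinh h \<noteq> 0"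
proof -
  show *: "fps_nth (fsinh h) 0 = 0" "fps_nth (fsinh h) 1 \<noteq> 0"
    using assms by (simp_all add: fsinh_def fexp_nth)
  then show "fsinh h \<noteq> 0" by auto
qed

text \<open>Undoes the termwise division in \<open>sinh_ratio\<close>. Since sinh(h) can be
  cancelled, the coproduct and the counit of \<open>sinh_ratio\<close> can be computed from this
  exponential form.\<close>

lemma sinh_ratio_mult:
  assumes h: "fps_nth h 0 = 0" "fps_nth h 1 \<noteq> 0"
  shows "scal (fsinh h) * sinh_ratio h = scal (fps_const (1 / 2)) * (expz h - expz (- h))"
proof -
  let ?s = "fsinh h" and ?b = "\<lambda>k. if odd k then fps_const (1 / fact k) * h ^ k / fsinh h else 0"
  note s = fsinh_nonzero[OF h]
  have "subdegree ?s = 1" "subdegree h = 1"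
    using s(1,2) h by (auto intro!: subdegreeI)
  moreover have "h \<noteq> 0"
    using h by auto
  ultimately have dvd: "?s dvd h"
    using s(3) by (simp add: fps_dvd_iff)
  \<comment> \<open>Both h and sinh(h) have order one, so the single quotient
    \<open>h div ?s\<close> is a power series and leaves \<open>h ^ (k - 1)\<close>, of order
    \<open>k - 1\<close>; hence the slack of one degree.\<close>
  have b: "?b k = fps_const (1 / fact k) * h ^ (k - 1) * (h div ?s)" if odd: "odd k" for k
  proof -
    have "fps_const (1 / fact k) * h ^ k = (fps_const (1 / fact k) * h ^ (k - 1)) * h"
      using that by (cases k) (simp_all add: mult_ac)
    then show ?thesis
      using dvd by (simp only: div_mult_swap if_P[OF odd])
  qed
  have "zconv ?b"
    unfolding zconv_def
  proof (intro allI impI)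
    fix n k :: nat
    assume "n + 1 < k"
    show "fps_nth (?b k) n = 0"
    proof (cases "odd k")
      case True
      have "fps_nth (h ^ (k - 1) * (h div ?s)) n = (\<Sum>i=0..n. fps_nth (h ^ (k - 1)) i * fps_nth (h div ?s) (n - i))"
        by (rule fps_mult_nth)
      also have "\<dots> = 0"
        using \<open>n + 1 < k\<close> by (intro sum.neutral ballI) (simp add: nilpotent_power_nth[OF h(1)])
      finally show ?thesis
        unfolding b[OF True] by (simp add: mult.assoc)
    qed simp
  qed
  then have "scal ?s * sinh_ratio h = z_series (\<lambda>k. ?s * ?b k)"
    unfolding sinh_ratio_def by (rule z_series_scal)
  also have "(\<lambda>k. ?s * ?b k) = (\<lambda>k. fps_const (1 / 2) *
      (fps_const (1 / fact k) * h ^ k - fps_const (1 / fact k) * (- h) ^ k))"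
  proof
    fix k
    show "?s * ?b k = fps_const (1 / 2) * (fps_const (1 / fact k) * h ^ k - fps_const (1 / fact k) * (- h) ^ k)"
    proof (cases "odd k")
      case True
      then have "?s dvd fps_const (1 / fact k) * h ^ k"
        using dvd by (metis dvd_mult dvd_power_same dvd_trans dvd_refl dvd_power odd_pos)
      then have "?s * ?b k = fps_const (1 / fact k) * h ^ k"
        using True by simp
      also have "\<dots> = fps_const (1 / 2) * (2 * (fps_const (1 / fact k) * h ^ k))"
        by (simp add: fps_eq_iff numeral_fps_const flip: mult.assoc)
      finally show ?thesis
        by (simp only: power_minus_odd[OF True] mult_minus_right diff_minus_eq_add mult_2)
    qed (simp add: power_minus_even)
  qed
  also have "z_series \<dots> = scal (fps_const (1 / 2)) * (expz h - expz (- h))"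
  proof -
    have e: "zconv (\<lambda>k. fps_const (1 / fact k) * h ^ k)" "zconv (\<lambda>k. fps_const (1 / fact k) * (- h) ^ k)"
      using h by (intro zconv_exp; simp)+
    then have "zconv (\<lambda>k. fps_const (1 / fact k) * h ^ k - fps_const (1 / fact k) * (- h) ^ k)"
      by (simp add: zconv_def)
    then show ?thesis
      by (simp only: expz_def z_series_diff[OF e] z_series_scal)
  qed
  finally show ?thesis .
qed

section \<open>Coproducts and the defining relations\<close>

lemma scal_scal_mult: "scal r * (scal s * f) = scal (r * s) * (f :: 'm::monoid_add alg)"
  by (simp only: scal_mult mult.assoc)

lemmas tens_distribs = tens_mult tens_add_left tens_add_right tens_diff_left tens_diff_right
  tens_scal_left tens_scal_right

text \<open>The cross terms \<open>x\<^sub>2 e \<otimes> e' x\<^sub>3 - e x\<^sub>2 \<otimes> x\<^sub>3 e'\<close> cancel because \<open>e\<close> and \<open>e'\<close> \<open>q\<close>-commute with \<open>x\<^sub>2\<close> and \<open>x\<^sub>3\<close>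
  with the same factor.\<close>

lemma coproduct_commutator:
  fixes x y e e' :: "'m::monoid_add alg"
  assumes I: "e * x - scal t * x * e \<in> I" "e' * y - scal t * y * e' \<in> I"
    "e * y - scal t' * y * e \<in> I" "e' * x - scal t' * x * e' \<in> I"
  shows "commutator (x \<boxtimes> e' + e \<boxtimes> x) (y \<boxtimes> e' + e \<boxtimes> y) -
    (commutator x y \<boxtimes> (e' * e') + (e * e) \<boxtimes> commutator x y) \<in> tker I I" (is "?l \<in> _")
proof -
  have "?l = (x * e) \<boxtimes> (e' * y - scal t * y * e') - (e * x - scal t * x * e) \<boxtimes> (y * e') +
      (e * y - scal t' * y * e) \<boxtimes> (x * e') - (y * e) \<boxtimes> (e' * x - scal t' * x * e')"
    by (simp add: commutator_def tens_distribs algebra_simps)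
  then show ?thesis
    using I by (simp add: cideal_add[OF cideal_tker] cideal_diff[OF cideal_tker] tens_tker_left tens_tker_right)
qed

text \<open>The commutator splits over the two legs: where x meets y it yields the weight r, where
  it meets e or e' it vanishes modulo I.\<close>

lemma coproduct_weight:
  fixes x y e e' :: "'m::monoid_add alg"
  assumes I: "commutator x y - scal r * y \<in> I" "commutator x e \<in> I" "commutator x e' \<in> I"
  shows "commutator (1 \<boxtimes> x + x \<boxtimes> 1) (y \<boxtimes> e' + e \<boxtimes> y) - scal r * (y \<boxtimes> e' + e \<boxtimes> y) \<in> tker I I" (is "?l \<in> _")
proof -
  have "?l = (commutator x y - scal r * y) \<boxtimes> e' + y \<boxtimes> commutator x e' + commutator x e \<boxtimes> y
      + e \<boxtimes> (commutator x y - scal r * y)"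
    by (simp add: commutator_def tens_distribs algebra_simps)
  then show ?thesis
    using I by (simp add: cideal_add[OF cideal_tker] tens_tker_left tens_tker_right)
qed

lemma coproduct_scaling:
  fixes y e e' g :: "'m::monoid_add alg"
  assumes I: "g * y - scal t * y * g \<in> I" and comm: "g * e = e * g" "g * e' = e' * g"
  shows "(g \<boxtimes> g) * (y \<boxtimes> e' + e \<boxtimes> y) - scal t * (y \<boxtimes> e' + e \<boxtimes> y) * (g \<boxtimes> g) \<in> tker I I" (is "?l \<in> _")
proof -
  have "?l = (g * y - scal t * y * g) \<boxtimes> (g * e') + (g * e) \<boxtimes> (g * y - scal t * y * g)"
    by (simp add: comm tens_distribs algebra_simps)
  then show ?thesis
    using I by (simp add: cideal_add[OF cideal_tker] tens_tker_left tens_tker_right)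
qed

lemma coproduct_commuting:
  fixes x g :: "'m::monoid_add alg"
  assumes I: "commutator x g \<in> I"
  shows "commutator (1 \<boxtimes> x + x \<boxtimes> 1) (g \<boxtimes> g) \<in> tker I I" (is "?l \<in> _")
proof -
  have "?l = g \<boxtimes> commutator x g + commutator x g \<boxtimes> g"
    by (simp add: commutator_def tens_distribs algebra_simps)
  then show ?thesis
    using I by (simp add: cideal_add[OF cideal_tker] tens_tker_left tens_tker_right)
qed

subsection \<open>The function algebra\<close>

lemma mhom_F_cop: "mhom F_cop"
  unfolding F_cop_def by (rule mhom_xlift) (simp_all add: tens_mult expx_mult)

lemma mhom_F_counit: "mhom F_counit"
  unfolding F_counit_def by (rule mhom_xlift) simp_all

lemmas ahom_F_cop = ahom_lin[OF mhom_F_cop]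

lemma lin_F_cop:
  "lin F_cop (genx 1) = 1 \<boxtimes> genx 1 + genx 1 \<boxtimes> 1"
  "j \<in> {2, 3} \<Longrightarrow> lin F_cop (genx j) = genx j \<boxtimes> expx (- 1) + expx 1 \<boxtimes> genx j"
  "lin F_cop (expx 1) = expx 1 \<boxtimes> expx 1" "lin F_cop (expx (- 1)) = expx (- 1) \<boxtimes> expx (- 1)"
  unfolding F_cop_def by auto

lemma counit_F_gen:
  "counit F_counit (genx i) = 0" "counit F_counit (expx k) = 1"
  using mhom_F_counit
  by (simp_all add: genx_def expx_def counit_simps) (simp_all add: F_counit_def)

lemma F_coassoc: "tens_id F_cop (lin F_cop f) = id_tens F_cop (lin F_cop f)"
proof (rule ahom_xword_eqI[OF ahom_comp[OF ahom_tens_id ahom_lin] ahom_comp[OF ahom_id_tens ahom_lin]])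
  note simps = lin_F_cop tens_conv_mult ahom_simps[OF ahom_tens_id[OF mhom_F_cop]]
    ahom_simps[OF ahom_id_tens[OF mhom_F_cop]] ahom_simps[OF ahom_inl] ahom_simps[OF ahom_inr]
    tens_id_inl tens_id_inr[OF mhom_F_cop] id_tens_inl[OF mhom_F_cop] id_tens_inr
    ahom_simps[OF ahom_assoc3] assoc3_inl_inl assoc3_inl_inr assoc3_inr
  fix i :: 3
  show "tens_id F_cop (lin F_cop (expx 1)) = id_tens F_cop (lin F_cop (expx 1))"
    "tens_id F_cop (lin F_cop (expx (- 1))) = id_tens F_cop (lin F_cop (expx (- 1)))"
    by (simp_all add: simps mult.assoc)
  show "tens_id F_cop (lin F_cop (genx i)) = id_tens F_cop (lin F_cop (genx i))"
    using exhaust_3[of i] by (auto simp: simps algebra_simps)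
qed (rule mhom_F_cop)+

lemma F_counit_left: "counit_left F_counit (lin F_cop f) = f"
  and F_counit_right: "counit_right F_counit (lin F_cop f) = f"
proof -
  have id: "ahom (\<lambda>f :: xword alg. f)"
    by (simp add: ahom_def)
  note simps = lin_F_cop tens_conv_mult ahom_simps[OF ahom_counit_left[OF mhom_F_counit]]
    ahom_simps[OF ahom_counit_right[OF mhom_F_counit]] ahom_simps[OF ahom_inl] ahom_simps[OF ahom_inr]
    counit_left_inl counit_left_inr[OF mhom_F_counit] counit_right_inr counit_right_inl[OF mhom_F_counit]
    counit_F_gen
  have "counit_left F_counit (lin F_cop (genx i)) = genx i \<and> counit_right F_counit (lin F_cop (genx i)) = genx i" for i
    using exhaust_3[of i] by (auto simp: simps)
  then have gen: "counit_left F_counit (lin F_cop (genx i)) = genx i" "counit_right F_counit (lin F_cop (genx i)) = genx i" for i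
    by blast+
  show "counit_left F_counit (lin F_cop f) = f"
    by (rule ahom_xword_eqI[OF ahom_comp[OF ahom_counit_left[OF mhom_F_counit] ahom_F_cop] id])
      (simp_all only: gen, simp_all add: simps)
  show "counit_right F_counit (lin F_cop f) = f"
    by (rule ahom_xword_eqI[OF ahom_comp[OF ahom_counit_right[OF mhom_F_counit] ahom_F_cop] id])
      (simp_all only: gen, simp_all add: simps)
qed

lemma cideal_F: "cideal (F_ideal A)"
  by (simp add: F_ideal_def cideal_closed_ideal)

text \<open>Relations with a plus sign are rewritten with a negative scalar, so that x_2 and x_3 are
  covered by the same weight lemmas.\<close>

lemma F_rels:
  "commutator (genx 1) (genx 2) - scal (2 * fps_X) * genx 2 \<in> F_ideal A"
  "commutator (genx 1) (genx 3) - scal (- (2 * fps_X)) * genx 3 \<in> F_ideal A"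
  "commutator (genx 2) (genx 3) - scal (2 * fps_X * (A oo fps_X\<^sup>2)) * sinh2X \<in> F_ideal A"
  "expx 1 * genx 2 - scal (fexp (2 * fps_X)) * genx 2 * expx 1 \<in> F_ideal A"
  "expx (- 1) * genx 2 - scal (fexp (- (2 * fps_X))) * genx 2 * expx (- 1) \<in> F_ideal A"
  "expx 1 * genx 3 - scal (fexp (- (2 * fps_X))) * genx 3 * expx 1 \<in> F_ideal A"
  "expx (- 1) * genx 3 - scal (fexp (2 * fps_X)) * genx 3 * expx (- 1) \<in> F_ideal A"
  "commutator (genx 1) (expx 1) \<in> F_ideal A" "commutator (genx 1) (expx (- 1)) \<in> F_ideal A"
  unfolding F_ideal_def by (rule in_closed_ideal; simp add: F_relations_def scal_uminus)+

text \<open>With \<open>e = expx 1\<close> and \<open>e' = expx (- 1)\<close>, the difference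
  \<open>e^2 \<otimes> e^2 - e'^2 \<otimes> e'^2\<close> telescopes through
  \<open>e^2 \<otimes> e'^2\<close>. This is the shape that \<open>coproduct_commutator\<close>
  produces for the other side of the relation.\<close>

lemma F_cop_sinh:
  "lin F_cop sinh2X = sinh2X \<boxtimes> (expx (- 1) * expx (- 1)) + (expx 1 * expx 1) \<boxtimes> sinh2X"
  unfolding sinh2X_def
  by (simp add: ahom_simps[OF ahom_F_cop] lin_F_cop tens_distribs algebra_simps)

lemma F_cop_rel:
  assumes "s \<in> F_relations A"
  shows "lin F_cop s \<in> tker (F_ideal A) (F_ideal A)"
proof -
  let ?I = "F_ideal A"
  note c = ahom_simps[OF ahom_F_cop] lin_F_cop
  have comm: "expx k * expx l = expx l * expx k" for k l
    by (simp add: expx_mult add.commute)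
  have cc: "lin F_cop (commutator f g) = commutator (lin F_cop f) (lin F_cop g)" for f g
    by (simp add: commutator_def c)
  let ?k = "scal (2 * fps_X * (A oo fps_X\<^sup>2))"
  have 3: "lin F_cop (commutator (genx 2) (genx 3) - ?k * sinh2X) \<in> tker ?I ?I"
  proof -
    let ?r = "commutator (genx 2) (genx 3) - ?k * sinh2X"
    \<comment> \<open>The first bracket is controlled by \<open>coproduct_commutator\<close>; what
      remains is the relation itself, placed in one leg at a time.\<close>
    have "lin F_cop ?r = (commutator (lin F_cop (genx 2)) (lin F_cop (genx 3)) -
        (commutator (genx 2) (genx 3) \<boxtimes> (expx (- 1) * expx (- 1)) + (expx 1 * expx 1) \<boxtimes> commutator (genx 2) (genx 3)))
        + (?r \<boxtimes> (expx (- 1) * expx (- 1)) + (expx 1 * expx 1) \<boxtimes> ?r)"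
      by (simp only: c(2,3,7) cc F_cop_sinh tens_distribs) (simp add: algebra_simps)
    moreover have "\<dots> \<in> tker ?I ?I"
      using coproduct_commutator[OF F_rels(4,7,6,5)] F_rels(3)[of A]
      by (intro cideal_add[OF cideal_tker]) (simp_all add: c tens_tker_left tens_tker_right)
    ultimately show ?thesis by simp
  qed
  note rels = coproduct_weight[OF F_rels(1,8,9)] coproduct_weight[OF F_rels(2,8,9)]
    coproduct_scaling[OF F_rels(4) comm comm] coproduct_scaling[OF F_rels(5) comm comm]
    coproduct_scaling[OF F_rels(6) comm comm] coproduct_scaling[OF F_rels(7) comm comm]
    coproduct_commuting[OF F_rels(8)] coproduct_commuting[OF F_rels(9)]
  have *: "lin F_cop (genx 2) = genx 2 \<boxtimes> expx (- 1) + expx 1 \<boxtimes> genx 2"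
    "lin F_cop (genx 3) = genx 3 \<boxtimes> expx (- 1) + expx 1 \<boxtimes> genx 3"
    by (simp_all add: c)
  show ?thesis
    using assms unfolding F_relations_def
    by (elim insertE emptyE) (use rels 3 in \<open>simp_all only: c(1,2,3,6,7) cc lin_F_cop(1,3,4) * scal_uminus
      mult_minus_left diff_minus_eq_add\<close>)
qed

lemma counit_F_rel: "s \<in> F_relations A \<Longrightarrow> counit F_counit s = 0"
  unfolding F_relations_def
  by (elim insertE emptyE)
    (simp_all add: counit_simps[OF mhom_F_counit] counit_F_gen commutator_def sinh2X_def)

lemma F_bialgebra: "bialgebra (F_ideal A) F_cop F_counit"
  and F_cop_descends: "descends (F_ideal A) (tker (F_ideal A) (F_ideal A)) (lin F_cop)"
  by (rule bialgebraI[OF mhom_F_cop mhom_F_counit F_cop_rel counit_F_rel F_ideal_def F_coassoc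
        F_counit_left F_counit_right]; assumption)+

subsection \<open>The enveloping algebra\<close>

lemma cideal_U: "cideal (U_ideal h)"
  by (simp add: U_ideal_def cideal_closed_ideal)

lemma U_rels:
  "commutator (genz 1) (genz 2) - scal 2 * genz 2 \<in> U_ideal h"
  "commutator (genz 1) (genz 3) - scal (- 2) * genz 3 \<in> U_ideal h"
  "commutator (genz 2) (genz 3) - sinh_ratio h \<in> U_ideal h"
  unfolding U_ideal_def by (rule in_closed_ideal; simp add: scal_uminus)+

text \<open>The relation says \<open>z_1 y = y (z_1 + r)\<close> modulo the ideal; after
  exponentiation the central summand \<open>c r\<close> splits off as the factor
  \<open>fexp (c * r)\<close>.\<close>

lemma expz_intertwine:
  assumes y: "commutator (genz 1) y - scal r * y \<in> U_ideal h" and c0: "fps_nth c 0 = 0"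
  shows "expz c * y - scal (fexp (c * r)) * y * expz c \<in> U_ideal h"
proof -
  let ?a = "scal c * genz 1" and ?b = "scal (c * r) + scal c * genz 1"
  have "?a * y - y * ?b = scal c * (commutator (genz 1) y - scal r * y)"
    by (simp add: commutator_def algebra_simps scal_left_commute[of y] scal_mult)
      (simp add: scal_commute[of _ y, symmetric] mult.assoc[symmetric])
  then have "?a * y - y * ?b \<in> U_ideal h"
    using y by (simp add: cideal_lmult[OF cideal_U])
  then have "nexp ?a * y - y * nexp ?b \<in> U_ideal h"
    using c0 by (intro nexp_intertwine[OF cideal_U]) simp_all
  moreover have "nexp ?b = scal (fexp (c * r)) * expz c"
    using c0 by (subst nexp_add) (simp_all add: nexp_scal expz_conv_nexp scal_commute)
  ultimately show ?thesis
    using c0 by (simp add: expz_conv_nexp scal_left_commute[of y] mult.assoc)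
qed

lemma expz_scaling:
  assumes "fps_nth c 0 = 0"
  shows "expz c * genz 2 - scal (fexp (2 * c)) * genz 2 * expz c \<in> U_ideal h"
    "expz c * genz 3 - scal (fexp (- (2 * c))) * genz 3 * expz c \<in> U_ideal h"
  using expz_intertwine[OF U_rels(1) assms] expz_intertwine[OF U_rels(2) assms]
  by (simp_all add: mult.commute)

lemma expz_commute: "fps_nth c 0 = 0 \<Longrightarrow> commutator (genz 1) (expz c) = 0"
proof -
  assume c0: "fps_nth c 0 = 0"
  have "cideal {0 :: zword alg}"
    by (rule cideal_singleton_0)
  then have "nexp (scal c * genz 1) * genz 1 - genz 1 * nexp (scal c * genz 1) \<in> {0}"
    by (rule nexp_intertwine) (simp_all add: c0 scal_left_commute[of "genz 1"] mult.assoc)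
  then show ?thesis
    by (simp add: commutator_def expz_conv_nexp c0)
qed

lemma expz_0 [simp]: "expz 0 = 1"
  by (simp add: expz_conv_nexp)

lemma expz_inverse: "fps_nth c 0 = 0 \<Longrightarrow> expz c * expz (- c) = 1" "fps_nth c 0 = 0 \<Longrightarrow> expz (- c) * expz c = 1"
  by (simp_all flip: expz_add)

lemma mhom_U_cop: "mhom (U_cop h)"
  unfolding U_cop_def by (rule mhom_zlift)

lemma mhom_U_counit: "mhom U_counit"
  unfolding U_counit_def by (rule mhom_zlift)

lemmas ahom_U_cop = ahom_lin[OF mhom_U_cop]

lemma lin_U_cop:
  "lin (U_cop h) (genz 1) = 1 \<boxtimes> genz 1 + genz 1 \<boxtimes> 1"
  "j \<in> {2, 3} \<Longrightarrow> lin (U_cop h) (genz j) =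
     genz j \<boxtimes> expz (- (fps_const (1 / 2) * h)) + expz (fps_const (1 / 2) * h) \<boxtimes> genz j"
  unfolding U_cop_def by auto

text \<open>z_1 is primitive and its two legs commute, so its exponential is group-like.\<close>

lemma lin_U_cop_expz:
  assumes c0: "fps_nth c 0 = 0"
  shows "lin (U_cop h) (expz c) = expz c \<boxtimes> expz c"
proof -
  let ?a = "scal c * genz 1"
  have "lin (U_cop h) (expz c) = nexp (inl ?a + inr ?a)"
    by (simp add: add.commute expz_conv_nexp c0 ahom_nexp[OF ahom_U_cop] ahom_simps[OF ahom_U_cop] lin_U_cop
        ahom_simps[OF ahom_inl] ahom_simps[OF ahom_inr] distrib_left flip: inl_conv inr_conv)
  also have "\<dots> = nexp (inl ?a) * nexp (inr ?a)"
    by (rule nexp_add) (simp_all add: inl_inr_commute ahom_nth_0[OF ahom_inl] ahom_nth_0[OF ahom_inr] c0)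
  also have "\<dots> = expz c \<boxtimes> expz c"
    by (simp add: expz_conv_nexp c0 tens_conv_mult inl_inr_commute
        ahom_nexp[OF ahom_inl] ahom_nexp[OF ahom_inr])
  finally show ?thesis .
qed

lemma counit_U_genz: "counit U_counit (genz i) = 0"
  using mhom_U_counit by (simp add: genz_def counit_simps) (simp add: U_counit_def)

lemma counit_U_expz:
  assumes "fps_nth c 0 = 0"
  shows "counit U_counit (expz c) = 1"
proof -
  \<comment> \<open>\<open>nat alg\<close> is just some algebra into which the scalars embed, so
    that \<open>ahom_nexp\<close> applies to the counit.\<close>
  have "scal (counit U_counit (expz c)) = (1 :: nat alg)"
    using assms ahom_nexp[OF ahom_scal_counit[OF mhom_U_counit, where 'k = nat], of "scal c * genz 1"]
    by (simp add: expz_conv_nexp counit_simps[OF mhom_U_counit] counit_U_genz)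
  then show ?thesis
    by (metis scal_1 scal_inj)
qed

lemma half_nth_0: "fps_nth h 0 = 0 \<Longrightarrow> fps_nth (fps_const (1 / 2) * h) 0 = (0 :: real)"
  by simp

lemma U_coassoc:
  assumes h0: "fps_nth h 0 = 0"
  shows "tens_id (U_cop h) (lin (U_cop h) f) = id_tens (U_cop h) (lin (U_cop h) f)"
proof (rule ahom_zword_eqI[OF ahom_comp[OF ahom_tens_id ahom_lin] ahom_comp[OF ahom_id_tens ahom_lin]])
  note simps = lin_U_cop lin_U_cop_expz tens_conv_mult ahom_simps[OF ahom_tens_id[OF mhom_U_cop]]
    ahom_simps[OF ahom_id_tens[OF mhom_U_cop]] ahom_simps[OF ahom_inl] ahom_simps[OF ahom_inr]
    tens_id_inl tens_id_inr[OF mhom_U_cop] id_tens_inl[OF mhom_U_cop] id_tens_inr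
    ahom_simps[OF ahom_assoc3] assoc3_inl_inl assoc3_inl_inr assoc3_inr
  show "tens_id (U_cop h) (lin (U_cop h) (genz i)) = id_tens (U_cop h) (lin (U_cop h) (genz i))" for i
    using exhaust_3[of i] h0 by (auto simp: simps algebra_simps)
qed (rule mhom_U_cop)+

lemma U_counit_left: "fps_nth h 0 = 0 \<Longrightarrow> counit_left U_counit (lin (U_cop h) f) = f"
  and U_counit_right: "fps_nth h 0 = 0 \<Longrightarrow> counit_right U_counit (lin (U_cop h) f) = f"
proof -
  assume h0: "fps_nth h 0 = 0"
  have id: "ahom (\<lambda>f :: zword alg. f)"
    by (simp add: ahom_def)
  note simps = lin_U_cop tens_conv_mult ahom_simps[OF ahom_counit_left[OF mhom_U_counit]]
    ahom_simps[OF ahom_counit_right[OF mhom_U_counit]] ahom_simps[OF ahom_inl] ahom_simps[OF ahom_inr]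
    counit_left_inl counit_left_inr[OF mhom_U_counit] counit_right_inr counit_right_inl[OF mhom_U_counit]
    counit_U_genz counit_U_expz
  have "counit_left U_counit (lin (U_cop h) (genz i)) = genz i \<and> counit_right U_counit (lin (U_cop h) (genz i)) = genz i" for i
    using exhaust_3[of i] h0 by (auto simp: simps)
  then have gen: "counit_left U_counit (lin (U_cop h) (genz i)) = genz i" "counit_right U_counit (lin (U_cop h) (genz i)) = genz i" for i
    by blast+
  show "counit_left U_counit (lin (U_cop h) f) = f"
    by (rule ahom_zword_eqI[OF ahom_comp[OF ahom_counit_left[OF mhom_U_counit] ahom_U_cop] id])
      (simp_all only: gen)
  show "counit_right U_counit (lin (U_cop h) f) = f"
    by (rule ahom_zword_eqI[OF ahom_comp[OF ahom_counit_right[OF mhom_U_counit] ahom_U_cop] id])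
      (simp_all only: gen)
qed

context
  fixes h :: "real fps"
  assumes h: "fps_nth h 0 = 0" "fps_nth h 1 \<noteq> 0"
begin

lemma half_add: "fps_const (1 / 2) * h + fps_const (1 / 2) * h = h"
  by (rule fps_ext) simp

text \<open>After multiplication by sinh(h) the claim concerns exponentials only, and there it
  telescopes through \<open>(e * e) \<otimes> (e' * e')\<close>.\<close>

lemma U_cop_sinh_ratio:
  fixes e e' :: "zword alg"
  defines "e \<equiv> expz (fps_const (1 / 2) * h)" and "e' \<equiv> expz (- (fps_const (1 / 2) * h))"
  shows "lin (U_cop h) (sinh_ratio h) = sinh_ratio h \<boxtimes> (e' * e') + (e * e) \<boxtimes> sinh_ratio h"
proof (rule scal_cancel[OF fsinh_nonzero(3)[OF h]])
  let ?s = "scal (fsinh h)"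
  have ee: "e * e = expz h" "e' * e' = expz (- h)"
    using h(1) expz_add[of "fps_const (1 / 2) * h" "fps_const (1 / 2) * h"]
      expz_add[of "- (fps_const (1 / 2) * h)" "- (fps_const (1 / 2) * h)"]
    by (simp_all only: e_def e'_def half_nth_0 fps_neg_nth minus_zero half_add flip: minus_add_distrib)
  have "?s * lin (U_cop h) (sinh_ratio h) = lin (U_cop h) (?s * sinh_ratio h)"
    by (simp only: ahom_simps[OF ahom_U_cop])
  also have "\<dots> = scal (fps_const (1 / 2)) * (expz h \<boxtimes> expz h - expz (- h) \<boxtimes> expz (- h))"
    using h(1) by (simp only: sinh_ratio_mult[OF h] ahom_simps[OF ahom_U_cop]) (simp add: lin_U_cop_expz)
  also have "\<dots> = (?s * sinh_ratio h) \<boxtimes> (e' * e') + (e * e) \<boxtimes> (?s * sinh_ratio h)"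
    by (simp only: sinh_ratio_mult[OF h] ee) (simp add: tens_distribs algebra_simps)
  also have "\<dots> = ?s * (sinh_ratio h \<boxtimes> (e' * e') + (e * e) \<boxtimes> sinh_ratio h)"
    by (simp only: tens_distribs distrib_left)
  finally show "?s * lin (U_cop h) (sinh_ratio h) = \<dots>" .
qed

lemma U_bialgebra: "bialgebra (U_ideal h) (U_cop h) U_counit"
  and U_cop_descends: "descends (U_ideal h) (tker (U_ideal h) (U_ideal h)) (lin (U_cop h))"
proof -
  let ?I = "U_ideal h" and ?c = "fps_const (1 / 2) * h"
  let ?e = "expz ?c" and ?e' = "expz (- ?c)"
  define S where "S = {commutator (genz 1) (genz 2) - 2 * genz 2, commutator (genz 1) (genz 3) + 2 * genz 3,
     commutator (genz 2) (genz 3) - sinh_ratio h}"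
  have c0: "fps_nth ?c 0 = 0" "fps_nth (- ?c) 0 = 0"
    using h by simp_all
  note c = ahom_simps[OF ahom_U_cop[of h]]
  have cop: "lin (U_cop h) (genz 1) = 1 \<boxtimes> genz 1 + genz 1 \<boxtimes> 1"
    "lin (U_cop h) (genz 2) = genz 2 \<boxtimes> ?e' + ?e \<boxtimes> genz 2"
    "lin (U_cop h) (genz 3) = genz 3 \<boxtimes> ?e' + ?e \<boxtimes> genz 3"
    by (simp_all add: lin_U_cop)
  have cc: "lin (U_cop h) (commutator f g) = commutator (lin (U_cop h) f) (lin (U_cop h) g)" for f g
    by (simp add: commutator_def c)
  have comm: "commutator (genz 1) ?e \<in> ?I" "commutator (genz 1) ?e' \<in> ?I"
    using c0 by (simp_all add: expz_commute cideal_0[OF cideal_U])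
  have q: "?e * genz 2 - scal (fexp (2 * ?c)) * genz 2 * ?e \<in> ?I"
    "?e' * genz 3 - scal (fexp (2 * ?c)) * genz 3 * ?e' \<in> ?I"
    "?e * genz 3 - scal (fexp (- (2 * ?c))) * genz 3 * ?e \<in> ?I"
    "?e' * genz 2 - scal (fexp (- (2 * ?c))) * genz 2 * ?e' \<in> ?I"
    using expz_scaling[OF c0(1), of h] expz_scaling[OF c0(2), of h] by simp_all
  let ?r = "commutator (genz 2) (genz 3) - sinh_ratio h"
  have 3: "lin (U_cop h) ?r \<in> tker ?I ?I"
  proof -
    have "lin (U_cop h) ?r = (commutator (lin (U_cop h) (genz 2)) (lin (U_cop h) (genz 3)) -
        (commutator (genz 2) (genz 3) \<boxtimes> (?e' * ?e') + (?e * ?e) \<boxtimes> commutator (genz 2) (genz 3)))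
        + (?r \<boxtimes> (?e' * ?e') + (?e * ?e) \<boxtimes> ?r)"
      by (simp only: c(7) cc U_cop_sinh_ratio tens_diff_left tens_diff_right) (simp add: algebra_simps)
    moreover have "\<dots> \<in> tker ?I ?I"
      unfolding cop using coproduct_commutator[OF q] U_rels(3)[of h]
      by (intro cideal_add[OF cideal_tker] tens_tker_left tens_tker_right)
    ultimately show ?thesis by simp
  qed
  have cop_rel: "lin (U_cop h) s \<in> tker ?I ?I" if "s \<in> S" for s
  proof -
    have two: "2 * f = scal 2 * f" for f :: "'x::monoid_add alg"
      by simp
    from that show ?thesis
      using coproduct_weight[OF U_rels(1) comm] coproduct_weight[OF U_rels(2) comm] 3 unfolding S_def
      by (elim insertE emptyE) (simp_all only: two c(1,2,3,7) cc cop scal_uminus mult_minus_left diff_minus_eq_add)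
  qed
  have "fsinh h * counit U_counit (sinh_ratio h) = counit U_counit (scal (fsinh h) * sinh_ratio h)"
    by (simp add: counit_simps[OF mhom_U_counit])
  also have "\<dots> = 0"
    using h by (simp add: sinh_ratio_mult counit_simps[OF mhom_U_counit] counit_U_expz)
  finally have "counit U_counit (sinh_ratio h) = 0"
    using fsinh_nonzero[OF h] by simp
  then have counit_rel: "counit U_counit s = 0" if "s \<in> S" for s
    using that by (auto simp: S_def commutator_def counit_simps[OF mhom_U_counit] counit_U_genz)
  have I: "?I = closed_ideal S"
    by (simp add: U_ideal_def S_def)
  show "bialgebra ?I (U_cop h) U_counit" "descends ?I (tker ?I ?I) (lin (U_cop h))"
    by (rule bialgebraI[OF mhom_U_cop mhom_U_counit cop_rel counit_rel I U_coassoc[OF h(1)]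
          U_counit_left[OF h(1)] U_counit_right[OF h(1)]]; assumption)+
qed

end

subsection \<open>The change of coordinates\<close>

lemma h_par_nth: "fps_nth h_par 0 = 0" "fps_nth h_par 1 \<noteq> 0"
  by (simp_all add: h_par_def)

lemma half_h_par: "fps_const (1 / 2) * h_par = fps_X"
  by (simp add: h_par_def numeral_fps_const flip: mult.assoc)

lemma coord_change_conv: "coord_change A = xlift (expz fps_X) (expz (- fps_X))
     (\<lambda>i. if i = 1 then scal fps_X * genz 1 else scal (rescaling A) * genz i)"
  unfolding coord_change_def half_h_par ..

lemma mhom_coord_change: "mhom (coord_change A)"
  unfolding coord_change_conv by (rule mhom_xlift) (simp_all add: expz_inverse)

lemmas ahom_coord_change = ahom_lin[OF mhom_coord_change]

lemma lin_coord_change: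
  "lin (coord_change A) (expx 1) = expz fps_X" "lin (coord_change A) (expx (- 1)) = expz (- fps_X)"
  "lin (coord_change A) (genx 1) = scal fps_X * genz 1"
  "j \<in> {2, 3} \<Longrightarrow> lin (coord_change A) (genx j) = scal (rescaling A) * genz j"
  unfolding coord_change_conv by auto

lemma coord_change_sinh: "lin (coord_change A) sinh2X = scal (fsinh h_par) * sinh_ratio h_par"
proof -
  have hX: "h_par = fps_X + fps_X"
    by (simp add: h_par_def)
  have X0: "fps_nth fps_X 0 = (0 :: real)" "fps_nth (- fps_X) 0 = (0 :: real)"
    by simp_all
  have "expz fps_X * expz fps_X = expz h_par" "expz (- fps_X) * expz (- fps_X) = expz (- h_par)"
    unfolding hX minus_add_distrib expz_add[OF X0(1) X0(1)] expz_add[OF X0(2) X0(2)] by (rule refl)+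
  then show ?thesis
    unfolding sinh2X_def
    by (simp only: ahom_simps[OF ahom_coord_change] lin_coord_change sinh_ratio_mult[OF h_par_nth])
qed

lemma commutator_scal:
  "commutator (scal r * f) g = scal r * commutator f g" "commutator f (scal r * g) = scal r * commutator f g"
  for f g :: "'m::monoid_add alg"
  by (simp_all add: commutator_def right_diff_distrib mult.assoc scal_left_commute[of f] scal_left_commute[of g])

lemma commutator_ahom: "ahom T \<Longrightarrow> T (commutator f g) = commutator (T f) (T g)"
  by (simp add: commutator_def ahom_simps)

lemma lin_coord_change_genx:
  "lin (coord_change A) (genx 2) = scal (rescaling A) * genz 2"
  "lin (coord_change A) (genx 3) = scal (rescaling A) * genz 3"
  by (simp_all add: lin_coord_change)

text \<open>The exact factors matter. Read forwards, they show that the relations are respected;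
  once \<epsilon> is inverted they can be divided out, so that conversely the images generate the
  relations of U_h.\<close>

lemma coord_change_rels:
  "lin (coord_change A) (commutator (genx 1) (genx 2) - scal (2 * fps_X) * genx 2) =
    scal (fps_X * rescaling A) * (commutator (genz 1) (genz 2) - 2 * genz 2)"
  "lin (coord_change A) (commutator (genx 1) (genx 3) + scal (2 * fps_X) * genx 3) =
    scal (fps_X * rescaling A) * (commutator (genz 1) (genz 3) + 2 * genz 3)"
  "(rescaling A)\<^sup>2 = 2 * fps_X * (A oo fps_X\<^sup>2) * fsinh h_par \<Longrightarrow>
    lin (coord_change A) (commutator (genx 2) (genx 3) - scal (2 * fps_X * (A oo fps_X\<^sup>2)) * sinh2X) =
    scal (rescaling A * rescaling A) * (commutator (genz 2) (genz 3) - sinh_ratio h_par)"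
proof -
  note simps = ahom_simps[OF ahom_coord_change[of A]] commutator_ahom[OF ahom_coord_change[of A]]
    lin_coord_change(1-3) lin_coord_change_genx commutator_scal right_diff_distrib distrib_left scal_scal_mult
  have two: "2 * f = scal 2 * f" for f :: "zword alg"
    by simp
  show "lin (coord_change A) (commutator (genx 1) (genx 2) - scal (2 * fps_X) * genx 2) =
    scal (fps_X * rescaling A) * (commutator (genz 1) (genz 2) - 2 * genz 2)"
    "lin (coord_change A) (commutator (genx 1) (genx 3) + scal (2 * fps_X) * genx 3) =
    scal (fps_X * rescaling A) * (commutator (genz 1) (genz 3) + 2 * genz 3)"
    unfolding two by (simp_all only: simps mult_ac)
  assume "(rescaling A)\<^sup>2 = 2 * fps_X * (A oo fps_X\<^sup>2) * fsinh h_par"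
  then have XA: "2 * fps_X * (A oo fps_X\<^sup>2) * fsinh h_par = rescaling A * rescaling A"
    by (simp only: power2_eq_square)
  show "lin (coord_change A) (commutator (genx 2) (genx 3) - scal (2 * fps_X * (A oo fps_X\<^sup>2)) * sinh2X) =
    scal (rescaling A * rescaling A) * (commutator (genz 2) (genz 3) - sinh_ratio h_par)"
    by (simp only: simps coord_change_sinh XA)
qed

lemma coord_change_F_ideal:
  assumes c2: "(rescaling A)\<^sup>2 = 2 * fps_X * (A oo fps_X\<^sup>2) * fsinh h_par" and f: "f \<in> F_ideal A"
  shows "lin (coord_change A) f \<in> U_ideal h_par"
proof (rule closed_ideal_image[OF ahom_coord_change cideal_U _ f[unfolded F_ideal_def]])
  let ?J = "U_ideal h_par" and ?T = "lin (coord_change A)"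
  note simps = ahom_simps[OF ahom_coord_change[of A]] commutator_ahom[OF ahom_coord_change[of A]]
    lin_coord_change(1-3) lin_coord_change_genx commutator_scal
  note lmult = cideal_lmult[OF cideal_U, of _ h_par]
  have q: "?T (expx k * genx j - scal t * genx j * expx k) \<in> ?J"
    if "?T (expx k) = expz d" "?T (genx j) = scal (rescaling A) * genz j"
      "expz d * genz j - scal t * genz j * expz d \<in> ?J" for k j t d
  proof -
    have "?T (expx k * genx j - scal t * genx j * expx k) =
        scal (rescaling A) * (expz d * genz j - scal t * genz j * expz d)"
      by (simp only: simps that(1,2) right_diff_distrib mult.assoc scal_left_commute[of "expz _"]
          scal_scal_mult mult.commute)
    then show ?thesis
      using that(3) by (simp add: lmult)
  qed
  note e = expz_scaling[where c = fps_X and h = h_par] expz_scaling[where c = "- fps_X" and h = h_par]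
  have "commutator (scal fps_X * genz 1) (expz d) \<in> ?J" if "fps_nth d 0 = 0" for d
    using that by (simp only: commutator_scal) (simp add: expz_commute cideal_0[OF cideal_U])
  then have comm: "?T (commutator (genx 1) (expx 1)) \<in> ?J" "?T (commutator (genx 1) (expx (- 1))) \<in> ?J"
    by (simp_all only: simps) simp_all
  have "?T (commutator (genx 1) (genx 2) - scal (2 * fps_X) * genx 2) \<in> ?J"
    "?T (commutator (genx 1) (genx 3) + scal (2 * fps_X) * genx 3) \<in> ?J"
    "?T (commutator (genx 2) (genx 3) - scal (2 * fps_X * (A oo fps_X\<^sup>2)) * sinh2X) \<in> ?J"
    unfolding coord_change_rels(1,2) coord_change_rels(3)[OF c2]
    using U_rels[where h = h_par] by (simp_all add: lmult scal_uminus)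
  moreover note comm
  moreover have "?T (expx 1 * genx 2 - scal (fexp (2 * fps_X)) * genx 2 * expx 1) \<in> ?J"
    "?T (expx (- 1) * genx 2 - scal (fexp (- (2 * fps_X))) * genx 2 * expx (- 1)) \<in> ?J"
    "?T (expx 1 * genx 3 - scal (fexp (- (2 * fps_X))) * genx 3 * expx 1) \<in> ?J"
    "?T (expx (- 1) * genx 3 - scal (fexp (2 * fps_X)) * genx 3 * expx (- 1)) \<in> ?J"
    using e by (auto intro!: q simp: lin_coord_change)
  ultimately show "?T s \<in> ?J" if "s \<in> F_relations A" for s
    using that unfolding F_relations_def by (elim insertE emptyE) (simp_all only:)
qed

lemma coord_change_bialgebra_hom:
  assumes c2: "(rescaling A)\<^sup>2 = 2 * fps_X * (A oo fps_X\<^sup>2) * fsinh h_par"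
  shows "bialgebra_hom (F_ideal A) F_cop F_counit (U_ideal h_par) (U_cop h_par) U_counit (coord_change A)"
proof (rule bialgebra_homI[OF F_cop_descends U_cop_descends[OF h_par_nth] cideal_F cideal_U mhom_coord_change
      coord_change_F_ideal[OF c2]])
  let ?T = "lin (coord_change A)" and ?T2 = "lin (\<lambda>(a, b). coord_change A a \<boxtimes> coord_change A b)"
  note T2 = tens_map_inl[OF mhom_coord_change[of A]] tens_map_inr[OF mhom_coord_change[of A]]
    ahom_simps[OF ahom_tens_map[OF mhom_coord_change[of A]]]
  note simps = ahom_simps[OF ahom_coord_change[of A]] ahom_simps[OF ahom_inl] ahom_simps[OF ahom_inr]
    ahom_simps[OF ahom_U_cop[of h_par]] lin_F_cop[unfolded tens_conv_mult]
    lin_U_cop[unfolded tens_conv_mult] lin_U_cop_expz[unfolded tens_conv_mult] lin_coord_change half_h_par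
  fix f
  show "?T2 (lin F_cop f) = lin (U_cop h_par) (?T f)"
  proof (rule ahom_xword_eqI[OF ahom_comp[OF ahom_tens_map[OF mhom_coord_change] ahom_F_cop]
        ahom_comp[OF ahom_U_cop ahom_coord_change]])
    show "?T2 (lin F_cop (expx 1)) = lin (U_cop h_par) (?T (expx 1))"
      "?T2 (lin F_cop (expx (- 1))) = lin (U_cop h_par) (?T (expx (- 1)))"
      by (simp_all add: simps T2)
    fix i :: 3
    consider "i = 1" | "i \<in> {2, 3}"
      using exhaust_3[of i] by auto
    then show "?T2 (lin F_cop (genx i)) = lin (U_cop h_par) (?T (genx i))"
      by cases (simp_all add: simps T2 distrib_left mult.assoc scal_left_commute[of "inl _"]
          del: insert_iff scal_X)
  qed
  have "(scal (counit U_counit (?T f)) :: nat alg) = scal (counit F_counit f)"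
  proof (rule ahom_xword_eqI[OF ahom_comp[OF ahom_scal_counit[OF mhom_U_counit] ahom_coord_change]
        ahom_scal_counit[OF mhom_F_counit]])
    note simps = lin_coord_change counit_simps[OF mhom_U_counit] counit_U_genz counit_U_expz counit_F_gen
    show "scal (counit U_counit (?T (expx 1))) = (scal (counit F_counit (expx 1)) :: nat alg)"
      "scal (counit U_counit (?T (expx (- 1)))) = (scal (counit F_counit (expx (- 1))) :: nat alg)"
      by (simp_all add: simps)
    fix i :: 3
    show "scal (counit U_counit (?T (genx i))) = (scal (counit F_counit (genx i)) :: nat alg)"
      using exhaust_3[of i] by (auto simp: simps simp del: scal_X)
  qed
  then show "counit U_counit (?T f) = counit F_counit f"
    by (simp only: scal_inj)
qed

section \<open>Spanning sets modulo a closed ideal\<close>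

text \<open>The coefficient family v is itself a formal series over the index type, so infinite
  combinations are allowed as long as each order in \<epsilon> of v involves finitely many
  indices.\<close>

definition span_mod :: "'m::monoid_add alg set \<Rightarrow> ('b::monoid_add \<Rightarrow> 'm alg) \<Rightarrow> 'm alg set" where
  "span_mod I \<beta> = {f. \<exists>v. f - lin \<beta> v \<in> I}"

context
  fixes I :: "'m::monoid_add alg set" and \<beta> :: "'b::monoid_add \<Rightarrow> 'm alg"
  assumes I: "cideal I"
begin

lemma span_mod_ideal: "f \<in> I \<Longrightarrow> f \<in> span_mod I \<beta>"
  using slinear_0[OF slinear_lin[of \<beta>]] unfolding span_mod_def
  by (metis (mono_tags, lifting) diff_zero mem_Collect_eq)

lemma span_mod_base: "\<beta> b \<in> span_mod I \<beta>"
  unfolding span_mod_def using cideal_0[OF I] by (auto intro!: exI[of _ "mon b"])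

lemma span_mod_add:
  assumes "f \<in> span_mod I \<beta>" "g \<in> span_mod I \<beta>"
  shows "f + g \<in> span_mod I \<beta>"
proof -
  obtain v w where "f - lin \<beta> v \<in> I" "g - lin \<beta> w \<in> I"
    using assms by (auto simp: span_mod_def)
  then have "(f - lin \<beta> v) + (g - lin \<beta> w) \<in> I"
    by (rule cideal_add[OF I])
  then have "f + g - lin \<beta> (v + w) \<in> I"
    by (simp add: lin_add algebra_simps)
  then show ?thesis
    by (auto simp: span_mod_def)
qed

lemma span_mod_scal:
  assumes "f \<in> span_mod I \<beta>"
  shows "scal r * f \<in> span_mod I \<beta>"
proof -
  obtain v where "f - lin \<beta> v \<in> I"
    using assms by (auto simp: span_mod_def)
  then have "scal r * (f - lin \<beta> v) \<in> I"
    by (rule cideal_lmult[OF I])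
  then have "scal r * f - lin \<beta> (scal r * v) \<in> I"
    by (simp add: lin_scal_mult right_diff_distrib)
  then show ?thesis
    by (auto simp: span_mod_def)
qed

lemma span_mod_uminus: "f \<in> span_mod I \<beta> \<Longrightarrow> - f \<in> span_mod I \<beta>"
  using span_mod_scal[of f "- 1"] by (simp add: scal_uminus)

lemma span_mod_cong:
  assumes "f - g \<in> I" "g \<in> span_mod I \<beta>"
  shows "f \<in> span_mod I \<beta>"
  using span_mod_add[OF span_mod_ideal[OF assms(1)] assms(2)] by simp

text \<open>Coefficient families chosen for the single monomials are assembled by
  \<open>lin\<close>; the resulting error is linear in f and lies in I because I is closed.\<close>

lemma span_mod_slinear:
  assumes T: "slinear T"
    and supp: "\<And>n m. m \<in> Poly_Mapping.keys (fps_nth f n) \<Longrightarrow> T (mon m) \<in> span_mod I \<beta>"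
  shows "T f \<in> span_mod I \<beta>"
proof -
  have "\<forall>m. \<exists>v. T (mon m) \<in> span_mod I \<beta> \<longrightarrow> T (mon m) - lin \<beta> v \<in> I"
    by (auto simp: span_mod_def)
  then obtain w where w: "\<And>m. T (mon m) \<in> span_mod I \<beta> \<Longrightarrow> T (mon m) - lin \<beta> (w m) \<in> I"
    by metis
  have "slinear (\<lambda>f. T f - lin \<beta> (lin w f))"
    using T by (simp add: slinear_def lin_add lin_scal_mult algebra_simps)
  from slinear_in_cideal[OF this I, of f] have "T f - lin \<beta> (lin w f) \<in> I"
    using supp w by simp
  then show ?thesis
    by (auto simp: span_mod_def)
qed

lemma span_mod_lmult:
  assumes x: "\<And>b. x * \<beta> b \<in> span_mod I \<beta>" and f: "f \<in> span_mod I \<beta>"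
  shows "x * f \<in> span_mod I \<beta>"
proof -
  obtain v where v: "f - lin \<beta> v \<in> I"
    using f by (auto simp: span_mod_def)
  have "slinear (\<lambda>v. x * lin \<beta> v)"
    by (simp add: slinear_def lin_add lin_scal_mult distrib_left scal_left_commute[of x])
  then have "x * lin \<beta> v \<in> span_mod I \<beta>"
    by (rule span_mod_slinear) (simp add: x)
  moreover have "x * f - x * lin \<beta> v \<in> I"
    using cideal_lmult[OF I v, of x] by (simp add: right_diff_distrib)
  ultimately show ?thesis
    by (rule span_mod_cong[rotated])
qed

lemma span_mod_UNIV:
  assumes "\<And>m. mon m \<in> span_mod I \<beta>"
  shows "f \<in> span_mod I \<beta>"
proof -
  have "slinear (\<lambda>f :: 'm alg. f)"
    by (simp add: slinear_def)
  then show ?thesis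
    by (rule span_mod_slinear) (rule assms)
qed

text \<open>Modulo I, \<open>y x = x y - s\<close>. Moving y through \<open>x^a\<close> therefore
  costs only terms containing s, which stay in the span.\<close>

lemma span_mod_swap:
  assumes rel: "commutator x y - s \<in> I"
    and x: "\<And>f. f \<in> span_mod I \<beta> \<Longrightarrow> x * f \<in> span_mod I \<beta>"
    and s: "\<And>f. f \<in> span_mod I \<beta> \<Longrightarrow> s * f \<in> span_mod I \<beta>"
    and f: "f \<in> span_mod I \<beta>" "y * f \<in> span_mod I \<beta>"
  shows "y * (x ^ a * f) \<in> span_mod I \<beta>"
proof (induction a)
  case (Suc a)
  have pow: "x ^ n * f \<in> span_mod I \<beta>" for n
    by (induction n) (simp_all add: f(1) x mult.assoc)
  let ?g = "x * (y * (x ^ a * f)) + - (s * (x ^ a * f))"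
  have "y * (x ^ Suc a * f) - ?g = - ((commutator x y - s) * (x ^ a * f))"
    by (simp add: commutator_def algebra_simps)
  then have "y * (x ^ Suc a * f) - ?g \<in> I"
    using rel by (simp only: cideal_uminus[OF I] cideal_rmult[OF I])
  moreover have "?g \<in> span_mod I \<beta>"
    by (intro span_mod_add span_mod_uminus x s pow Suc)
  ultimately show ?case
    by (rule span_mod_cong)
qed (simp add: f)

end

text \<open>Serves two cases at once: a weight operator shifted by a constant at each y
  (\<open>g i = x + s + i r\<close>) and an element scaled at each y
  (\<open>g i = t^i e\<close>).\<close>

lemma cideal_twisted_power:
  assumes I: "cideal I" and g: "\<And>i. g i * y - y * g (Suc i) \<in> I"
  shows "g i * y ^ a - y ^ a * g (i + a) \<in> I"
proof (induction a arbitrary: i)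
  case 0
  show ?case by (simp add: cideal_0[OF I])
next
  case (Suc a)
  have "g i * y ^ Suc a - y ^ Suc a * g (i + Suc a) =
      (g i * y - y * g (Suc i)) * y ^ a + y * (g (Suc i) * y ^ a - y ^ a * g (Suc i + a))"
    by (simp add: algebra_simps)
  then show ?case
    using g Suc by (simp only: cideal_add[OF I] cideal_lmult[OF I] cideal_rmult[OF I])
qed

lemma cideal_weight_power:
  assumes I: "cideal I" and y: "commutator x y - scal r * y \<in> I"
  shows "(x + scal s) * y ^ a - y ^ a * (x + scal (s + of_nat a * r)) \<in> I"
proof -
  define g where "g i = x + scal (s + of_nat i * r)" for i
  have "g i * y - y * g (Suc i) = commutator x y - scal r * y" for i
    by (simp add: g_def commutator_def algebra_simps scal_add scal_commute[of _ y])
  then show ?thesis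
    using cideal_twisted_power[OF I, of g y 0 a] y by (simp add: g_def)
qed

lemma cideal_scaling_power:
  assumes I: "cideal I" and y: "e * y - scal t * y * e \<in> I"
  shows "e * y ^ a - y ^ a * (scal (t ^ a) * e) \<in> I"
proof -
  define g where "g i = scal (t ^ i) * e" for i
  have "g i * y - y * g (Suc i) = scal (t ^ i) * (e * y - scal t * y * e)" for i
    by (simp add: g_def right_diff_distrib mult.assoc scal_left_commute[of y] scal_scal_mult mult.commute)
  then show ?thesis
    using cideal_twisted_power[OF I, of g y 0 a] y by (simp add: g_def cideal_lmult[OF I])
qed

section \<open>Spanning monomials\<close>

text \<open>The part \<open>x_1^c e^(k x_1)\<close> stands on the right, so that after the
  substitution it meets the vacuum vector first and acts there by a scalar.\<close>

definition F_basis :: "nat \<times> nat \<times> nat \<times> int \<Rightarrow> xword alg" where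
  "F_basis = (\<lambda>(a, b, c, k). genx 2 ^ a * (genx 3 ^ b * (genx 1 ^ c * expx k)))"

definition U_basis :: "nat \<times> nat \<times> nat \<Rightarrow> zword alg" where
  "U_basis = (\<lambda>(a, b, c). genz 2 ^ a * (genz 3 ^ b * genz 1 ^ c))"

text \<open>The span contains all \<open>expx k\<close> and is stable under left multiplication by
  every generator, hence contains every word.\<close>

lemma F_spanning: "f \<in> span_mod (F_ideal A) F_basis"
proof (rule span_mod_UNIV[OF cideal_F])
  let ?I = "F_ideal A" and ?S = "span_mod (F_ideal A) F_basis"
  note I = cideal_F[of A] and R = F_rels[where A = A]
  note mem = cideal_add[OF I] cideal_lmult[OF I] cideal_rmult[OF I]
  have lmult: "x * f \<in> ?S" if "\<And>a b c k. x * F_basis (a, b, c, k) \<in> ?S" "f \<in> ?S" for x f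
    by (rule span_mod_lmult[OF I _ that(2)]) (use that(1) in \<open>auto simp: split_paired_all\<close>)
  have base: "F_basis b \<in> ?S" for b
    by (rule span_mod_base[OF I])
  have x2: "genx 2 * f \<in> ?S" if "f \<in> ?S" for f
  proof (rule lmult[OF _ that])
    fix a b c k
    have "genx 2 * F_basis (a, b, c, k) = F_basis (Suc a, b, c, k)"
      by (simp add: F_basis_def mult.assoc)
    then show "genx 2 * F_basis (a, b, c, k) \<in> ?S"
      by (simp only: base)
  qed
  have x1: "genx 1 * f \<in> ?S" if "f \<in> ?S" for f
  proof (rule lmult[OF _ that])
    fix a b c k
    \<comment> \<open>\<open>?r\<close> is the weight collected by x_1 in passing
      \<open>x_2^a\<close>, and \<open>?s\<close> the total after passing \<open>x_3^b\<close> as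
      well.\<close>
    let ?r = "of_nat a * (2 * fps_X)"
    let ?s = "?r + of_nat b * - (2 * fps_X)"
    let ?W = "genx 1 ^ c * expx k"
    have "genx 1 * F_basis (a, b, c, k) - (F_basis (a, b, Suc c, k) + scal ?s * F_basis (a, b, c, k)) =
        (genx 1 * genx 2 ^ a - genx 2 ^ a * (genx 1 + scal ?r)) * (genx 3 ^ b * ?W) +
        genx 2 ^ a * ((genx 1 + scal ?r) * genx 3 ^ b - genx 3 ^ b * (genx 1 + scal ?s)) * ?W"
      by (simp add: F_basis_def algebra_simps scal_left_commute[of "genx _ ^ _"])
    also have "\<dots> \<in> ?I"
      using cideal_weight_power[OF I R(1), of 0 a] cideal_weight_power[OF I R(2), of ?r b]
      by (intro mem) simp_all
    finally show "genx 1 * F_basis (a, b, c, k) \<in> ?S"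
      by (rule span_mod_cong[OF I]) (intro span_mod_add[OF I] span_mod_scal[OF I] base)
  qed
  have e: "expx l * f \<in> ?S"
    if rel: "expx l * genx 2 - scal t * genx 2 * expx l \<in> ?I" "expx l * genx 3 - scal u * genx 3 * expx l \<in> ?I"
      "commutator (genx 1) (expx l) \<in> ?I" and f: "f \<in> ?S" for l t u f
  proof (rule lmult[OF _ f])
    fix a b c k
    let ?e = "expx l"
    \<comment> \<open>Commutation with x_1 is recast as scaling with factor 1, so that one lemma
      serves all three powers.\<close>
    have "?e * genx 1 - scal 1 * genx 1 * ?e \<in> ?I"
      using cideal_uminus[OF I rel(3)] by (simp add: commutator_def)
    note pow = cideal_scaling_power[OF I rel(1), of a] cideal_scaling_power[OF I rel(2), of b]
      cideal_scaling_power[OF I this, of c]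
    have ek: "?e * expx k = expx (l + k)"
      by (rule expx_mult)
    have "?e * F_basis (a, b, c, k) - scal (t ^ a * u ^ b) * F_basis (a, b, c, l + k) =
        (?e * genx 2 ^ a - genx 2 ^ a * (scal (t ^ a) * ?e)) * (genx 3 ^ b * (genx 1 ^ c * expx k)) +
        scal (t ^ a) * genx 2 ^ a * ((?e * genx 3 ^ b - genx 3 ^ b * (scal (u ^ b) * ?e)) * (genx 1 ^ c * expx k)) +
        scal (t ^ a * u ^ b) * genx 2 ^ a * genx 3 ^ b * ((?e * genx 1 ^ c - genx 1 ^ c * (scal (1 ^ c) * ?e)) * expx k)"
      by (simp add: F_basis_def left_diff_distrib right_diff_distrib mult.assoc scal_left_commute[of "genx _ ^ _"]
          scal_scal_mult flip: ek)
    also have "\<dots> \<in> ?I"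
      using pow by (intro mem)
    finally show "?e * F_basis (a, b, c, k) \<in> ?S"
      by (rule span_mod_cong[OF I]) (intro span_mod_scal[OF I] base)
  qed
  have e1: "expx 1 * f \<in> ?S" and e2: "expx (- 1) * f \<in> ?S" if "f \<in> ?S" for f
    using e[OF R(4,6,8) that] e[OF R(5,7,9) that] by blast+
  have sinh: "scal r * sinh2X * f \<in> ?S" if "f \<in> ?S" for r f
  proof -
    have "scal r * sinh2X * f = scal (r * fps_const (1 / 2)) * (expx 1 * (expx 1 * f)) +
        - (scal (r * fps_const (1 / 2)) * (expx (- 1) * (expx (- 1) * f)))"
      by (simp add: sinh2X_def algebra_simps scal_mult)
    also have "\<dots> \<in> ?S"
      by (intro span_mod_add[OF I] span_mod_scal[OF I] span_mod_uminus[OF I] e1 e2 that)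
    finally show ?thesis .
  qed
  have x3: "genx 3 * f \<in> ?S" if "f \<in> ?S" for f
  proof (rule lmult[OF _ that])
    fix a b c k
    \<comment> \<open>x_3 does not merely scale in passing x_2, so it is moved through
      \<open>x_2^a\<close> one factor at a time; the commutator terms carry \<open>sinh2X\<close>,
      already known to preserve the span.\<close>
    have "genx 3 * (genx 2 ^ a * F_basis (0, b, c, k)) \<in> ?S"
    proof (rule span_mod_swap[OF I R(3)])
      have "genx 3 * F_basis (0, b, c, k) = F_basis (0, Suc b, c, k)"
        by (simp add: F_basis_def mult.assoc)
      then show "genx 3 * F_basis (0, b, c, k) \<in> ?S"
        by (simp only: base)
    qed (use x2 sinh base in auto)
    then show "genx 3 * F_basis (a, b, c, k) \<in> ?S"
      by (simp add: F_basis_def)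
  qed
  have gen: "genx i * f \<in> ?S" if "f \<in> ?S" for i f
    using exhaust_3[of i] x1 x2 x3 that by auto
  have ek: "expx k * f \<in> ?S" if "f \<in> ?S" for k f
  proof (induction k rule: int_induct[where k = 0])
    case base
    show ?case using that by simp
  next
    case (step1 i)
    have "expx (i + 1) = expx 1 * expx i"
      by (simp add: expx_mult add.commute)
    then show ?case
      using e1[OF step1(2)] by (simp add: mult.assoc)
  next
    case (step2 i)
    have "expx (i - 1) = expx (- 1) * expx i"
      by (simp add: expx_mult)
    then show ?case
      using e2[OF step2(2)] by (simp add: mult.assoc)
  qed
  fix m
  show "mon m \<in> ?S"
  proof (induction m)
    case (XE k)
    have "mon (XE k) = F_basis (0, 0, 0, k)"
      by (simp add: F_basis_def expx_def)
    then show ?case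
      by (simp only: base)
  next
    case (XC k i w)
    have "XE 0 + w = w"
      using add_0_left[of w] by (simp only: zero_xword_def)
    then have "mon (XC k i w) = expx k * (genx i * mon w)"
      by (simp add: expx_def genx_def mon_mult)
    then show ?case
      by (simp only: ek gen XC)
  qed
qed

lemma U_spanning: "f \<in> span_mod (U_ideal h) U_basis"
proof (rule span_mod_UNIV[OF cideal_U])
  let ?I = "U_ideal h" and ?S = "span_mod (U_ideal h) U_basis"
  note I = cideal_U[of h] and R = U_rels[where h = h]
  note mem = cideal_add[OF I] cideal_lmult[OF I] cideal_rmult[OF I]
  have lmult: "x * f \<in> ?S" if "\<And>a b c. x * U_basis (a, b, c) \<in> ?S" "f \<in> ?S" for x f
    by (rule span_mod_lmult[OF I _ that(2)]) (use that(1) in \<open>auto simp: split_paired_all\<close>)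
  have base: "U_basis b \<in> ?S" for b
    by (rule span_mod_base[OF I])
  have z2: "genz 2 * f \<in> ?S" if "f \<in> ?S" for f
  proof (rule lmult[OF _ that])
    fix a b c
    have "genz 2 * U_basis (a, b, c) = U_basis (Suc a, b, c)"
      by (simp add: U_basis_def mult.assoc)
    then show "genz 2 * U_basis (a, b, c) \<in> ?S"
      by (simp only: base)
  qed
  have z1: "genz 1 * f \<in> ?S" if "f \<in> ?S" for f
  proof (rule lmult[OF _ that])
    fix a b c
    let ?r = "of_nat a * 2 :: real fps"
    let ?s = "?r + of_nat b * - 2"
    let ?W = "genz 1 ^ c"
    have "genz 1 * U_basis (a, b, c) - (U_basis (a, b, Suc c) + scal ?s * U_basis (a, b, c)) =
        (genz 1 * genz 2 ^ a - genz 2 ^ a * (genz 1 + scal ?r)) * (genz 3 ^ b * ?W) +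
        genz 2 ^ a * ((genz 1 + scal ?r) * genz 3 ^ b - genz 3 ^ b * (genz 1 + scal ?s)) * ?W"
      by (simp add: U_basis_def algebra_simps scal_left_commute[of "genz _ ^ _"])
    also have "\<dots> \<in> ?I"
      using cideal_weight_power[OF I R(1), of 0 a] cideal_weight_power[OF I R(2), of ?r b]
      by (intro mem) simp_all
    finally show "genz 1 * U_basis (a, b, c) \<in> ?S"
      by (rule span_mod_cong[OF I]) (intro span_mod_add[OF I] span_mod_scal[OF I] base)
  qed
  \<comment> \<open>\<open>sinh_ratio h\<close> is an infinite series; stability under powers of z_1
    extends to it by \<open>span_mod_slinear\<close>, since only such powers occur in it.\<close>
  have sinh: "sinh_ratio h * f \<in> ?S" if f: "f \<in> ?S" for f
  proof -
    have pow: "genz 1 ^ k * f \<in> ?S" for k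
      by (induction k) (simp_all add: f z1 mult.assoc)
    have "slinear (\<lambda>g. g * f)"
      by (simp add: slinear_def distrib_right mult.assoc)
    then show ?thesis
    proof (rule span_mod_slinear[OF I])
      fix n m
      assume "m \<in> Poly_Mapping.keys (fps_nth (sinh_ratio h) n)"
      then obtain k where "m = ZW (replicate k 1)"
        unfolding sinh_ratio_def by (blast dest: keys_z_series)
      then show "mon m * f \<in> ?S"
        using pow[of k] by (simp add: genz_power)
    qed
  qed
  have z3: "genz 3 * f \<in> ?S" if "f \<in> ?S" for f
  proof (rule lmult[OF _ that])
    fix a b c
    have "genz 3 * (genz 2 ^ a * U_basis (0, b, c)) \<in> ?S"
    proof (rule span_mod_swap[OF I R(3)])
      have "genz 3 * U_basis (0, b, c) = U_basis (0, Suc b, c)"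
        by (simp add: U_basis_def mult.assoc)
      then show "genz 3 * U_basis (0, b, c) \<in> ?S"
        by (simp only: base)
    qed (use z2 sinh base in auto)
    then show "genz 3 * U_basis (a, b, c) \<in> ?S"
      by (simp add: U_basis_def)
  qed
  have gen: "genz i * f \<in> ?S" if "f \<in> ?S" for i f
    using exhaust_3[of i] z1 z2 z3 that by auto
  have "mon (ZW w) \<in> ?S" for w
  proof (induction w)
    case Nil
    have "mon (ZW []) = U_basis (0, 0, 0)"
      by (simp add: U_basis_def flip: zero_zword_def)
    then show ?case
      by (simp only: base)
  next
    case (Cons i w)
    have "mon (ZW (i # w)) = genz i * mon (ZW w)"
      by (simp add: genz_def mon_mult)
    then show ?case
      by (simp only: gen Cons)
  qed
  then show "mon m \<in> ?S" for m
    by (cases m) simp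
qed

section \<open>The regular representation of the enveloping algebra\<close>

text \<open>On an ordered monomial \<open>z\<^sub>2\<^sup>a z\<^sub>3\<^sup>b g(z\<^sub>1)\<close> left multiplication by \<open>z\<^sub>1\<close> multiplies \<open>g(t)\<close> by \<open>t + 2 a - 2 b\<close>,
  and left multiplication by \<open>z\<^sub>3\<close> yields \<open>z\<^sub>2\<^sup>a z\<^sub>3\<^sup>b\<^sup>+\<^sup>1 g - z\<^sub>2\<^sup>a\<^sup>-\<^sup>1 z\<^sub>3\<^sup>b S\<^sub>a(z\<^sub>1 - 2 b) g\<close> with
  \<open>S\<^sub>a(t) = s(t) + s(t + 2) + \<dots> + s(t + 2 a - 2)\<close> and \<open>s(z\<^sub>1) = [z\<^sub>2, z\<^sub>3]\<close>. These formulas make sense pointwise in the real number \<open>t\<close>,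
  on all functions of \<open>(a, b)\<close>, so that no convergence in \<open>z\<^sub>1\<close> is involved. The commutative algebra \<open>nat alg\<close> only serves as a home
  for the scalars.\<close>

type_synonym vec = "nat \<Rightarrow> nat \<Rightarrow> nat alg"

abbreviation creal :: "real \<Rightarrow> nat alg" where
  "creal x \<equiv> scal (fps_const x)"

text \<open>Every generator is sent to x, but only series in z_1 are ever evaluated.\<close>

definition z_eval :: "real \<Rightarrow> zword alg \<Rightarrow> nat alg" where
  "z_eval x = lin (zlift (\<lambda>_. creal x))"

lemma ahom_z_eval: "ahom (z_eval x)"
  unfolding z_eval_def by (rule ahom_lin[OF mhom_zlift])

definition act_1 :: "real \<Rightarrow> vec \<Rightarrow> vec" where
  "act_1 t v a b = creal (t + 2 * real a - 2 * real b) * v a b"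

definition act_2 :: "vec \<Rightarrow> vec" where
  "act_2 v a b = (case a of 0 \<Rightarrow> 0 | Suc a' \<Rightarrow> v a' b)"

definition shift_sum :: "real fps \<Rightarrow> nat \<Rightarrow> real \<Rightarrow> nat alg" where
  "shift_sum h a x = (\<Sum>j<a. z_eval (x + 2 * real j) (sinh_ratio h))"

text \<open>The correction at index \<open>(a, b)\<close> arises from the monomial with one more
  z_2, hence \<open>v (Suc a) b\<close> and \<open>shift_sum h (Suc a)\<close>.\<close>

definition act_3 :: "real fps \<Rightarrow> real \<Rightarrow> vec \<Rightarrow> vec" where
  "act_3 h t v a b = (case b of 0 \<Rightarrow> 0 | Suc b' \<Rightarrow> v a b') - shift_sum h (Suc a) (t - 2 * real b) * v (Suc a) b"

definition act_gen :: "real fps \<Rightarrow> real \<Rightarrow> 3 \<Rightarrow> vec \<Rightarrow> vec" where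
  "act_gen h t i = (if i = 1 then act_1 t else if i = 2 then act_2 else act_3 h t)"

primrec act_word :: "real fps \<Rightarrow> real \<Rightarrow> zword \<Rightarrow> vec \<Rightarrow> vec" where
  "act_word h t (ZW w) = foldr (act_gen h t) w"

text \<open>Extending the action of words separately at each index \<open>(a, b)\<close> keeps the
  \<epsilon>-adic sums inside \<open>nat alg\<close>, so vectors need no topology.\<close>

definition act :: "real fps \<Rightarrow> real \<Rightarrow> zword alg \<Rightarrow> vec \<Rightarrow> vec" where
  "act h t f v a b = lin (\<lambda>m. act_word h t m v a b) f"

lemma slinear_act: "slinear (\<lambda>f. act h t f v a b)"
  unfolding act_def by (rule slinear_lin)

lemma act_mon: "act h t (mon m) v = act_word h t m v"
  by (intro ext) (simp add: act_def)

lemma act_genz: "act h t (genz i) v = act_gen h t i v"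
  by (simp add: genz_def act_mon)

lemma mon_Nil: "mon (ZW []) = 1"
  by (simp flip: zero_zword_def)

lemma act_one: "act h t 1 v = v"
  using act_mon[of h t "ZW []" v] by (simp add: mon_Nil)

lemma slinear_act_gen:
  fixes V :: "zword alg \<Rightarrow> vec"
  assumes V: "\<And>a b. slinear (\<lambda>f. V f a b)"
  shows "slinear (\<lambda>f. act_gen h t i (V f) a b)"
proof -
  have lin: "V (f + g) a b = V f a b + V g a b" "V (scal r * f) a b = scal r * V f a b" for f g r a b
    using V unfolding slinear_def by blast+
  show ?thesis
    by (auto simp: slinear_def act_gen_def act_1_def act_2_def act_3_def lin algebra_simps
        split: nat.splits)
qed

lemma act_genz_mult: "act h t (genz i * g) v = act_gen h t i (act h t g v)"
proof (intro ext)
  fix a b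
  show "act h t (genz i * g) v a b = act_gen h t i (act h t g v) a b"
  proof (rule slinear_eqI[OF _ slinear_act_gen[OF slinear_act]])
    show "slinear (\<lambda>g. act h t (genz i * g) v a b)"
      using slinear_act[of h t v a b]
      by (simp add: slinear_def distrib_left scal_left_commute[of "genz i"])
    show "act h t (genz i * mon m) v a b = act_gen h t i (act h t (mon m) v) a b" for m
      by (cases m) (simp add: genz_def mon_mult act_mon)
  qed
qed

lemma act_mult: "act h t (f * g) v = act h t f (act h t g v)"
proof (intro ext)
  fix a b
  have word: "act h t (mon (ZW w) * g) v = act_word h t (ZW w) (act h t g v)" for w
  proof (induction w)
    case Nil
    show ?case by (simp add: mon_Nil)
  next
    case (Cons i w)
    have "mon (ZW (i # w)) * g = genz i * (mon (ZW w) * g)"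
      by (simp add: genz_def mon_mult flip: mult.assoc)
    then show ?case
      by (simp add: act_genz_mult Cons)
  qed
  show "act h t (f * g) v a b = act h t f (act h t g v) a b"
  proof (rule slinear_eqI[OF _ slinear_act])
    show "slinear (\<lambda>f. act h t (f * g) v a b)"
      using slinear_act[of h t v a b] by (simp add: slinear_def distrib_right mult.assoc)
    show "act h t (mon m * g) v a b = act h t (mon m) (act h t g v) a b" for m
      by (cases m) (simp add: word act_mon)
  qed
qed

lemma act_add: "act h t (f + g) v a b = act h t f v a b + act h t g v a b"
  and act_diff: "act h t (f - g) v a b = act h t f v a b - act h t g v a b"
  and act_scal_mult: "act h t (scal r * f) v a b = scal r * act h t f v a b"
  using slinear_act[of h t v a b] slinear_diff[OF slinear_act] by (auto simp: slinear_def)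

lemma act_zero: "act h t f (\<lambda>_ _. 0) a b = 0"
proof (rule slinear_zero_on_monI[OF slinear_act])
  have "act_gen h t i (\<lambda>_ _. 0) = (\<lambda>_ _. 0)" for i
    by (intro ext) (simp add: act_gen_def act_1_def act_2_def act_3_def split: nat.splits)
  then have "foldr (act_gen h t) w (\<lambda>_ _. 0) = (\<lambda>_ _. 0)" for w
    by (induction w) simp_all
  then show "act h t (mon m) (\<lambda>_ _. 0) a b = 0" for m
    by (cases m) (simp add: act_mon)
qed

text \<open>z_1 acts diagonally, by the weight \<open>t + 2 a - 2 b\<close> at index
  \<open>(a, b)\<close>, so a series in z_1 acts by its value at that weight.\<close>

lemma act_z_series:
  "act h t (z_series c) v a b = z_eval (t + 2 * real a - 2 * real b) (z_series c) * v a b"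
proof -
  let ?x = "t + 2 * real a - 2 * real b"
  let ?T = "\<lambda>g. act h t g v a b - z_eval ?x g * v a b"
  have "slinear ?T"
    using slinear_act[of h t v a b] ahom_simps[OF ahom_z_eval[of ?x]]
    by (simp add: slinear_def algebra_simps)
  then have "?T (z_series c) \<in> {0}"
  proof (rule slinear_in_cideal[OF _ cideal_singleton_0])
    fix n m
    assume "m \<in> Poly_Mapping.keys (fps_nth (z_series c) n)"
    then obtain k where m: "m = ZW (replicate k 1)"
      using keys_z_series by blast
    have "foldr (act_gen h t) (replicate k 1) v a b = creal ?x ^ k * v a b"
      by (induction k arbitrary: v) (simp_all add: act_gen_def act_1_def mult.assoc)
    then show "?T (mon m) \<in> {0}"
      by (simp add: m act_mon z_eval_def prod_list_replicate)
  qed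
  then show ?thesis by simp
qed

lemma act_U_ideal:
  assumes "f \<in> U_ideal h"
  shows "act h t f v a b = 0"
proof -
  \<comment> \<open>Annihilation is demanded for all vectors at once, which makes \<open>K\<close>
    stable under right multiplication.\<close>
  define K where "K = {f. \<forall>v a b. act h t f v a b = 0}"
  have zero: "act h t f v = (\<lambda>_ _. 0)" if "f \<in> K" for f v
    using that by (intro ext) (simp add: K_def)
  have "ideal K ring_of_type_algebra"
    unfolding ideal_iff
  proof (intro conjI ballI allI)
    show "0 \<in> K"
      by (simp add: K_def slinear_0[OF slinear_act])
    fix f g
    assume f: "f \<in> K"
    show "f + g \<in> K" if "g \<in> K"
      using f that by (simp add: K_def act_add)
    show "r * f \<in> K" "f * r \<in> K" for r
      using f by (simp_all add: K_def act_mult zero[OF f] act_zero)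
  qed
  moreover have "f \<in> K" if lim: "\<forall>N. \<exists>g\<in>K. \<forall>n<N. fps_nth f n = fps_nth g n" for f
    unfolding K_def
  proof (intro CollectI allI fps_ext)
    fix v a b n
    obtain g where g: "g \<in> K" "\<forall>m<Suc n. fps_nth f m = fps_nth g m"
      using lim by blast
    have "fps_nth (act h t f v a b) n = fps_nth (act h t g v a b) n"
      by (rule slinear_agree[OF slinear_act g(2)]) simp
    then show "fps_nth (act h t f v a b) n = fps_nth 0 n"
      using g(1) by (simp add: K_def)
  qed
  ultimately have K: "cideal K"
    by (simp add: cideal_def)
  note act_simps = commutator_def act_add act_diff act_scal_mult act_genz_mult act_genz
  have two: "2 * g = scal (fps_const 2) * g" for g :: "'x::monoid_add alg"
    by (simp flip: numeral_fps_const)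
  have "commutator (genz 1) (genz 2) - 2 * genz 2 \<in> K"
    unfolding K_def two
  proof (intro CollectI allI)
    fix v a b
    show "act h t (commutator (genz 1) (genz 2) - scal (fps_const 2) * genz 2) v a b = 0"
    proof (cases a)
      case (Suc a')
      have "creal (t + 2 * real (Suc a') - 2 * real b) = creal (t + 2 * real a' - 2 * real b) + creal 2"
        by (simp flip: scal_add add: algebra_simps)
      then show ?thesis
        by (simp only: act_simps) (simp add: act_gen_def act_1_def act_2_def Suc algebra_simps del: of_nat_Suc)
    qed (simp only: act_simps, simp add: act_gen_def act_1_def act_2_def)
  qed
  moreover have "commutator (genz 1) (genz 3) + 2 * genz 3 \<in> K"
    unfolding K_def two
  proof (intro CollectI allI)
    fix v a b
    have 1: "creal (t + 2 * real (Suc a) - 2 * real b) = creal (t + 2 * real a - 2 * real b) + creal 2"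
      by (simp flip: scal_add add: algebra_simps)
    show "act h t (commutator (genz 1) (genz 3) + scal (fps_const 2) * genz 3) v a b = 0"
    proof (cases b)
      case (Suc b')
      have "creal (t + 2 * real a - 2 * real b') = creal (t + 2 * real a - 2 * real b) + creal 2"
        by (simp flip: scal_add add: algebra_simps Suc)
      then show ?thesis
        using 1 by (simp only: act_simps)
          (simp add: act_gen_def act_1_def act_3_def Suc algebra_simps del: of_nat_Suc)
    next
      case 0
      show ?thesis
        using 1 unfolding 0
        by (simp only: act_simps) (simp add: act_gen_def act_1_def act_3_def algebra_simps del: of_nat_Suc)
    qed
  qed
  moreover have "commutator (genz 2) (genz 3) - sinh_ratio h \<in> K"
    unfolding K_def
  proof (intro CollectI allI)
    fix v a b
    have s: "act h t (sinh_ratio h) v a b = z_eval (t - 2 * real b + 2 * real a) (sinh_ratio h) * v a b"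
      unfolding sinh_ratio_def act_z_series by (simp add: algebra_simps)
    \<comment> \<open>\<open>shift_sum\<close> for \<open>a + 1\<close> minus
      \<open>shift_sum\<close> for a leaves the last summand, the value of the series at the weight
      of \<open>(a, b)\<close>, which is what \<open>s\<close> requires.\<close>
    show "act h t (commutator (genz 2) (genz 3) - sinh_ratio h) v a b = 0"
      unfolding act_simps s
      by (cases a; cases b)
        (simp_all add: act_gen_def act_2_def act_3_def shift_sum_def algebra_simps del: of_nat_Suc)
  qed
  ultimately have "U_ideal h \<subseteq> K"
    unfolding U_ideal_def by (intro closed_ideal_least[OF K]) simp
  then show ?thesis
    using assms by (auto simp: K_def)
qed

section \<open>Ordered monomials acting on the vacuum vector\<close>

definition delta_vec :: "nat alg \<Rightarrow> nat \<Rightarrow> nat \<Rightarrow> vec" where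
  "delta_vec r a b = (\<lambda>a' b'. if a' = a \<and> b' = b then r else 0)"

text \<open>z_3 acts while the power of z_2 is still zero, so its correction term reads off a zero
  entry, and z_2 only shifts. Hence an ordered monomial produces a single nonzero entry at
  most.\<close>

lemma act_delta_vec:
  assumes g: "act h t g (delta_vec 1 0 0) = delta_vec r 0 0"
  shows "act h t (genz 2 ^ a * (genz 3 ^ b * g)) (delta_vec 1 0 0) = delta_vec r a b"
proof (induction a)
  case 0
  have "act h t (genz 3 ^ b * g) (delta_vec 1 0 0) = delta_vec r 0 b"
  proof (induction b)
    case (Suc b)
    show ?case
      unfolding power_Suc mult.assoc act_genz_mult Suc
      by (intro ext) (auto simp: act_gen_def act_3_def delta_vec_def split: nat.splits)
  qed (simp add: g)
  then show ?case by simp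
next
  case (Suc a)
  show ?case
    unfolding power_Suc mult.assoc act_genz_mult Suc
    by (intro ext) (auto simp: act_gen_def act_2_def delta_vec_def split: nat.splits)
qed

lemma act_vacuum_genz: "act h t (genz 1 ^ c * g) (delta_vec 1 0 0) = delta_vec (creal t ^ c * r) 0 0"
  if "act h t g (delta_vec 1 0 0) = delta_vec r 0 0"
proof (induction c)
  case 0
  show ?case by (simp add: that)
next
  case (Suc c)
  show ?case
    unfolding power_Suc mult.assoc act_genz_mult Suc
    by (intro ext) (auto simp: act_gen_def act_1_def delta_vec_def)
qed

lemma act_vacuum_expz:
  assumes "fps_nth d 0 = 0"
  shows "act h t (expz d) (delta_vec 1 0 0) = delta_vec (scal (fexp (d * fps_const t))) 0 0"
proof -
  have "z_eval t (expz d) = nexp (z_eval t (scal d * genz 1))"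
    using assms by (simp add: expz_conv_nexp ahom_nexp[OF ahom_z_eval])
  also have "z_eval t (scal d * genz 1) = scal (d * fps_const t)"
    by (simp add: ahom_simps[OF ahom_z_eval] scal_mult) (simp add: z_eval_def)
  finally have "z_eval t (expz d) = scal (fexp (d * fps_const t))"
    by (simp add: nexp_scal)
  then show ?thesis
    by (intro ext) (auto simp: expz_def act_z_series delta_vec_def)
qed

section \<open>Linear independence and its consequences\<close>

lemma poly_real_zeroI: "(\<And>t :: real. poly p t = 0) \<Longrightarrow> p = 0"
  using poly_all_0_iff_0 by blast

text \<open>The entry \<open>(a, b)\<close> of the image of the vacuum isolates the monomials
  \<open>z_2^a z_3^b z_1^c\<close>. At each order in \<epsilon> it is a polynomial in the weight t
  that vanishes for all real t.\<close>

lemma U_independent: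
  assumes v: "lin U_basis v \<in> U_ideal h"
  shows "v = 0"
proof (rule fps_ext, rule poly_mapping_eqI)
  fix N and m :: "nat \<times> nat \<times> nat"
  obtain a b c where m: "m = (a, b, c)"
    by (cases m)
  let ?V = "fps_nth v N"
  define P where "P = (\<Sum>m\<in>Poly_Mapping.keys ?V. case m of (a', b', c') \<Rightarrow>
    if a' = a \<and> b' = b then Polynomial.monom (Poly_Mapping.lookup ?V m) c' else 0)"
  have "poly P t = 0" for t
  proof -
    define p where "p = (\<lambda>(a', b', c'). if a' = a \<and> b' = b then t ^ c' else 0)"
    let ?T = "\<lambda>v. act h t (lin U_basis v) (delta_vec 1 0 0) a b"
    have "slinear ?T"
      using slinear_act[of h t] by (simp add: slinear_def lin_add lin_scal_mult)
    moreover
    have "?T (mon (a', b', c')) = scal (fps_const (p (a', b', c')))" for a' b' c'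
    proof -
      have "act h t (genz 1 ^ c' * 1) (delta_vec 1 0 0) = delta_vec (creal t ^ c' * 1) 0 0"
        by (rule act_vacuum_genz) (simp add: act_one)
      then have "act h t (U_basis (a', b', c')) (delta_vec 1 0 0) = delta_vec (creal t ^ c') a' b'"
        using act_delta_vec[of h t "genz 1 ^ c'" "creal t ^ c'" a' b'] by (simp add: U_basis_def)
      then show ?thesis
        by (auto simp: delta_vec_def p_def fps_const_power simp flip: scal_power)
    qed
    then have "?T (mon m) = lin (\<lambda>m. scal (fps_const (p m))) (mon m)" for m
      unfolding lin_mon[where \<phi> = "\<lambda>m. scal (fps_const (p m))"] by (cases m) blast
    ultimately have "?T v = lin (\<lambda>m. scal (fps_const (p m))) v"
      by (rule slinear_eqI[OF _ slinear_lin])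
    \<comment> \<open>\<open>counit p\<close> serves here as the coefficientwise linear functional
      with values \<open>p\<close>.\<close>
    then have "(scal (counit p v) :: nat alg) = scal 0"
      using act_U_ideal[OF v] by (simp add: scal_counit)
    then have "counit p v = 0"
      by (simp only: scal_inj)
    then have "fps_nth (counit p v) N = 0"
      by simp
    then have "(\<Sum>m\<in>Poly_Mapping.keys ?V. Poly_Mapping.lookup ?V m * p m) = 0"
      by (simp add: counit_def)
    also have "(\<Sum>m\<in>Poly_Mapping.keys ?V. Poly_Mapping.lookup ?V m * p m) = poly P t"
      unfolding P_def poly_sum by (rule sum.cong) (auto simp: p_def poly_monom)
    finally show ?thesis .
  qed
  then have "P = 0"
    by (rule poly_real_zeroI)
  then have "0 = Polynomial.coeff P c"
    by simp
  also have "\<dots> = (\<Sum>m'\<in>Poly_Mapping.keys ?V. if m' = m then Poly_Mapping.lookup ?V m' else 0)"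
    unfolding P_def coeff_sum by (rule sum.cong) (auto simp: m split: if_splits)
  also have "\<dots> = Poly_Mapping.lookup ?V m"
    by (simp add: in_keys_iff)
  finally show "Poly_Mapping.lookup (fps_nth v N) m = Poly_Mapping.lookup (fps_nth 0 N) m"
    by simp
qed

text \<open>Modulo I every element comes from a coefficient family, unique by independence, and
  multiplication by \<epsilon> is injective on families.\<close>

lemma scal_X_cancel_ideal:
  assumes I: "cideal I" and span: "f \<in> span_mod I \<beta>"
    and indep: "\<And>v. lin \<beta> v \<in> I \<Longrightarrow> v = 0" and f: "scal fps_X * f \<in> I"
  shows "f \<in> I"
proof -
  obtain v where v: "f - lin \<beta> v \<in> I"
    using span by (auto simp: span_mod_def)
  have "lin \<beta> (scal fps_X * v) = scal fps_X * f - scal fps_X * (f - lin \<beta> v)"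
    by (simp add: lin_scal_mult right_diff_distrib del: scal_X)
  also have "\<dots> \<in> I"
    using f cideal_lmult[OF I v, of "scal fps_X"] by (rule cideal_diff[OF I])
  finally have "scal fps_X * v = scal fps_X * 0"
    using indep by (metis mult_zero_right)
  then have "v = 0"
    by (rule scal_cancel[rotated]) simp
  then show ?thesis
    using v slinear_0[OF slinear_lin[of \<beta>]] by simp
qed

lemma U_torsion_free: "scal fps_X * f \<in> U_ideal h \<Longrightarrow> f \<in> U_ideal h"
  using scal_X_cancel_ideal[OF cideal_U U_spanning U_independent] .

section \<open>Independence of exponential polynomials\<close>

lemma fps_of_poly_exp_deriv:
  fixes k :: real
  shows "(fps_deriv ^^ n) (fps_of_poly p * fps_exp k) =
    fps_of_poly (((\<lambda>p. pderiv p + Polynomial.smult k p) ^^ n) p) * fps_exp k"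
proof (induction n arbitrary: p)
  case (Suc n)
  have "fps_deriv (fps_of_poly p * fps_exp k) = fps_of_poly (pderiv p + Polynomial.smult k p) * fps_exp k"
    by (simp add: fps_of_poly_add fps_of_poly_smult fps_of_poly_pderiv algebra_simps)
  then show ?case
    by (simp add: Suc funpow_swap1 del: funpow.simps add: funpow_Suc_right)
qed simp

text \<open>Multiplying by \<open>e^(-l t)\<close> and differentiating \<open>degree + 1\<close>
  times removes the term of exponent l. On every other term the induced operator is a power of
  \<open>q \<mapsto> q' + k q\<close> with \<open>k \<noteq> 0\<close>, which is injective since it
  multiplies the leading coefficient by k.\<close>

lemma exp_poly_independent:
  fixes p :: "real \<Rightarrow> real poly"
  assumes "finite K" and "(\<Sum>k\<in>K. fps_of_poly (p k) * fps_exp k) = 0" and "k \<in> K"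
  shows "p k = 0"
  using assms
proof (induction K arbitrary: p k rule: finite_induct)
  case (insert l K)
  define D where "D k = (\<lambda>q :: real poly. pderiv q + Polynomial.smult k q)" for k
  have D_inj: "q = 0" if "(D k ^^ n) q = 0" "k \<noteq> 0" for k n q
    using that(1)
  proof (induction n)
    case (Suc n)
    let ?q = "(D k ^^ n) q"
    have "?q = 0"
    proof (rule ccontr)
      assume "?q \<noteq> 0"
      moreover have "Polynomial.coeff (D k ?q) (Polynomial.degree ?q) = k * Polynomial.lead_coeff ?q"
        by (simp add: D_def coeff_pderiv coeff_eq_0)
      ultimately show False
        using Suc.prems \<open>k \<noteq> 0\<close> by simp
    qed
    then show ?case by (rule Suc.IH)
  qed simp
  let ?n = "Suc (Polynomial.degree (p l))"
  have sum_l: "fps_of_poly (p l) * fps_exp 0 + (\<Sum>k\<in>K. fps_of_poly (p k) * fps_exp (k - l)) = 0"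
  proof -
    have "fps_exp (- l) * (fps_of_poly (p k) * fps_exp k) = fps_of_poly (p k) * fps_exp (k - l)" for k
      using fps_exp_add_mult[of "- l" k] by (simp add: algebra_simps)
    then have "(\<Sum>k\<in>insert l K. fps_of_poly (p k) * fps_exp (k - l)) =
        fps_exp (- l) * (\<Sum>k\<in>insert l K. fps_of_poly (p k) * fps_exp k)"
      by (simp only: sum_distrib_left)
    then show ?thesis
      using insert.prems(1) insert.hyps by simp
  qed
  have deriv_sum: "(fps_deriv ^^ n) (\<Sum>k\<in>S. f k) = (\<Sum>k\<in>S. (fps_deriv ^^ n) (f k))"
    for n S and f :: "real \<Rightarrow> real fps"
    by (induction n) (simp_all add: fps_deriv_sum)
  have "(fps_deriv ^^ ?n) (fps_of_poly (p l) * fps_exp 0) = 0"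
  proof -
    have "(pderiv ^^ n) q = 0" if "Polynomial.degree q < n" for n and q :: "real poly"
      using that
    proof (induction n arbitrary: q)
      case (Suc n)
      show ?case
      proof (cases "Polynomial.degree q = 0")
        case True
        then have "pderiv q = 0"
          by (simp add: pderiv_eq_0_iff)
        moreover have "(pderiv ^^ n) 0 = (0 :: real poly)"
          by (induction n) simp_all
        ultimately show ?thesis
          by (simp add: funpow_swap1)
      next
        case False
        then show ?thesis
          using Suc.prems by (simp add: funpow_swap1 Suc.IH degree_pderiv)
      qed
    qed simp
    then show ?thesis
      unfolding fps_of_poly_exp_deriv by (simp del: funpow.simps)
  qed
  moreover have "(fps_deriv ^^ ?n) (x + y) = (fps_deriv ^^ ?n) x + (fps_deriv ^^ ?n) y" for x y :: "real fps"
    using deriv_sum[of ?n "\<lambda>i. if i = 0 then x else y" "{0, 1}"] by (simp del: funpow.simps)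
  moreover have "(fps_deriv ^^ ?n) (0 :: real fps) = 0"
    using deriv_sum[of ?n "\<lambda>_. 0" "{}"] by (simp del: funpow.simps)
  ultimately have "(\<Sum>k\<in>K. (fps_deriv ^^ ?n) (fps_of_poly (p k) * fps_exp (k - l))) = 0"
    using arg_cong[OF sum_l, of "fps_deriv ^^ ?n"] by (simp add: deriv_sum del: funpow.simps)
  then have "fps_exp l * (\<Sum>k\<in>K. fps_of_poly ((D (k - l) ^^ ?n) (p k)) * fps_exp (k - l)) = 0"
    by (simp add: fps_of_poly_exp_deriv D_def del: funpow.simps)
  moreover have "fps_exp l * (fps_of_poly q * fps_exp (k - l)) = fps_of_poly q * fps_exp k" for q k
    using fps_exp_add_mult[of l "k - l"] by (simp add: algebra_simps)
  ultimately have "(\<Sum>k\<in>K. fps_of_poly ((D (k - l) ^^ ?n) (p k)) * fps_exp k) = 0"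
    by (simp add: sum_distrib_left del: funpow.simps)
  from insert.IH[OF this] have K0: "p k = 0" if "k \<in> K" for k
    using that insert.hyps D_inj[where k = "k - l" and n = ?n and q = "p k"] by (cases "k = l") auto
  then have "fps_of_poly (p l) = 0"
    using sum_l by simp
  then have "p l = 0"
    by (metis fps_of_poly_0 fps_of_poly_eq_iff)
  with K0 insert.prems(2) show ?case by auto
qed simp

lemma F_independent:
  assumes c: "rescaling A \<noteq> 0" and v: "lin (coord_change A) (lin F_basis v) \<in> U_ideal h_par"
  shows "v = 0"
proof (rule fps_ext, rule poly_mapping_eqI)
  fix N and m :: "nat \<times> nat \<times> nat \<times> int"
  obtain a b c k where m: "m = (a, b, c, k)"
    by (cases m)
  \<comment> \<open>\<open>q\<close> attaches to an index the formal function
    \<open>t^c e^(k t)\<close>, suppressing all exponents of x_2 and x_3 other than a and b.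
    \<open>Q n\<close> gathers order n of v into one exponential polynomial, and the aim is that it
    vanishes.\<close>
  define q :: "nat \<times> nat \<times> nat \<times> int \<Rightarrow> real fps" where
    "q = (\<lambda>(a', b', c', k'). if a' = a \<and> b' = b then fps_X ^ c' * fps_exp (of_int k') else 0)"
  define Q where "Q n = (\<Sum>m\<in>Poly_Mapping.keys (fps_nth v n). fps_const (Poly_Mapping.lookup (fps_nth v n) m) * q m)" for n
  have "fps_nth (Q n) d = 0" for n d
  proof -
    \<comment> \<open>Up to a common factor, this is the coefficient of order \<open>n + d\<close>
      in the entry \<open>(a, b)\<close>, as a polynomial in t. Order i of v is paired with
      \<open>t^(n + d - i)\<close>, so the coefficient of \<open>t^d\<close> involves
      \<open>Q n\<close> alone.\<close>
    define R where "R = (\<Sum>i\<le>n + d. Polynomial.monom (fps_nth (Q i) (n + d - i)) (n + d - i))"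
    have "poly R t = 0" for t
    proof -
      let ?T = "\<lambda>v. act h_par t (lin (coord_change A) (lin F_basis v)) (delta_vec 1 0 0) a b"
      \<comment> \<open>The factor from rescaling x_2 and x_3 depends only on the entry
        \<open>(a, b)\<close>, so it is common to all surviving terms and can be cancelled.\<close>
      let ?c = "rescaling A ^ (a + b)"
      \<comment> \<open>Since x_1 becomes \<open>\<epsilon> z_1\<close> and z_1 has weight t on the
        vacuum, the substitution composes \<open>q m\<close> with
        \<open>\<epsilon> t\<close>.\<close>
      define g where "g m = q m oo (fps_const t * fps_X)" for m
      have comp: "(x * y) oo (fps_const t * fps_X) = (x oo (fps_const t * fps_X)) * (y oo (fps_const t * fps_X))"
        for x y :: "real fps"
        by (rule fps_compose_mult_distrib) simp
      have T: "?T (mon (a', b', c', k')) = scal ?c * scal (g (a', b', c', k'))" for a' b' c' k'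
      proof -
        let ?d = "of_int k' * fps_X :: real fps"
        have ek: "lin (coord_change A) (expx k') = expz ?d"
        proof (induction k' rule: int_induct[where k = 0])
          case base
          show ?case by (simp add: ahom_simps[OF ahom_coord_change])
        next
          case (step1 i)
          have "lin (coord_change A) (expx (i + 1)) = lin (coord_change A) (expx i * expx 1)"
            by (simp add: expx_mult)
          then show ?case
            by (simp add: ahom_simps[OF ahom_coord_change] step1 lin_coord_change distrib_right flip: expz_add)
        next
          case (step2 i)
          have "lin (coord_change A) (expx (i - 1)) = lin (coord_change A) (expx i * expx (- 1))"
            by (simp add: expx_mult)
          then show ?case
            by (simp add: ahom_simps[OF ahom_coord_change] step2 lin_coord_change left_diff_distrib flip: expz_add)
        qed
        have "act h_par t (genz 1 ^ c' * expz ?d) (delta_vec 1 0 0) =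
            delta_vec (creal t ^ c' * scal (fexp (?d * fps_const t))) 0 0"
          by (intro act_vacuum_genz act_vacuum_expz) simp
        note basis = act_delta_vec[OF this, of a' b']
        have "lin (coord_change A) (F_basis (a', b', c', k')) =
            scal (rescaling A ^ (a' + b') * fps_X ^ c') * (genz 2 ^ a' * (genz 3 ^ b' * (genz 1 ^ c' * expz ?d)))"
          by (simp only: F_basis_def prod.case ahom_simps[OF ahom_coord_change] lin_coord_change insertI1 insertI2
              ek scal_mult_power mult.assoc scal_left_commute[of "genz _ ^ _"] scal_scal_mult power_add)
        then have "?T (mon (a', b', c', k')) = scal (rescaling A ^ (a' + b') * fps_X ^ c') *
            delta_vec (creal t ^ c' * scal (fexp (?d * fps_const t))) a' b' a b"
          by (simp only: lin_mon act_scal_mult basis)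
        also have "\<dots> = scal ?c * scal (g (a', b', c', k'))"
        proof (cases "a' = a \<and> b' = b")
          case True
          have "?d * fps_const t = fps_const (of_int k' * t) * fps_X"
            by (simp add: mult_ac flip: fps_of_int)
          then have "fexp (?d * fps_const t) = fps_exp (of_int k') oo (fps_const t * fps_X)"
            by (simp only: fexp_def fps_exp_compose_linear) (simp add: mult.commute)
          moreover have "fps_X ^ c' oo (fps_const t * fps_X) = fps_const t ^ c' * fps_X ^ c'"
            by (simp add: fps_X_power_compose power_mult_distrib)
          ultimately have "g (a', b', c', k') = fps_const t ^ c' * fps_X ^ c' * fexp (?d * fps_const t)"
            using True by (simp add: g_def q_def comp)
          then show ?thesis
            using True by (simp add: delta_vec_def mult_ac flip: scal_mult scal_power)
        next
          case False
          then show ?thesis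
            by (auto simp: delta_vec_def g_def q_def)
        qed
        finally show ?thesis .
      qed
      have "?T v = scal ?c * lin (\<lambda>m. scal (g m)) v"
      proof (rule slinear_eqI[where T = ?T and U = "\<lambda>v. scal ?c * lin (\<lambda>m. scal (g m)) v"])
        show "slinear ?T"
          using slinear_act[of h_par t] by (simp add: slinear_def lin_add lin_scal_mult)
        show "slinear (\<lambda>v. scal ?c * lin (\<lambda>m. scal (g m)) v :: nat alg)"
          by (simp add: slinear_def lin_add lin_scal_mult distrib_left mult.left_commute)
        show "?T (mon m) = scal ?c * lin (\<lambda>m. scal (g m)) (mon m)" for m
          by (cases m) (simp only: T[unfolded lin_mon] lin_mon)
      qed
      then have "scal ?c * lin (\<lambda>m. scal (g m)) v = (scal ?c * 0 :: nat alg)"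
        using act_U_ideal[OF v] by simp
      then have "lin (\<lambda>m. scal (g m)) v = (0 :: nat alg)"
        by (rule scal_cancel[rotated]) (use c in simp)
      then have "0 = Poly_Mapping.lookup (fps_nth (lin (\<lambda>m. scal (g m)) v :: nat alg) (n + d)) 0"
        by simp
      also have "\<dots> = (\<Sum>i\<le>n + d. \<Sum>m\<in>Poly_Mapping.keys (fps_nth v i).
          Poly_Mapping.lookup (fps_nth v i) m * fps_nth (g m) (n + d - i))"
        by (simp add: lin_def lookup_sum mult_single)
      finally have "0 = (\<Sum>i\<le>n + d. \<Sum>m\<in>Poly_Mapping.keys (fps_nth v i).
          Poly_Mapping.lookup (fps_nth v i) m * fps_nth (g m) (n + d - i))" .
      moreover have "fps_nth (g m) j = t ^ j * fps_nth (q m) j" for m j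
        by (simp add: g_def fps_compose_linear)
      then have "(\<Sum>i\<le>n + d. \<Sum>m\<in>Poly_Mapping.keys (fps_nth v i).
          Poly_Mapping.lookup (fps_nth v i) m * fps_nth (g m) (n + d - i)) = poly R t"
        unfolding R_def poly_sum
        by (intro sum.cong) (simp_all add: Q_def poly_monom fps_sum_nth sum_distrib_left mult_ac)
      ultimately show ?thesis by simp
    qed
    then have "R = 0"
      by (rule poly_real_zeroI)
    then have "0 = Polynomial.coeff R d"
      by simp
    also have "\<dots> = (\<Sum>i\<le>n + d. if i = n then fps_nth (Q i) (n + d - i) else 0)"
      unfolding R_def coeff_sum by (rule sum.cong) auto
    also have "\<dots> = fps_nth (Q n) d"
      by simp
    finally show ?thesis by simp
  qed
  then have Q0: "Q N = 0"
    by (intro fps_ext) simp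
  let ?V = "fps_nth v N"
  \<comment> \<open>Terms with the same exponent k are merged into one polynomial factor, because
    \<open>exp_poly_independent\<close> speaks about distinct exponents.\<close>
  define K where "K = (\<lambda>(a', b', c', k'). of_int k' :: real) ` Poly_Mapping.keys ?V"
  define p where "p x = (\<Sum>m\<in>Poly_Mapping.keys ?V. case m of (a', b', c', k') \<Rightarrow>
    if a' = a \<and> b' = b \<and> of_int k' = x then Polynomial.monom (Poly_Mapping.lookup ?V m) c' else 0)" for x :: real
  have "(\<Sum>x\<in>K. fps_of_poly (p x) * fps_exp x) = (\<Sum>m\<in>Poly_Mapping.keys ?V. \<Sum>x\<in>K.
      fps_of_poly (case m of (a', b', c', k') \<Rightarrow>
        if a' = a \<and> b' = b \<and> of_int k' = x then Polynomial.monom (Poly_Mapping.lookup ?V m) c' else 0) * fps_exp x)"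
    unfolding p_def fps_of_poly_sum sum_distrib_right by (rule sum.swap)
  also have "\<dots> = Q N"
    unfolding Q_def
  proof (rule sum.cong)
    fix m
    assume mV: "m \<in> Poly_Mapping.keys ?V"
    obtain a' b' c' k' where m: "m = (a', b', c', k')"
      by (cases m)
    have "of_int k' \<in> K"
      unfolding K_def using mV m by force
    moreover have "finite K"
      by (simp add: K_def)
    moreover have "(\<Sum>x\<in>K. fps_of_poly (case m of (a', b', c', k') \<Rightarrow>
        if a' = a \<and> b' = b \<and> of_int k' = x then Polynomial.monom (Poly_Mapping.lookup ?V m) c' else 0) * fps_exp x) =
        (\<Sum>x\<in>K. if x = of_int k' then fps_const (Poly_Mapping.lookup ?V m) * q m else 0)"
      by (rule sum.cong) (auto simp: m q_def fps_of_poly_monom mult.assoc)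
    ultimately show "(\<Sum>x\<in>K. fps_of_poly (case m of (a', b', c', k') \<Rightarrow>
        if a' = a \<and> b' = b \<and> of_int k' = x then Polynomial.monom (Poly_Mapping.lookup ?V m) c' else 0) * fps_exp x) =
        fps_const (Poly_Mapping.lookup ?V m) * q m"
      by simp
  qed simp
  finally have p0: "p x = 0" if "x \<in> K" for x
    using exp_poly_independent[of K p x] that Q0 by (simp add: K_def)
  have "Poly_Mapping.lookup ?V m = 0"
  proof (cases "m \<in> Poly_Mapping.keys ?V")
    case True
    then have "of_int k \<in> K"
      unfolding K_def using m by force
    then have "0 = Polynomial.coeff (p (of_int k)) c"
      by (simp add: p0)
    also have "\<dots> = (\<Sum>m'\<in>Poly_Mapping.keys ?V. if m' = m then Poly_Mapping.lookup ?V m' else 0)"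
      unfolding p_def coeff_sum by (rule sum.cong) (auto simp: m split: if_splits)
    also have "\<dots> = Poly_Mapping.lookup ?V m"
      by (simp add: in_keys_iff)
    finally show ?thesis by simp
  qed (simp add: in_keys_iff)
  then show "Poly_Mapping.lookup (fps_nth v N) m = Poly_Mapping.lookup (fps_nth 0 N) m"
    by simp
qed

text \<open>Modulo the ideal f is an ordered combination; its image lies in the ideal of U_h
  together with that of f, and independence forces all its coefficients to vanish.\<close>

lemma coord_change_reflects_ideal:
  assumes c: "rescaling A \<noteq> 0" and c2: "(rescaling A)\<^sup>2 = 2 * fps_X * (A oo fps_X\<^sup>2) * fsinh h_par"
    and f: "lin (coord_change A) f \<in> U_ideal h_par"
  shows "f \<in> F_ideal A"
proof -
  obtain v where v: "f - lin F_basis v \<in> F_ideal A"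
    using F_spanning by (auto simp: span_mod_def)
  have "lin (coord_change A) (lin F_basis v) = lin (coord_change A) f - lin (coord_change A) (f - lin F_basis v)"
    by (simp add: ahom_simps[OF ahom_coord_change])
  also have "\<dots> \<in> U_ideal h_par"
    using f coord_change_F_ideal[OF c2 v] by (rule cideal_diff[OF cideal_U])
  finally have "v = 0"
    by (rule F_independent[OF c])
  then show ?thesis
    using v slinear_0[OF slinear_lin[of F_basis]] by simp
qed

section \<open>Inverting the formal parameter\<close>

text \<open>Sign convention: \<open>lfrac k g\<close> is \<open>\<epsilon>^(-k) g\<close>, so a
  positive k is a denominator.\<close>

abbreviation lfrac :: "int \<Rightarrow> 'a::zero fps \<Rightarrow> 'a fls" where
  "lfrac k g \<equiv> fls_shift k (fps_to_fls g)"

lemma fps_to_fls_X_power_mult: "fps_to_fls (fps_X ^ n * g) = fls_shift (- int n) (fps_to_fls g)"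
  for g :: "'a::ring_1 fps"
  by (simp add: fls_times_fps_to_fls fps_to_fls_power fls_X_power_conv_shift_1 fls_shifted_times_simps)

lemma lfrac_X_power: "lfrac k g = lfrac (k + int n) (fps_X ^ n * g)"
  for g :: "'a::ring_1 fps"
  by (simp add: fps_to_fls_X_power_mult)

lemma lfrac_mult: "lfrac k f * lfrac l g = lfrac (k + l) (f * g)"
  for f g :: "'a::ring_1 fps"
  by (simp add: fls_times_both_shifted_simp fls_times_fps_to_fls)

lemma lfrac_exists: "\<exists>k. \<forall>n\<ge>k. \<exists>f. F = lfrac (int n) f"
proof (rule exI[of _ "nat (- fls_subdegree F)"], intro allI impI)
  fix n
  assume n: "n \<ge> nat (- fls_subdegree F)"
  have "fls_subdegree (fls_shift (- int n) F) \<ge> 0"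
    by (rule fls_subdegree_ge0I) (use n in auto)
  then have "F = lfrac (int n) (fls_regpart (fls_shift (- int n) F))"
    by (simp only: fls_regpart_to_fls_trivial) simp
  then show "\<exists>f. F = lfrac (int n) f" ..
qed

lemma lfrac_cases:
  obtains n f where "F = lfrac (int n) f"
  using lfrac_exists[of F] by blast

lemma lfrac_cases2:
  obtains n f g where "F = lfrac (int n) f" "G = lfrac (int n) g"
proof -
  obtain k l where "\<forall>n\<ge>k. \<exists>f. F = lfrac (int n) f" "\<forall>n\<ge>l. \<exists>f. G = lfrac (int n) f"
    using lfrac_exists[of F] lfrac_exists[of G] by blast
  then have "\<exists>f. F = lfrac (int (max k l)) f" "\<exists>g. G = lfrac (int (max k l)) g"
    by simp_all
  with that show thesis by blast
qed

lemma lfrac_base_factor: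
  assumes "g \<noteq> (0 :: 'a::ring_1 fps)"
  obtains u d where "g = fps_X ^ d * u" "fls_base_factor_to_fps (lfrac k g) = u" "fls_subdegree (lfrac k g) = int d - k"
proof
  let ?d = "subdegree g" and ?u = "fps_shift (subdegree g) g"
  show g: "g = fps_X ^ ?d * ?u"
    by (rule fps_ext) (auto simp: fps_X_power_mult_nth)
  show sub: "fls_subdegree (lfrac k g) = int ?d - k"
    using assms by (simp add: fls_subdegree_fls_to_fps)
  show "fls_base_factor_to_fps (lfrac k g) = ?u"
    by (rule fps_ext) (use sub in \<open>simp add: fls_subdegree_fls_to_fps add.commute nat_add_distrib\<close>)
qed

text \<open>Commuting with \<epsilon> makes \<open>loc_map T\<close> independent of how a Laurent
  series is split into a power of \<epsilon> and a power series. Unlike \<open>slinear\<close>, this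
  also covers \<open>scal\<close>, whose domain is \<open>real fps\<close>.\<close>

definition X_linear :: "('a::ring_1 fps \<Rightarrow> 'b::ring_1 fps) \<Rightarrow> bool" where
  "X_linear T \<longleftrightarrow> T 0 = 0 \<and> (\<forall>f. T (fps_X * f) = fps_X * T f)"

lemma X_linear_power: "X_linear T \<Longrightarrow> T (fps_X ^ n * f) = fps_X ^ n * T f"
  by (induction n) (simp_all add: X_linear_def mult.assoc)

lemma loc_map_lfrac:
  assumes T: "X_linear T"
  shows "loc_map T (lfrac k g) = lfrac k (T g)"
proof (cases "g = 0")
  case True
  then show ?thesis
    using T by (simp add: loc_map_def X_linear_def)
next
  case False
  then obtain u d where u: "g = fps_X ^ d * u" "fls_base_factor_to_fps (lfrac k g) = u"
    "fls_subdegree (lfrac k g) = int d - k"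
    by (rule lfrac_base_factor)
  have "loc_map T (lfrac k g) = lfrac (k - int d) (T u)"
    unfolding loc_map_def u(2,3) by simp
  also have "\<dots> = lfrac k (T g)"
    using lfrac_X_power[of "k - int d" "T u" d] by (simp add: u(1) X_linear_power[OF T])
  finally show ?thesis .
qed

lemma loc_map_fps: "X_linear T \<Longrightarrow> loc_map T (fps_to_fls g) = fps_to_fls (T g)"
  using loc_map_lfrac[of T 0 g] by simp

lemma loc_map_hom:
  assumes X: "X_linear T" and add: "\<And>f g. T (f + g) = T f + T g" and mult: "\<And>f g. T (f * g) = T f * T g"
  shows "loc_map T (F + G) = loc_map T F + loc_map T G" "loc_map T (F * G) = loc_map T F * loc_map T G"
proof -
  obtain n f g where [simp]: "F = lfrac (int n) f" "G = lfrac (int n) g"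
    by (rule lfrac_cases2)
  have "F + G = lfrac (int n) (f + g)"
    by simp
  then have "loc_map T (F + G) = lfrac (int n) (T f + T g)"
    by (simp only: loc_map_lfrac[OF X] add)
  then show "loc_map T (F + G) = loc_map T F + loc_map T G"
    by (simp add: loc_map_lfrac[OF X])
  show "loc_map T (F * G) = loc_map T F * loc_map T G"
    by (simp add: loc_map_lfrac[OF X] lfrac_mult mult)
qed

lemma X_linear_scal: "X_linear (scal :: real fps \<Rightarrow> 'm::monoid_add alg)"
  by (simp add: X_linear_def scal_mult)

lemma X_linear_slinear:
  assumes "slinear T"
  shows "X_linear T"
proof -
  have "T (scal fps_X * f) = scal fps_X * T f" for f
    using assms by (simp only: slinear_def)
  then show ?thesis
    by (simp add: X_linear_def slinear_0[OF assms])
qed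

lemma lscal_add: "lscal (r + s) = (lscal r + lscal s :: ('m::monoid_add \<Rightarrow>\<^sub>0 real) fls)"
  and lscal_mult: "lscal (r * s) = (lscal r * lscal s :: ('m \<Rightarrow>\<^sub>0 real) fls)"
  unfolding lscal_def by (rule loc_map_hom[OF X_linear_scal]; simp add: scal_add scal_mult)+

lemma lscal_fps: "lscal (fps_to_fls r) = (fps_to_fls (scal r) :: ('m::monoid_add \<Rightarrow>\<^sub>0 real) fls)"
  unfolding lscal_def by (rule loc_map_fps[OF X_linear_scal])

lemma lscal_lfrac: "lscal (lfrac k r) = (lfrac k (scal r) :: ('m::monoid_add \<Rightarrow>\<^sub>0 real) fls)"
  unfolding lscal_def by (rule loc_map_lfrac[OF X_linear_scal])

lemma lscal_1 [simp]: "lscal 1 = (1 :: ('m::monoid_add \<Rightarrow>\<^sub>0 real) fls)"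
  using lscal_fps[of 1, where 'm = 'm] by simp

lemma lscal_commute: "lscal r * F = F * (lscal r :: ('m::monoid_add \<Rightarrow>\<^sub>0 real) fls)"
proof -
  obtain n f where "F = lfrac (int n) f"
    by (rule lfrac_cases)
  moreover obtain m s where "r = lfrac (int m) s"
    by (rule lfrac_cases)
  ultimately show ?thesis
    by (simp add: lscal_lfrac lfrac_mult scal_commute add.commute)
qed

lemma lscal_left_commute: "F * (lscal r * G) = lscal r * (F * (G :: ('m::monoid_add \<Rightarrow>\<^sub>0 real) fls))"
  by (metis lscal_commute mult.assoc)

lemma lscal_lscal_mult: "lscal r * (lscal s * F) = lscal (r * s) * (F :: ('m::monoid_add \<Rightarrow>\<^sub>0 real) fls)"
  by (simp add: lscal_mult mult.assoc)

lemma loc_map_ahom: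
  assumes T: "ahom T"
  shows "loc_map T (F + G) = loc_map T F + loc_map T G" "loc_map T (F * G) = loc_map T F * loc_map T G"
    "loc_map T (lscal r) = lscal r" "loc_map T (fps_to_fls f) = fps_to_fls (T f)" "loc_map T 1 = 1"
proof -
  note X = X_linear_slinear[OF ahom_slinear[OF T]]
  show "loc_map T (F + G) = loc_map T F + loc_map T G" "loc_map T (F * G) = loc_map T F * loc_map T G"
    by (rule loc_map_hom[OF X]; simp add: ahom_simps[OF T])+
  show "loc_map T (fps_to_fls f) = fps_to_fls (T f)" for f
    by (rule loc_map_fps[OF X])
  from this[of 1] show "loc_map T 1 = 1"
    by (simp add: ahom_simps[OF T])
  obtain n s where "r = lfrac (int n) s"
    by (rule lfrac_cases)
  then show "loc_map T (lscal r) = lscal r"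
    by (simp add: lscal_lfrac loc_map_lfrac[OF X] ahom_simps[OF T])
qed

lemma X_power_cideal: "cideal I \<Longrightarrow> f \<in> I \<Longrightarrow> fps_X ^ n * f \<in> I"
  by (rule cideal_lmult)

lemma ideal_loc:
  fixes I :: "'m::monoid_add alg set"
  assumes I: "cideal I"
  shows "ideal (loc I) ring_of_type_algebra"
  unfolding ideal_iff
proof (intro conjI ballI allI)
  have "0 = lfrac 0 (0 :: 'm alg)"
    by simp
  then show "0 \<in> loc I"
    unfolding loc_def using cideal_0[OF I] by blast
  have int: "\<exists>n g. F = lfrac (int n) g \<and> g \<in> I" if F: "F \<in> loc I" for F
  proof -
    obtain k g where g: "F = lfrac k g" "g \<in> I"
      using F by (auto simp: loc_def)
    show ?thesis
    proof (cases "k \<ge> 0")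
      case True
      then show ?thesis
        using g by (intro exI[of _ "nat k"] exI[of _ g]) simp
    next
      case False
      then have "F = lfrac (int 0) (fps_X ^ nat (- k) * g)"
        using lfrac_X_power[of k g "nat (- k)"] by (simp add: g(1))
      then show ?thesis
        using X_power_cideal[OF I g(2)] by blast
    qed
  qed
  fix F G :: "('m \<Rightarrow>\<^sub>0 real) fls"
  assume F: "F \<in> loc I"
  then obtain n f where f: "F = lfrac (int n) f" "f \<in> I"
    using int by blast
  {
    assume "G \<in> loc I"
    then obtain m g where g: "G = lfrac (int m) g" "g \<in> I"
      using int by blast
    have "F + G = lfrac (int n + int m) (fps_X ^ m * f + fps_X ^ n * g)"
      using lfrac_X_power[of "int n" f m] lfrac_X_power[of "int m" g n] by (simp add: f g add.commute)
    moreover have "fps_X ^ m * f + fps_X ^ n * g \<in> I"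
      using f g by (intro cideal_add[OF I] X_power_cideal[OF I])
    ultimately show "F + G \<in> loc I"
      unfolding loc_def by blast
  }
  fix r :: "('m \<Rightarrow>\<^sub>0 real) fls"
  obtain m g where g: "r = lfrac (int m) g"
    by (rule lfrac_cases)
  have "r * F = lfrac (int m + int n) (g * f)" "F * r = lfrac (int n + int m) (f * g)"
    by (simp_all only: f g lfrac_mult)
  then show "r * F \<in> loc I" "F * r \<in> loc I"
    unfolding loc_def using cideal_lmult[OF I f(2)] cideal_rmult[OF I f(2)] by blast+
qed

lemma fps_in_loc: "f \<in> I \<Longrightarrow> fps_to_fls f \<in> loc I"
  unfolding loc_def by (metis (mono_tags, lifting) fls_shift_0 mem_Collect_eq)

lemma lscal_in_loc: "cideal I \<Longrightarrow> f \<in> I \<Longrightarrow> lscal r * fps_to_fls f \<in> loc I"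
  by (rule ideal_lmult[OF ideal_loc fps_in_loc])

text \<open>Clearing denominators leaves a power of \<epsilon> times f in I, and torsion-freeness
  removes that power; so localizing adds no power series to I.\<close>

lemma loc_torsion_free:
  assumes I: "cideal I" and tf: "\<And>f. scal fps_X * f \<in> I \<Longrightarrow> f \<in> I" and F: "lfrac k f \<in> loc I"
  shows "f \<in> (I :: 'm::monoid_add alg set)"
proof -
  have tfn: "f \<in> I" if "fps_X ^ n * f \<in> I" for n f
    using that
  proof (induction n)
    case (Suc n)
    then show ?case
      using tf[of "fps_X ^ n * f"] by (simp add: mult.assoc)
  qed simp
  obtain l g where g: "g \<in> I" "lfrac k f = lfrac l g"
    using F by (auto simp: loc_def)
  show ?thesis
  proof (cases "k \<le> l")
    case True
    then have "lfrac k f = lfrac l (fps_X ^ nat (l - k) * f)"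
      using lfrac_X_power[of k f "nat (l - k)"] by simp
    then have "fps_X ^ nat (l - k) * f = g"
      using g(2) by (simp only: fls_shift_eq_iff fps_to_fls_eq_iff)
    with g(1) show ?thesis
      using tfn by blast
  next
    case False
    then have "lfrac l g = lfrac k (fps_X ^ nat (k - l) * g)"
      using lfrac_X_power[of l g "nat (k - l)"] by simp
    then have eq: "f = fps_X ^ nat (k - l) * g"
      using g(2) by (simp only: fls_shift_eq_iff fps_to_fls_eq_iff)
    show ?thesis
      unfolding eq using I g(1) by (rule X_power_cideal)
  qed
qed

lemma descends_loc:
  assumes T: "ahom T" and I: "cideal I" and K: "cideal K" and into: "\<And>f. f \<in> I \<Longrightarrow> T f \<in> K"
  shows "descends (loc I) (loc K) (loc_map T)"
proof (rule descendsI[OF ideal_loc[OF I] ideal_loc[OF K]])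
  fix F
  assume "F \<in> loc I"
  then obtain k f where "F = lfrac k f" "f \<in> I"
    by (auto simp: loc_def)
  then show "loc_map T F \<in> loc K"
    using into by (auto simp: loc_map_lfrac[OF X_linear_slinear[OF ahom_slinear[OF T]]] loc_def)
qed (simp_all add: loc_map_ahom[OF T])

lemma ltens_lfrac: "lfrac k f \<boxtimes>\<^sub>l lfrac l g = lfrac (k + l) (f \<boxtimes> g)"
  for f :: "'m::monoid_add alg" and g :: "'k::monoid_add alg"
proof (cases "f = 0 \<or> g = 0")
  case True
  then show ?thesis
    by (auto simp: ltens_def)
next
  case False
  obtain u d where u: "f = fps_X ^ d * u" "fls_base_factor_to_fps (lfrac k f) = u" "fls_subdegree (lfrac k f) = int d - k"
    using False lfrac_base_factor[of f k] by blast
  obtain w e where w: "g = fps_X ^ e * w" "fls_base_factor_to_fps (lfrac l g) = w" "fls_subdegree (lfrac l g) = int e - l"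
    using False lfrac_base_factor[of g l] by blast
  have "f \<boxtimes> g = fps_X ^ (d + e) * (u \<boxtimes> w)"
    unfolding u(1) w(1) using tens_scal_left[of "fps_X ^ d" u "fps_X ^ e * w"] tens_scal_right[of u "fps_X ^ e" w]
    by (simp add: scal_power power_add mult.assoc)
  then have "lfrac (k + l) (f \<boxtimes> g) = lfrac (k - int d + (l - int e)) (u \<boxtimes> w)"
    using lfrac_X_power[of "k - int d + (l - int e)" "u \<boxtimes> w" "d + e"] by (simp add: algebra_simps)
  then show ?thesis
    unfolding ltens_def u(2,3) w(2,3) by (simp add: algebra_simps)
qed

lemma ltens_fps: "fps_to_fls f \<boxtimes>\<^sub>l fps_to_fls g = fps_to_fls (f \<boxtimes> g)"
  for f :: "'m::monoid_add alg" and g :: "'k::monoid_add alg"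
  using ltens_lfrac[of 0 f 0 g] by simp

lemma ltens_lscal:
  "(lscal r * fps_to_fls f) \<boxtimes>\<^sub>l fps_to_fls g = lscal r * fps_to_fls (f \<boxtimes> g)"
  "fps_to_fls f \<boxtimes>\<^sub>l (lscal r * fps_to_fls g) = lscal r * fps_to_fls (f \<boxtimes> g)"
  for f :: "'m::monoid_add alg" and g :: "'k::monoid_add alg"
proof -
  obtain n s where r: "r = lfrac (int n) s"
    by (rule lfrac_cases)
  have *: "lscal r * fps_to_fls h = lfrac (int n) (scal s * h)" for h :: "'x::monoid_add alg"
    using lfrac_mult[of "int n" "scal s" 0 h] by (simp add: r lscal_lfrac)
  show "(lscal r * fps_to_fls f) \<boxtimes>\<^sub>l fps_to_fls g = lscal r * fps_to_fls (f \<boxtimes> g)"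
    using ltens_lfrac[of "int n" "scal s * f" 0 g] by (simp add: * tens_scal_left)
  show "fps_to_fls f \<boxtimes>\<^sub>l (lscal r * fps_to_fls g) = lscal r * fps_to_fls (f \<boxtimes> g)"
    using ltens_lfrac[of 0 f "int n" "scal s * g"] by (simp add: * tens_scal_right)
qed

section \<open>Closures of ideals of Laurent series\<close>

lemma closure_fls_iff:
  "F \<in> closure S \<longleftrightarrow> (\<forall>N::nat. \<exists>G\<in>S. \<forall>n<int N. fls_nth F n = fls_nth (G :: 'a::ab_group_add fls) n)"
proof safe
  fix N :: nat
  assume "F \<in> closure S"
  then obtain G where G: "G \<in> S" "dist G F < inverse (2 ^ N)"
    unfolding closure_approachable by (meson inverse_positive_iff_positive zero_less_numeral zero_less_power)
  have "fls_nth F n = fls_nth G n" if "n < int N" for n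
  proof (cases "G = F")
    case False
    have "inverse (2 ^ N) \<le> (1 :: real)"
      by (simp add: inverse_le_1_iff)
    \<comment> \<open>A difference with a pole has distance at least 1, so a small distance first
      forces the difference to be a power series.\<close>
    have "0 \<le> fls_subdegree (G - F)"
    proof (rule ccontr)
      assume "\<not> 0 \<le> fls_subdegree (G - F)"
      then have "dist G F = 2 ^ nat (- fls_subdegree (G - F))"
        using False by (simp add: dist_fls_def)
      moreover have "(1 :: real) \<le> 2 ^ nat (- fls_subdegree (G - F))"
        by simp
      ultimately show False
        using G(2) \<open>inverse (2 ^ N) \<le> (1 :: real)\<close> by linarith
    qed
    then have "N < nat (fls_subdegree (G - F))"
      using G(2) False by (simp add: dist_fls_def)
    then have "fls_nth (G - F) n = 0"
      using that by (intro fls_eq0_below_subdegree) simp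
    then show ?thesis by simp
  qed simp
  then show "\<exists>G\<in>S. \<forall>n<int N. fls_nth F n = fls_nth G n"
    using G(1) by blast
next
  assume *: "\<forall>N::nat. \<exists>G\<in>S. \<forall>n<int N. fls_nth F n = fls_nth G n"
  show "F \<in> closure S"
    unfolding closure_approachable
  proof safe
    fix e :: real
    assume "e > 0"
    then obtain N where "(1 / 2) ^ N < e"
      using real_arch_pow_inv[of e "1 / 2"] by force
    then have N: "inverse (2 ^ N) < e"
      by (simp add: power_one_over inverse_eq_divide)
    obtain G where G: "G \<in> S" "\<forall>n<int N. fls_nth F n = fls_nth G n"
      using * by blast
    have "dist G F \<le> inverse (2 ^ N)"
    proof (cases "G = F")
      case False
      then have "int N \<le> fls_subdegree (G - F)"
        using G(2) by (intro fls_subdegree_geI) auto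
      then have "0 \<le> fls_subdegree (G - F)" "N \<le> nat (fls_subdegree (G - F))"
        by linarith+
      then show ?thesis
        using False by (simp add: dist_fls_def)
    qed simp
    with N G(1) show "\<exists>y\<in>S. dist y F < e"
      by force
  qed
qed

text \<open>An approximant in \<open>loc I\<close> that agrees with \<open>\<epsilon>^(-k) f\<close>
  in all degrees below N has no worse pole; multiplied by \<open>\<epsilon>^k\<close> it is a power
  series, and it lies in I by torsion-freeness.\<close>

lemma closure_loc:
  assumes I: "cideal I" and tf: "\<And>f. scal fps_X * f \<in> I \<Longrightarrow> f \<in> I"
  shows "closure (loc I) = loc I"
proof
  show "loc I \<subseteq> closure (loc I)"
    by (rule closure_subset)
  show "closure (loc I) \<subseteq> loc I"
  proof
    fix F
    assume F: "F \<in> closure (loc I)"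
    obtain k f where f: "F = lfrac (int k) f"
      by (rule lfrac_cases)
    have "f \<in> I"
    proof (rule cideal_lim[OF I])
      fix N
      obtain G where G: "G \<in> loc I" "\<forall>n<int N. fls_nth F n = fls_nth G n"
        using F unfolding closure_fls_iff by blast
      then obtain l g where g: "G = lfrac l g" "g \<in> I"
        by (auto simp: loc_def)
      let ?G = "fls_shift (- int k) G"
      have nth: "fls_nth ?G n = fls_nth (fps_to_fls f) n" if "n < int N + int k" for n
      proof -
        have "fls_nth F (n - int k) = fls_nth G (n - int k)"
          using G(2) that by simp
        then show ?thesis
          by (simp add: f)
      qed
      have "fls_subdegree ?G \<ge> 0"
        by (rule fls_subdegree_ge0I) (simp add: nth del: fls_shift_nth)
      then have G': "fps_to_fls (fls_regpart ?G) = ?G"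
        by (rule fls_regpart_to_fls_trivial)
      moreover have "?G \<in> loc I"
        using g by (auto simp: loc_def)
      ultimately have "lfrac 0 (fls_regpart ?G) \<in> loc I"
        by simp
      then have "fls_regpart ?G \<in> I"
        using loc_torsion_free[OF I, of 0 "fls_regpart ?G"] tf by blast
      moreover have "\<forall>n<N. fps_nth f n = fps_nth (fls_regpart ?G) n"
        by (simp add: nth del: fls_shift_nth)
      ultimately show "\<exists>g\<in>I. \<forall>n<N. fps_nth f n = fps_nth g n"
        by blast
    qed
    then show "F \<in> loc I"
      unfolding f loc_def by blast
  qed
qed

section \<open>The rescaling constant\<close>

lemma rescaling_square:
  assumes A: "fps_nth A 0 = 4"
  shows "(rescaling A)\<^sup>2 = 2 * fps_X * (A oo fps_X\<^sup>2) * fsinh h_par" "rescaling A \<noteq> 0"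
proof -
  let ?f = "2 * fps_X * (A oo fps_X\<^sup>2) * fsinh h_par"
  define w where "w = fps_shift 1 (fsinh h_par)"
  define u where "u = 2 * (A oo fps_X\<^sup>2) * w"
  have w: "fsinh h_par = fps_X * w"
    using fsinh_nonzero(1)[OF h_par_nth] by (intro fps_ext) (simp add: w_def)
  have w0: "fps_nth w 0 = 2"
    by (simp add: w_def fsinh_def fexp_nth h_par_def)
  \<comment> \<open>The value is \<open>2 * 4 * 2\<close>, from \<open>A(0) = 4\<close> and the
    leading coefficient 2 of sinh(2 \<epsilon>). Being positive, it admits a real square root series
    with constant term 4.\<close>
  have u0: "fps_nth u 0 = 16"
    by (simp add: u_def w0 A fps_mult_nth_0 fps_compose_nth_0)
  have f: "?f = fps_X\<^sup>2 * u"
    by (simp add: w u_def power2_eq_square mult_ac)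
  define s where "s = fps_radical (\<lambda>n x. root n x) 2 u"
  have "root 2 16 = (4 :: real)"
    by (rule real_root_pos_unique) simp_all
  then have s2: "s\<^sup>2 = u" and s0: "fps_nth s 0 = 4"
    using power_radical[of u "\<lambda>n x. root n x" 1] by (simp_all add: s_def u0 numeral_2_eq_2)
  define g where "g = fps_X * s"
  have g2: "g\<^sup>2 = ?f"
    by (simp add: g_def f s2 power_mult_distrib)
  have "subdegree g = 1"
    by (intro subdegreeI) (simp_all add: g_def s0)
  then have g_pos: "0 < fps_nth g (subdegree g)"
    by (simp add: g_def s0)
  have "rescaling A = g"
    unfolding rescaling_def fps_sqrt_def
  proof (rule the_equality)
    show "g\<^sup>2 = ?f \<and> 0 < fps_nth g (subdegree g)"
      using g2 g_pos by simp
    fix y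
    assume y: "y\<^sup>2 = ?f \<and> 0 < fps_nth y (subdegree y)"
    \<comment> \<open>Real power series have no zero divisors, so only the sign is open, and the
      positivity demanded in \<open>fps_sqrt\<close> decides it.\<close>
    then have "y = g \<or> y = - g"
      using g2 by (metis power2_eq_iff)
    moreover have False if "y = - g"
      using y g_pos that by simp
    ultimately show "y = g" by blast
  qed
  then show "(rescaling A)\<^sup>2 = ?f" "rescaling A \<noteq> 0"
    using g2 g_pos by auto
qed

section \<open>The new coordinates\<close>

lemma new_coord_1: "new_coord A 1 = lscal (inverse (fps_to_fls fps_X)) * fps_to_fls (genx 1)"
  and new_coord_23: "j \<in> {2, 3} \<Longrightarrow> new_coord A j = lscal (inverse (fps_to_fls (rescaling A))) * fps_to_fls (genx j)"
  by (auto simp: new_coord_def)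

lemma commutator_lscal:
  "commutator (lscal r * F) G = lscal r * commutator F (G :: ('m::monoid_add \<Rightarrow>\<^sub>0 real) fls)"
  "commutator F (lscal r * G) = lscal r * commutator F G"
  by (simp_all add: commutator_def right_diff_distrib mult.assoc lscal_left_commute[of F] lscal_left_commute[of G])

lemma commutator_fps_to_fls: "commutator (fps_to_fls f) (fps_to_fls g) = fps_to_fls (commutator f g)"
  for f g :: "'a::ring_1 fps"
  by (simp add: commutator_def fls_times_fps_to_fls)

lemma cls_loc_eqI:
  assumes I: "cideal I" and eq: "F - G = lscal r * fps_to_fls f" and f: "f \<in> I"
  shows "cls (loc I) F = cls (loc I) G"
  unfolding cls_eq_iff[OF ideal_loc[OF I]] eq using I f by (rule lscal_in_loc)

lemma coord_relations:
  fixes A :: "real fps"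
  defines "IL \<equiv> loc (F_ideal A)"
    and "z1 \<equiv> new_coord A 1" and "z2 \<equiv> new_coord A 2" and "z3 \<equiv> new_coord A 3"
    and "e \<equiv> fps_to_fls (expx 1)" and "e' \<equiv> fps_to_fls (expx (- 1))"
    and "eh \<equiv> lscal (fps_to_fls (fexp h_par))" and "eh' \<equiv> lscal (fps_to_fls (fexp (- h_par)))"
  assumes c: "rescaling A \<noteq> 0" and c2: "(rescaling A)\<^sup>2 = 2 * fps_X * (A oo fps_X\<^sup>2) * fsinh h_par"
  shows "cls IL (commutator z1 z2) = cls IL (2 * z2)"
    "cls IL (commutator z1 z3) = cls IL (- 2 * z3)"
    "cls IL (commutator z2 z3) =
      cls IL (lscal (inverse (fps_to_fls (fsinh h_par))) * (lscal (fls_const (1 / 2)) * (e * e - e' * e')))"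
    "cls IL (e * z2) = cls IL (eh * z2 * e)" "cls IL (e' * z2) = cls IL (eh' * z2 * e')"
    "cls IL (e * z3) = cls IL (eh' * z3 * e)" "cls IL (e' * z3) = cls IL (eh * z3 * e')"
    "cls IL (commutator z1 e) = cls IL 0" "cls IL (commutator z1 e') = cls IL 0"
proof -
  note I = cideal_F[of A] and R = F_rels[where A = A]
  \<comment> \<open>x and w are the reciprocals of the two rescaling factors; each relation is
    multiplied by the reciprocals belonging to the coordinates in it.\<close>
  define x where "x = inverse (fps_to_fls fps_X :: real fls)"
  define w where "w = inverse (fps_to_fls (rescaling A))"
  have xX: "x * fps_to_fls fps_X = 1" and wc: "w * fps_to_fls (rescaling A) = 1"
    using c by (simp_all add: x_def w_def)
  have z: "z1 = lscal x * fps_to_fls (genx 1)" "z2 = lscal w * fps_to_fls (genx 2)"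
    "z3 = lscal w * fps_to_fls (genx 3)"
    by (simp_all add: z1_def z2_def z3_def x_def w_def new_coord_1 new_coord_23)
  have two: "lscal (x * w) * fps_to_fls (scal (2 * fps_X) * f) = 2 * (lscal w * fps_to_fls f)" for f :: "xword alg"
  proof -
    have "lscal (x * w) * fps_to_fls (scal (2 * fps_X) * f) =
        lscal (x * w * fps_to_fls (2 * fps_X)) * fps_to_fls f"
      by (simp only: fls_times_fps_to_fls lscal_fps[symmetric] lscal_lscal_mult)
    also have "x * w * fps_to_fls (2 * fps_X) = w * 2"
    proof -
      have "x * w * fps_to_fls (2 * fps_X) = (x * fps_to_fls fps_X) * (w * 2)"
        by (simp only: fls_times_fps_to_fls fps_to_fls_numeral mult_ac)
      then show ?thesis
        by (simp only: xX mult_1)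
    qed
    also have "lscal (w * 2) = (2 * lscal w :: (xword \<Rightarrow>\<^sub>0 real) fls)"
      by (simp only: lscal_add mult_2 mult_2_right)
    finally show ?thesis
      by (simp add: mult.assoc)
  qed
  show "cls IL (commutator z1 z2) = cls IL (2 * z2)"
    unfolding IL_def
    by (rule cls_loc_eqI[OF I _ R(1), where r = "x * w"])
      (simp only: z commutator_lscal lscal_lscal_mult mult.commute[of w x] commutator_fps_to_fls fps_to_fls_minus right_diff_distrib two)
  show "cls IL (commutator z1 z3) = cls IL (- 2 * z3)"
    unfolding IL_def
    by (rule cls_loc_eqI[OF I _ R(2), where r = "x * w"])
      (simp only: z commutator_lscal lscal_lscal_mult mult.commute[of w x] commutator_fps_to_fls fps_to_fls_minus right_diff_distrib
        scal_uminus mult_minus_left fps_to_fls_uminus mult_minus_right two)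
  show "cls IL (commutator z2 z3) =
      cls IL (lscal (inverse (fps_to_fls (fsinh h_par))) * (lscal (fls_const (1 / 2)) * (e * e - e' * e')))"
  proof -
    let ?k = "2 * fps_X * (A oo fps_X\<^sup>2)" and ?s = "fps_to_fls (fsinh h_par)"
    have s: "lscal (fls_const (1 / 2)) * (e * e - e' * e') = fps_to_fls sinh2X"
      unfolding e_def e'_def sinh2X_def using lscal_fps[of "fps_const (1 / 2)", where 'm = xword]
      by (simp add: fls_times_fps_to_fls)
    have s0: "?s \<noteq> 0"
      using fsinh_nonzero(3)[OF h_par_nth] by simp
    \<comment> \<open>This is the reason for the choice of the rescaling: its square is the
      structure constant times sinh(h), so dividing twice leaves \<open>1 / sinh(h)\<close>.\<close>
    have "fps_to_fls (rescaling A) * fps_to_fls (rescaling A) = fps_to_fls ?k * ?s"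
      using c2 by (simp only: power2_eq_square flip: fls_times_fps_to_fls)
    then have "(w * fps_to_fls (rescaling A)) * (w * fps_to_fls (rescaling A)) = w * w * fps_to_fls ?k * ?s"
      by (simp only: mult_ac)
    then have "w * w * fps_to_fls ?k * ?s = 1"
      by (simp only: wc mult_1)
    then have "w * w * fps_to_fls ?k = inverse ?s"
      using s0 by (simp add: field_simps)
    then have "lscal (w * w) * fps_to_fls (scal ?k * sinh2X) = lscal (inverse ?s) * fps_to_fls sinh2X"
      by (simp only: fls_times_fps_to_fls lscal_fps[symmetric] lscal_lscal_mult)
    then show ?thesis
      unfolding IL_def s
      by (intro cls_loc_eqI[OF I _ R(3), where r = "w * w"])
        (simp only: z commutator_lscal lscal_lscal_mult mult.commute[of w x] commutator_fps_to_fls fps_to_fls_minus right_diff_distrib)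
  qed
  have q: "cls IL (fps_to_fls g * (lscal w * fps_to_fls y)) = cls IL (lscal (fps_to_fls t) * (lscal w * fps_to_fls y) * fps_to_fls g)"
    if "g * y - scal t * y * g \<in> F_ideal A" for g y t
    unfolding IL_def
    by (rule cls_loc_eqI[OF I _ that, where r = w])
      (simp only: fps_to_fls_minus right_diff_distrib fls_times_fps_to_fls lscal_left_commute[of "fps_to_fls _"]
        lscal_fps[symmetric] mult.assoc lscal_lscal_mult mult.commute[of w])
  show "cls IL (e * z2) = cls IL (eh * z2 * e)" "cls IL (e' * z2) = cls IL (eh' * z2 * e')"
    "cls IL (e * z3) = cls IL (eh' * z3 * e)" "cls IL (e' * z3) = cls IL (eh * z3 * e')"
    unfolding z e_def e'_def eh_def eh'_def h_par_def by (rule q, rule R)+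
  show "cls IL (commutator z1 e) = cls IL 0" "cls IL (commutator z1 e') = cls IL 0"
    unfolding IL_def e_def e'_def
    by (rule cls_loc_eqI[OF I _ R(8), where r = x] cls_loc_eqI[OF I _ R(9), where r = x],
        simp only: z commutator_lscal lscal_lscal_mult mult.commute[of w x] commutator_fps_to_fls diff_zero)+
qed

lemma coord_coproduct:
  fixes A :: "real fps"
  defines "IL \<equiv> loc (F_ideal A)" and "I2L \<equiv> loc (tker (F_ideal A) (F_ideal A))"
    and "e \<equiv> fps_to_fls (expx 1)" and "e' \<equiv> fps_to_fls (expx (- 1))"
  defines "\<Delta> \<equiv> induced I2L (loc_map (lin F_cop))"
  shows "descends IL I2L (loc_map (lin F_cop))"
    "\<Delta> (cls IL (new_coord A 1)) = cls I2L (1 \<boxtimes>\<^sub>l new_coord A 1 + new_coord A 1 \<boxtimes>\<^sub>l 1)"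
    "j \<in> {2, 3} \<Longrightarrow> \<Delta> (cls IL (new_coord A j)) = cls I2L (new_coord A j \<boxtimes>\<^sub>l e' + e \<boxtimes>\<^sub>l new_coord A j)"
    "\<Delta> (cls IL e) = cls I2L (e \<boxtimes>\<^sub>l e)" "\<Delta> (cls IL e') = cls I2L (e' \<boxtimes>\<^sub>l e')"
proof -
  have into: "lin F_cop f \<in> tker (F_ideal A) (F_ideal A)" if "f \<in> F_ideal A" for f
    using that unfolding F_ideal_def[of A]
    by (rule closed_ideal_image[OF ahom_F_cop cideal_tker F_cop_rel[unfolded F_ideal_def], rotated])
  show D: "descends IL I2L (loc_map (lin F_cop))"
    unfolding IL_def I2L_def using into by (intro descends_loc ahom_F_cop cideal_F cideal_tker)
  have one: "1 = fps_to_fls (1 :: xword alg)"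
    by simp
  note simps = descends_cls[OF D] loc_map_ahom[OF ahom_F_cop] lin_F_cop ltens_fps ltens_lscal
  show "\<Delta> (cls IL (new_coord A 1)) = cls I2L (1 \<boxtimes>\<^sub>l new_coord A 1 + new_coord A 1 \<boxtimes>\<^sub>l 1)"
    unfolding \<Delta>_def one by (simp only: new_coord_1 simps fps_to_fls_plus distrib_left)
  show "\<Delta> (cls IL (new_coord A j)) = cls I2L (new_coord A j \<boxtimes>\<^sub>l e' + e \<boxtimes>\<^sub>l new_coord A j)" if "j \<in> {2, 3}"
    unfolding \<Delta>_def e_def e'_def by (simp only: new_coord_23[OF that] simps lin_F_cop(2)[OF that] fps_to_fls_plus distrib_left)
  show "\<Delta> (cls IL e) = cls I2L (e \<boxtimes>\<^sub>l e)" "\<Delta> (cls IL e') = cls I2L (e' \<boxtimes>\<^sub>l e')"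
    unfolding \<Delta>_def e_def e'_def by (simp_all only: simps)
qed

lemma loc_map_new_coord:
  assumes c: "rescaling A \<noteq> 0"
  shows "loc_map (lin (coord_change A)) (new_coord A i) = fps_to_fls (genz i)"
proof -
  note simps = loc_map_ahom[OF ahom_coord_change] lin_coord_change lin_coord_change_genx
    fls_times_fps_to_fls lscal_fps[symmetric] lscal_lscal_mult
  have inv: "inverse (fps_to_fls (rescaling A)) * fps_to_fls (rescaling A) = 1"
    "inverse (fps_to_fls fps_X) * fps_to_fls fps_X = (1 :: real fls)"
    using c by simp_all
  show ?thesis
    using exhaust_3[of i]
    by (elim disjE) (simp_all only: new_coord_1 new_coord_23 insertI1 insertI2 simps inv lscal_1 mult_1_left)
qed

text \<open>Every z_i is hit once division by \<epsilon> and by \<open>rescaling A\<close> is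
  allowed, hence so is every finite combination of words; the remainder can be pushed to any order
  N.\<close>

lemma coord_change_dense:
  assumes c: "rescaling A \<noteq> 0"
  shows "\<exists>F v. u = loc_map (lin (coord_change A)) F + fps_to_fls (scal (fps_X ^ N) * v)"
proof -
  let ?T = "loc_map (lin (coord_change A))"
  note hom = loc_map_ahom[OF ahom_coord_change[of A]]
  have add: "F + G \<in> range ?T" if "F \<in> range ?T" "G \<in> range ?T" for F G
    using that by (auto simp flip: hom(1))
  have mult: "F * G \<in> range ?T" if "F \<in> range ?T" "G \<in> range ?T" for F G
    using that by (auto simp flip: hom(2))
  have lscal: "lscal r \<in> range ?T" for r
    using hom(3)[of r] by (metis rangeI)
  have genz: "fps_to_fls (genz i) \<in> range ?T" for i
    using loc_map_new_coord[OF c, of i] by (metis rangeI)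
  have one: "1 \<in> range ?T"
    using hom(5) by (metis rangeI)
  have zero: "0 \<in> range ?T"
    using hom(4)[of 0] ahom_simps(5)[OF ahom_coord_change[of A]] by (metis fps_zero_to_fls rangeI)
  have word: "fps_to_fls (mon (ZW l)) \<in> range ?T" for l
  proof (induction l)
    case Nil
    show ?case using one by (simp add: mon_Nil)
  next
    case (Cons i l)
    have "mon (ZW (i # l)) = genz i * mon (ZW l)"
      by (simp add: genz_def mon_mult)
    then show ?case
      using mult[OF genz Cons] by (simp add: fls_times_fps_to_fls)
  qed
  have const: "fps_to_fls (fps_const p) \<in> range ?T" for p :: "zword \<Rightarrow>\<^sub>0 real"
  proof -
    have sum: "fps_to_fls (sum f S) \<in> range ?T" if "\<And>m. m \<in> S \<Longrightarrow> fps_to_fls (f m) \<in> range ?T"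
      for f :: "zword \<Rightarrow> zword alg" and S
      using that by (induction S rule: infinite_finite_induct) (simp_all add: zero add)
    have "fps_to_fls (scal r * mon m) \<in> range ?T" for r m
      using mult[OF lscal word] by (cases m) (simp add: fls_times_fps_to_fls lscal_fps[symmetric])
    then show ?thesis
      unfolding const_expand[of p] by (intro sum)
  qed
  have approx: "\<exists>F v. F \<in> range ?T \<and> fps_to_fls g = F + fps_to_fls (scal (fps_X ^ M) * v)" for g :: "zword alg" and M
  proof (induction M)
    case 0
    show ?case
      using zero by (intro exI[of _ 0] exI[of _ g]) simp
  next
    case (Suc M)
    then obtain F v where F: "F \<in> range ?T" "fps_to_fls g = F + fps_to_fls (scal (fps_X ^ M) * v)"
      by blast
    have "fps_to_fls (scal (fps_X ^ M) * v) = fps_to_fls (scal (fps_X ^ M) * (fps_const (fps_nth v 0) + scal fps_X * fps_shift 1 v))"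
      using fps_conv_const_shift[of v] by simp
    also have "\<dots> = lscal (fps_to_fls (fps_X ^ M)) * fps_to_fls (fps_const (fps_nth v 0)) +
        fps_to_fls (scal (fps_X ^ Suc M) * fps_shift 1 v)"
      by (simp only: distrib_left fps_to_fls_plus scal_scal_mult power_Suc mult.commute fls_times_fps_to_fls lscal_fps)
    finally have "fps_to_fls g = (F + lscal (fps_to_fls (fps_X ^ M)) * fps_to_fls (fps_const (fps_nth v 0))) +
        fps_to_fls (scal (fps_X ^ Suc M) * fps_shift 1 v)"
      using F(2) by simp
    then show ?case
      using add[OF F(1) mult[OF lscal const]] by blast
  qed
  obtain k g where u: "u = lfrac (int k) g"
    by (rule lfrac_cases)
  \<comment> \<open>The extra k orders pay for the later division by
    \<open>\<epsilon>^k\<close>.\<close>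
  obtain F v where F: "F \<in> range ?T" "fps_to_fls g = F + fps_to_fls (scal (fps_X ^ (N + k)) * v)"
    using approx by blast
  have shift: "fls_shift (int k) G = lscal (fls_shift (int k) 1) * G" for G :: "(zword \<Rightarrow>\<^sub>0 real) fls"
  proof -
    have "lscal (fls_shift (int k) 1) = (fls_shift (int k) 1 :: (zword \<Rightarrow>\<^sub>0 real) fls)"
      using lscal_lfrac[of "int k" 1, where 'm = zword] by simp
    then show ?thesis
      by (simp add: fls_shifted_times_simps)
  qed
  have "scal (fps_X ^ (N + k)) * v = scal (fps_X ^ k) * (scal (fps_X ^ N) * v)"
    by (simp only: scal_scal_mult power_add mult.commute)
  then have "u = fls_shift (int k) F + lfrac (int k) (fps_X ^ k * (scal (fps_X ^ N) * v))"
    unfolding u F(2) by (simp add: scal_power)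
  also have "lfrac (int k) (fps_X ^ k * (scal (fps_X ^ N) * v)) = fps_to_fls (scal (fps_X ^ N) * v)"
    using lfrac_X_power[of 0 "scal (fps_X ^ N) * v" k] by simp
  finally have u': "u = lscal (fls_shift (int k) 1) * F + fps_to_fls (scal (fps_X ^ N) * v)"
    unfolding shift .
  obtain F' where "lscal (fls_shift (int k) 1) * F = ?T F'"
    using mult[OF lscal F(1)] by blast
  then show ?thesis
    using u' by auto
qed

lemma coord_change_inj:
  assumes c: "rescaling A \<noteq> 0" and c2: "(rescaling A)\<^sup>2 = 2 * fps_X * (A oo fps_X\<^sup>2) * fsinh h_par"
  shows "inj_on (induced (U_ideal h_par) (lin (coord_change A))) (carrier (qring (F_ideal A)))"
    "inj_on (induced (loc (U_ideal h_par)) (loc_map (lin (coord_change A)))) (carrier (qring (loc (F_ideal A))))"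
    "descends (loc (F_ideal A)) (loc (U_ideal h_par)) (loc_map (lin (coord_change A)))"
proof -
  let ?I = "F_ideal A" and ?J = "U_ideal h_par" and ?T = "lin (coord_change A)"
  have D: "descends ?I ?J ?T"
    using ahom_coord_change cideal_F cideal_U coord_change_F_ideal[OF c2] by (rule descends_ahomI)
  show "inj_on (induced ?J ?T) (carrier (qring ?I))"
  proof (rule inj_onI)
    fix C C'
    assume "C \<in> carrier (qring ?I)" "C' \<in> carrier (qring ?I)" and eq: "induced ?J ?T C = induced ?J ?T C'"
    then obtain f g where fg: "C = cls ?I f" "C' = cls ?I g"
      by (auto simp: carrier_qring)
    then have "?T (f - g) \<in> ?J"
      using eq by (simp add: descends_cls[OF D] cls_eq_iff[OF cideal_ideal[OF cideal_U]] ahom_simps[OF ahom_coord_change])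
    then have "f - g \<in> ?I"
      by (rule coord_change_reflects_ideal[OF c c2])
    then show "C = C'"
      by (simp add: fg cls_eq_iff[OF cideal_ideal[OF cideal_F]])
  qed
  show DL: "descends (loc ?I) (loc ?J) (loc_map ?T)"
    by (rule descends_loc[OF ahom_coord_change cideal_F cideal_U coord_change_F_ideal[OF c2]])
  show "inj_on (induced (loc ?J) (loc_map ?T)) (carrier (qring (loc ?I)))"
  proof (rule inj_onI)
    fix C C'
    assume "C \<in> carrier (qring (loc ?I))" "C' \<in> carrier (qring (loc ?I))"
      and eq: "induced (loc ?J) (loc_map ?T) C = induced (loc ?J) (loc_map ?T) C'"
    then obtain F G where FG: "C = cls (loc ?I) F" "C' = cls (loc ?I) G"
      by (auto simp: carrier_qring)
    obtain n f g where fg: "F = lfrac (int n) f" "G = lfrac (int n) g"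
      by (rule lfrac_cases2)
    note frac = loc_map_lfrac[OF X_linear_slinear[OF ahom_slinear[OF ahom_coord_change[of A]]]]
    have "loc_map ?T F - loc_map ?T G \<in> loc ?J"
      using eq unfolding FG by (simp only: descends_cls[OF DL] cls_eq_iff[OF ideal_loc[OF cideal_U]])
    then have "lfrac (int n) (?T (f - g)) \<in> loc ?J"
      by (simp add: fg frac ahom_simps[OF ahom_coord_change])
    then have "?T (f - g) \<in> ?J"
      using loc_torsion_free[OF cideal_U] U_torsion_free by blast
    then have "f - g \<in> ?I"
      by (rule coord_change_reflects_ideal[OF c c2])
    then have "F - G \<in> loc ?I"
      unfolding loc_def fg by (auto intro!: exI[of _ "int n"] exI[of _ "f - g"])
    then show "C = C'"
      by (simp add: FG cls_eq_iff[OF ideal_loc[OF cideal_F]])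
  qed
qed

lemma F_torsion_free:
  assumes c: "rescaling A \<noteq> 0" and c2: "(rescaling A)\<^sup>2 = 2 * fps_X * (A oo fps_X\<^sup>2) * fsinh h_par"
    and f: "scal fps_X * f \<in> F_ideal A"
  shows "f \<in> F_ideal A"
proof -
  have "scal fps_X * lin (coord_change A) f \<in> U_ideal h_par"
    using coord_change_F_ideal[OF c2 f] by (simp only: ahom_simps[OF ahom_coord_change])
  then have "lin (coord_change A) f \<in> U_ideal h_par"
    by (rule U_torsion_free)
  then show ?thesis
    by (rule coord_change_reflects_ideal[OF c c2])
qed

text \<open>Over Laurent series the relations of U_h are scalar multiples of transported relations.
  Closedness of \<open>loc (U_ideal h_par)\<close> gives one inclusion, approximation by the
  uncompleted ideal the other.\<close>

lemma closed_ideal_loc_image: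
  assumes c: "rescaling A \<noteq> 0" and c2: "(rescaling A)\<^sup>2 = 2 * fps_X * (A oo fps_X\<^sup>2) * fsinh h_par"
  shows "closed_ideal (loc_map (lin (coord_change A)) ` loc (F_ideal A)) = loc (U_ideal h_par)"
proof
  let ?T = "lin (coord_change A)"
  let ?S = "loc_map ?T ` loc (F_ideal A)" and ?J = "U_ideal h_par"
  note X = X_linear_slinear[OF ahom_slinear[OF ahom_coord_change[of A]]]
  note R = ring_ring_of_type_algebra
  have "?S \<subseteq> loc ?J"
    using coord_change_F_ideal[OF c2] by (auto simp: loc_def loc_map_lfrac[OF X]) blast
  then have "genideal ring_of_type_algebra ?S \<subseteq> loc ?J"
    using ring.genideal_minimal[OF R ideal_loc[OF cideal_U]] by blast
  then show "closed_ideal ?S \<subseteq> loc ?J"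
    unfolding closed_ideal_def using closure_mono closure_loc[OF cideal_U U_torsion_free] by blast
  let ?H = "genideal ring_of_type_algebra ?S"
  note H = ideal_genideal[of ?S]
  have S_H: "?S \<subseteq> ?H"
    by (rule ring.genideal_self[OF R]) simp
  define rels where "rels = {commutator (genz 1) (genz 2) - 2 * genz 2, commutator (genz 1) (genz 3) + 2 * genz 3,
     commutator (genz 2) (genz 3) - sinh_ratio h_par}"
  \<comment> \<open>The power series inside the ideal generated by the images. It is an ideal of the
    power series algebra, so it suffices to place the relations of U_h in it.\<close>
  define G where "G = {f. fps_to_fls f \<in> ?H}"
  have "ideal G ring_of_type_algebra"
    unfolding ideal_iff G_def
    using ideal_0[OF H] by (auto simp: fls_times_fps_to_fls ideal_add[OF H] ideal_lmult[OF H] ideal_rmult[OF H])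
  moreover have "rels \<subseteq> G"
  proof -
    have gen: "g \<in> G" if rel: "r \<in> F_relations A" and T: "?T r = scal s * g" and s: "s \<noteq> 0" for r s g
    proof -
      have "r \<in> F_ideal A"
        using rel unfolding F_ideal_def by (rule in_closed_ideal)
      then have "loc_map ?T (fps_to_fls r) \<in> ?H"
        using S_H fps_in_loc by blast
      then have "fps_to_fls (scal s * g) \<in> ?H"
        by (simp add: loc_map_fps[OF X] T)
      then have "lscal (inverse (fps_to_fls s)) * fps_to_fls (scal s * g) \<in> ?H"
        by (rule ideal_lmult[OF H])
      moreover have "lscal (inverse (fps_to_fls s)) * fps_to_fls (scal s * g) = fps_to_fls g"
        using s by (simp add: fls_times_fps_to_fls lscal_fps[symmetric] lscal_lscal_mult)
      ultimately show ?thesis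
        by (simp add: G_def)
    qed
    have "commutator (genz 1) (genz 2) - 2 * genz 2 \<in> G"
      by (rule gen[OF _ coord_change_rels(1)]) (use c in \<open>simp_all add: F_relations_def\<close>)
    moreover have "commutator (genz 1) (genz 3) + 2 * genz 3 \<in> G"
      by (rule gen[OF _ coord_change_rels(2)]) (use c in \<open>simp_all add: F_relations_def\<close>)
    moreover have "commutator (genz 2) (genz 3) - sinh_ratio h_par \<in> G"
      by (rule gen[OF _ coord_change_rels(3)[OF c2]]) (use c in \<open>simp_all add: F_relations_def\<close>)
    ultimately show ?thesis
      by (simp add: rels_def)
  qed
  ultimately have gen_G: "genideal ring_of_type_algebra rels \<subseteq> G"
    by (rule ring.genideal_minimal[OF R])
  show "loc ?J \<subseteq> closed_ideal ?S"
  proof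
    fix F
    assume F: "F \<in> loc ?J"
    obtain k f where f: "F = lfrac (int k) f"
      by (rule lfrac_cases)
    have "f \<in> ?J"
      using loc_torsion_free[OF cideal_U, of h_par] U_torsion_free F unfolding f by blast
    then have f_cl: "f \<in> closure (genideal ring_of_type_algebra rels)"
      by (simp add: U_ideal_def rels_def closed_ideal_def)
    show "F \<in> closed_ideal ?S"
      unfolding closed_ideal_def closure_fls_iff
    proof
      fix N
      \<comment> \<open>Agreement in degrees below \<open>N + k\<close> becomes agreement below N
        after division by \<open>\<epsilon>^k\<close>.\<close>
      obtain g where g: "g \<in> genideal ring_of_type_algebra rels" "\<forall>n<N + k. fps_nth f n = fps_nth g n"
        using f_cl unfolding closure_fps_iff by blast
      have "lfrac (int k) 1 * fps_to_fls g \<in> ?H"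
        using g(1) gen_G by (intro ideal_lmult[OF H]) (auto simp: G_def)
      then have "lfrac (int k) g \<in> ?H"
        using lfrac_mult[of "int k" 1 0 g] by simp
      moreover have "\<forall>n<int N. fls_nth F n = fls_nth (lfrac (int k) g) n"
        using g(2) by (auto simp: f)
      ultimately show "\<exists>G\<in>?H. \<forall>n<int N. fls_nth F n = fls_nth G n"
        by blast
    qed
  qed
qed

theorem mainTheorem1:
  fixes a A :: "real fps"
  assumes "is_gauge a" and "is_commutator_series a A"
  shows
    "(let h = h_par; c = rescaling A;
          I = F_ideal A; I2 = tker I I; J = U_ideal h;
          \<Delta>t = lin F_cop; \<Phi> = lin (coord_change A);
          IL = loc I; I2L = loc I2; JL = loc J;
          \<Delta> = induced I2L (loc_map \<Delta>t); \<Psi> = induced JL (loc_map \<Phi>);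
          z1 = new_coord A 1; z2 = new_coord A 2; z3 = new_coord A 3;
          e = fps_to_fls (expx 1); e' = fps_to_fls (expx (- 1));
          s = lscal (fls_const (1 / 2)) * (e * e - e' * e');
          eh = lscal (fps_to_fls (fexp h)); eh' = lscal (fps_to_fls (fexp (- h)))
      in
        \<comment> \<open>the coproduct on words is a coassociative algebra homomorphism\<close>
        \<Delta>t \<in> ring_hom ring_of_type_algebra ring_of_type_algebra \<and>
        (\<forall>r. \<Delta>t (scal r) = scal r) \<and>
        \<Delta>t (genx 1) = 1 \<boxtimes> genx 1 + genx 1 \<boxtimes> 1 \<and>
        (\<forall>j\<in>{2, 3}. \<Delta>t (genx j) = genx j \<boxtimes> expx (- 1) + expx 1 \<boxtimes> genx j) \<and>
        \<Delta>t (expx 1) = expx 1 \<boxtimes> expx 1 \<and> \<Delta>t (expx (- 1)) = expx (- 1) \<boxtimes> expx (- 1) \<and>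
        (\<forall>f. tens_id F_cop (\<Delta>t f) = id_tens F_cop (\<Delta>t f)) \<and>
        \<comment> \<open>it descends to the quotient, which becomes a bialgebra; the target is a bialgebra as well\<close>
        descends I I2 \<Delta>t \<and> bialgebra I F_cop F_counit \<and>
        bialgebra J (U_cop h) U_counit \<and>
        \<comment> \<open>neither has torsion, so that the parameter may be inverted\<close>
        (\<forall>f. scal fps_X * f \<in> I \<longrightarrow> f \<in> I) \<and> (\<forall>f. scal fps_X * f \<in> J \<longrightarrow> f \<in> J) \<and>
        \<comment> \<open>the relations in the new coordinates\<close>
        c\<^sup>2 = 2 * fps_X * (A oo fps_X\<^sup>2) * fsinh h \<and>
        cls IL (commutator z1 z2) = cls IL (2 * z2) \<and>
        cls IL (commutator z1 z3) = cls IL (- 2 * z3) \<and>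
        cls IL (commutator z2 z3) = cls IL (lscal (inverse (fps_to_fls (fsinh h))) * s) \<and>
        cls IL (e * z2) = cls IL (eh * z2 * e) \<and> cls IL (e' * z2) = cls IL (eh' * z2 * e') \<and>
        cls IL (e * z3) = cls IL (eh' * z3 * e) \<and> cls IL (e' * z3) = cls IL (eh * z3 * e') \<and>
        cls IL (commutator z1 e) = cls IL 0 \<and> cls IL (commutator z1 e') = cls IL 0 \<and>
        \<comment> \<open>the coproduct in the new coordinates\<close>
        descends IL I2L (loc_map \<Delta>t) \<and>
        \<Delta> (cls IL z1) = cls I2L (1 \<boxtimes>\<^sub>l z1 + z1 \<boxtimes>\<^sub>l 1) \<and>
        \<Delta> (cls IL z2) = cls I2L (z2 \<boxtimes>\<^sub>l e' + e \<boxtimes>\<^sub>l z2) \<and>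
        \<Delta> (cls IL z3) = cls I2L (z3 \<boxtimes>\<^sub>l e' + e \<boxtimes>\<^sub>l z3) \<and>
        \<Delta> (cls IL e) = cls I2L (e \<boxtimes>\<^sub>l e) \<and> \<Delta> (cls IL e') = cls I2L (e' \<boxtimes>\<^sub>l e') \<and>
        \<comment> \<open>the isomorphism: the new coordinates are the generators of the enveloping algebra\<close>
        bialgebra_hom I F_cop F_counit J (U_cop h) U_counit (coord_change A) \<and>
        inj_on (induced J \<Phi>) (carrier (qring I)) \<and>
        descends IL JL (loc_map \<Phi>) \<and> inj_on \<Psi> (carrier (qring IL)) \<and>
        (\<forall>r. \<Psi> (cls IL (lscal r)) = cls JL (lscal r)) \<and>
        \<Psi> (cls IL z1) = cls JL (fps_to_fls (genz 1)) \<and>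
        \<Psi> (cls IL z2) = cls JL (fps_to_fls (genz 2)) \<and>
        \<Psi> (cls IL z3) = cls JL (fps_to_fls (genz 3)) \<and>
        \<Psi> (cls IL e) = cls JL (fps_to_fls (expz (fps_const (1 / 2) * h))) \<and>
        \<Psi> (cls IL e') = cls JL (fps_to_fls (expz (- (fps_const (1 / 2) * h)))) \<and>
        (\<forall>u (N::nat). \<exists>f v. cls JL u = cls JL (loc_map \<Phi> f + fps_to_fls (scal (fps_X ^ N) * v))) \<and>
        closed_ideal (loc_map \<Phi> ` IL) = JL)"
proof -
  have A0: "fps_nth A 0 = 4"
    using assms(2) by (simp add: is_commutator_series_def)
  note c2 = rescaling_square(1)[OF A0] and c = rescaling_square(2)[OF A0]
  let ?I = "F_ideal A" and ?J = "U_ideal h_par" and ?T = "lin (coord_change A)"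
  note hF = ahom_simps[OF ahom_F_cop]
  have hom: "lin F_cop \<in> ring_hom ring_of_type_algebra ring_of_type_algebra"
    by (rule ring_hom_memI) (simp_all add: hF)
  have gen: "\<forall>j\<in>{2, 3}. lin F_cop (genx j) = genx j \<boxtimes> expx (- 1) + expx 1 \<boxtimes> genx j"
    by (intro ballI lin_F_cop(2))
  note rel = coord_relations[OF c c2] and cop = coord_coproduct[where A = A] and inj = coord_change_inj[OF c c2]
  have h0: "fps_nth (fps_const (1 / 2) * h_par) 0 = 0"
    by (simp add: h_par_def)
  have \<Psi>: "induced (loc ?J) (loc_map ?T) (cls (loc ?I) F) = cls (loc ?J) (loc_map ?T F)" for F
    by (rule descends_cls[OF inj(3)])
  have \<Psi>_gen: "induced (loc ?J) (loc_map ?T) (cls (loc ?I) (new_coord A i)) = cls (loc ?J) (fps_to_fls (genz i))" for i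
    by (simp only: \<Psi> loc_map_new_coord[OF c])
  have \<Psi>_exp: "induced (loc ?J) (loc_map ?T) (cls (loc ?I) (fps_to_fls (expx 1))) =
      cls (loc ?J) (fps_to_fls (expz (fps_const (1 / 2) * h_par)))"
    "induced (loc ?J) (loc_map ?T) (cls (loc ?I) (fps_to_fls (expx (- 1)))) =
      cls (loc ?J) (fps_to_fls (expz (- (fps_const (1 / 2) * h_par))))"
    by (simp_all only: \<Psi> loc_map_ahom[OF ahom_coord_change] lin_coord_change half_h_par)
  have \<Psi>_scal: "\<forall>r. induced (loc ?J) (loc_map ?T) (cls (loc ?I) (lscal r)) = cls (loc ?J) (lscal r)"
    by (simp only: \<Psi> loc_map_ahom[OF ahom_coord_change] simp_thms)
  have dense: "\<forall>u (N::nat). \<exists>f v. cls (loc ?J) u =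
      cls (loc ?J) (loc_map ?T f + fps_to_fls (scal (fps_X ^ N) * v))"
    using coord_change_dense[OF c] by metis
  have tf: "\<forall>f. scal fps_X * f \<in> ?I \<longrightarrow> f \<in> ?I" "\<forall>f. scal fps_X * f \<in> ?J \<longrightarrow> f \<in> ?J"
    using F_torsion_free[OF c c2] U_torsion_free by blast+
  have scal: "\<forall>r. lin F_cop (scal r) = scal r" and coassoc: "\<forall>f. tens_id F_cop (lin F_cop f) = id_tens F_cop (lin F_cop f)"
    by (simp_all only: hF F_coassoc simp_thms)
  have cop23: "j \<in> {2, 3} \<Longrightarrow> induced (loc (tker ?I ?I)) (loc_map (lin F_cop)) (cls (loc ?I) (new_coord A j)) =
      cls (loc (tker ?I ?I)) (new_coord A j \<boxtimes>\<^sub>l fps_to_fls (expx (- 1)) + fps_to_fls (expx 1) \<boxtimes>\<^sub>l new_coord A j)" for j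
    by (rule cop(3))
  show ?thesis
    unfolding Let_def
    by (intro conjI hom scal lin_F_cop(1) gen lin_F_cop(3,4) coassoc F_cop_descends F_bialgebra
        U_bialgebra[OF h_par_nth] tf c2 rel cop(1,2,4,5) cop23 insertI1 insertI2
        coord_change_bialgebra_hom[OF c2] inj \<Psi>_gen \<Psi>_exp \<Psi>_scal dense closed_ideal_loc_image[OF c c2])
qed

end
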